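(* Let $(M,\omega)$ be a compact connected Kähler manifold without boundary, of complex dimension $n$, let $\mathcal{C}$ be the space of volume conformal factors, and let $\chi\in C^\infty(]0,+\infty[,\,]0,+\infty[)$. For a smooth two-parameter family $F=F(s,t)$ in $\mathcal{C}$ such that $F_s,F_t$ are linearly independent, the sectional curvature with respect to the weighted metric with weight $\chi$ of the two-plane spanned by $F_s$ and $F_t$ in $T_F\mathcal{C}$ is $$K^{\chi}[F](F_s,F_t)=\frac{1}{4\int_M\chi^{-1}(F)\frac{\omega^n}{n!}}\cdot\frac{\left(\int_M\frac{\chi'(F)}{\chi(F)}(F_s)^2\frac{\omega^n}{n!}\right)\left(\int_M\frac{\chi'(F)}{\chi(F)}(F_t)^2\frac{\omega^n}{n!}\right)-\left(\int_M\frac{\chi'(F)}{\chi(F)}F_sF_t\frac{\omega^n}{n!}\right)^2}{\left(\int_M\chi(F)(F_s)^2\frac{\omega^n}{n!}\right)\left(\int_M\chi(F)(F_t)^2\frac{\omega^n}{n!}\right)-\left(\int_M\chi(F)F_sF_t\frac{\omega^n}{n!}\right)^2}.$$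
   Context: The space of volume conformal factors is $\mathcal{C}=\{F\in C^\infty(M,\mathbb{R}): F>0,\ \int_MF\omega^n=\int_M\omega^n\}$, with tangent space $T_F\mathcal{C}=\{G\in C^\infty(M,\mathbb{R}):\int_MG\,\omega^n=0\}$. The weighted metric with weight $\chi$ is $\langle G_1,G_2\rangle_{F;\chi}=\int_M\chi(F)G_1G_2\frac{\omega^n}{n!}$. Here $\chi^{-1}=1/\chi$ is the multiplicative inverse. The Levi-Civita covariant derivative $D^\chi$ of this metric is the unique covariant derivative of smooth vector fields along smooth curves in $\mathcal{C}$ that is additive, satisfies the Leibniz rule, is compatible with the metric ($\frac{d}{dt}\langle G,H\rangle=\langle D^\chi_tG,H\rangle+\langle G,D^\chi_tH\rangle$) and is torsion free ($D^\chi_tF_s=D^\chi_sF_t$ for two-parameter families). The sectional curvature of the plane spanned by $F_s,F_t$ is $$K^\chi[F](F_s,F_t)=\frac{\langle D^\chi_sD^\chi_tF_t-D^\chi_tD^\chi_sF_t,\,F_s\rangle_{F;\chi}}{\langle F_s,F_s\rangle_{F;\chi}\langle F_t,F_t\rangle_{F;\chi}-\langle F_s,F_t\rangle_{F;\chi}^2}.$$ *)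

theory Defs
  imports "HOL-Analysis.Analysis"
begin

section \<open>Smooth functions on open subsets of normed spaces\<close>

primrec Ck_on :: "nat \<Rightarrow> 'p::real_normed_vector set \<Rightarrow> ('p \<Rightarrow> 'q::real_normed_vector) \<Rightarrow> bool" where
  "Ck_on 0 S f \<longleftrightarrow> continuous_on S f"
| "Ck_on (Suc k) S f \<longleftrightarrow>
     (\<forall>x\<in>S. f differentiable (at x)) \<and> (\<forall>v. Ck_on k S (\<lambda>x. frechet_derivative f (at x) v))"

definition smooth_on :: "'p::real_normed_vector set \<Rightarrow> ('p \<Rightarrow> 'q::real_normed_vector) \<Rightarrow> bool" where
  "smooth_on S f \<longleftrightarrow> (\<forall>k. Ck_on k S f)"

section \<open>Complex manifolds\<close>

text \<open>
  The manifold is the whole type \<open>'a\<close>; \<open>'n\<close> indexes the complex coordinates, so the complex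
  dimension is \<open>CARD('n)\<close>. A chart is a domain together with a coordinate map, whose values
  outside the domain are irrelevant.
\<close>

type_synonym ('a, 'n) chart = "'a set \<times> ('a \<Rightarrow> complex ^ 'n)"

definition chart_image :: "('a, 'n) chart \<Rightarrow> (complex ^ 'n) set" where
  "chart_image c = snd c ` fst c"

definition chart_inv :: "('a, 'n) chart \<Rightarrow> complex ^ 'n \<Rightarrow> 'a" where
  "chart_inv c = inv_into (fst c) (snd c)"

definition transition :: "('a, 'n) chart \<Rightarrow> ('a, 'n) chart \<Rightarrow> complex ^ 'n \<Rightarrow> complex ^ 'n" where
  "transition c d = snd d \<circ> chart_inv c"

definition holomorphic_map_on ::
  "(complex ^ 'n::finite) set \<Rightarrow> (complex ^ 'n \<Rightarrow> complex ^ 'n) \<Rightarrow> bool" where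
  "holomorphic_map_on S f \<longleftrightarrow>
     (\<forall>z\<in>S. \<exists>L. (f has_derivative L) (at z) \<and> (\<forall>(a::complex) v. L (a *s v) = a *s L v))"

definition holomorphic_atlas :: "('a::topological_space, 'n::finite) chart set \<Rightarrow> bool" where
  "holomorphic_atlas A \<longleftrightarrow>
     (\<Union>c\<in>A. fst c) = UNIV \<and>
     (\<forall>c\<in>A. open (fst c) \<and> open (chart_image c) \<and>
        homeomorphism (fst c) (chart_image c) (snd c) (chart_inv c)) \<and>
     (\<forall>c\<in>A. \<forall>d\<in>A. holomorphic_map_on (snd c ` (fst c \<inter> fst d)) (transition c d))"

section \<open>Kaehler forms\<close>

text \<open>
  A differential 2-form is given by its coordinate expressions: \<open>\<omega> c z u v\<close> is the value, in the
  chart \<open>c\<close> and at the coordinate point \<open>z\<close>, on the tangent vectors \<open>u\<close> and \<open>v\<close> of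
  the real vector space underlying \<open>complex ^ 'n\<close>. Being of type (1,1) is invariance under the
  complex structure, and closedness is the vanishing of the exterior derivative on constant
  coordinate vector fields.
\<close>

type_synonym ('a, 'n) two_form =
  "('a, 'n) chart \<Rightarrow> complex ^ 'n \<Rightarrow> complex ^ 'n \<Rightarrow> complex ^ 'n \<Rightarrow> real"

definition is_two_form ::
  "('a, 'n::finite) chart set \<Rightarrow> ('a, 'n) two_form \<Rightarrow> bool" where
  "is_two_form A \<omega> \<longleftrightarrow>
     (\<forall>c\<in>A. (\<forall>z\<in>chart_image c. bilinear (\<omega> c z) \<and> (\<forall>v. \<omega> c z v v = 0)) \<and>
        (\<forall>u v. smooth_on (chart_image c) (\<lambda>z. \<omega> c z u v))) \<and>
     (\<forall>c\<in>A. \<forall>d\<in>A. \<forall>z \<in> snd c ` (fst c \<inter> fst d). \<forall>u v.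
        \<omega> c z u v = \<omega> d (transition c d z)
          (frechet_derivative (transition c d) (at z) u)
          (frechet_derivative (transition c d) (at z) v))"

definition kaehler_form ::
  "('a, 'n::finite) chart set \<Rightarrow> ('a, 'n) two_form \<Rightarrow> bool" where
  "kaehler_form A \<omega> \<longleftrightarrow> is_two_form A \<omega> \<and>
     (\<forall>c\<in>A. \<forall>z\<in>chart_image c.
        (\<forall>u v. \<omega> c z (\<i> *s u) (\<i> *s v) = \<omega> c z u v) \<and>
        (\<forall>u. u \<noteq> 0 \<longrightarrow> 0 < \<omega> c z u (\<i> *s u)) \<and>
        (\<forall>u v w. frechet_derivative (\<lambda>y. \<omega> c y v w) (at z) u
               + frechet_derivative (\<lambda>y. \<omega> c y w u) (at z) v
               + frechet_derivative (\<lambda>y. \<omega> c y u v) (at z) w = 0))"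

definition compact_connected_kaehler_manifold ::
  "('a::t2_space, 'n::finite) chart set \<Rightarrow> ('a, 'n) two_form \<Rightarrow> bool" where
  "compact_connected_kaehler_manifold A \<omega> \<longleftrightarrow>
     compact (UNIV :: 'a set) \<and> connected (UNIV :: 'a set) \<and>
     holomorphic_atlas A \<and> kaehler_form A \<omega>"

section \<open>Integration against the top power of the Kaehler form\<close>

text \<open>
  \<open>omega_top \<omega> c z\<close> is the value of the wedge power \<open>\<omega>\<^sup>n\<close> on the oriented real
  basis \<open>e\<^sub>1, i e\<^sub>1, \<dots>, e\<^sub>n, i e\<^sub>n\<close>, i.e. the coefficient of \<open>\<omega>\<^sup>n\<close> with respect
  to Lebesgue measure. It is computed from
  \<open>\<omega>\<^sup>n (v\<^sub>1, \<dots>, v\<^sub>2\<^sub>n) =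
     2\<^sup>-\<^sup>n (\<Sum>p. sign p * (\<Prod>j. \<omega> (v (p (2j - 1))) (v (p (2j)))))\<close>,
  where the pair of positions \<open>2j - 1, 2j\<close> is encoded as \<open>(j, False), (j, True)\<close>.
\<close>

definition real_basis :: "'n::finite \<times> bool \<Rightarrow> complex ^ 'n" where
  "real_basis k = axis (fst k) (if snd k then \<i> else 1)"

definition omega_top ::
  "('a, 'n::finite) two_form \<Rightarrow> ('a, 'n) chart \<Rightarrow> complex ^ 'n \<Rightarrow> real" where
  "omega_top \<omega> c z =
     (\<Sum>p | p permutes (UNIV :: ('n \<times> bool) set).
        of_int (sign p) *
        (\<Prod>j\<in>UNIV. \<omega> c z (real_basis (p (j, False))) (real_basis (p (j, True)))))
     / 2 ^ CARD('n)"

text \<open>The Borel measure on the manifold which in every chart is \<open>\<omega>\<^sup>n\<close>.\<close>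

definition omega_top_measure ::
  "('a::topological_space, 'n::finite) chart set \<Rightarrow> ('a, 'n) two_form \<Rightarrow> 'a measure" where
  "omega_top_measure A \<omega> =
     (THE \<mu>. sets \<mu> = sets borel \<and>
        (\<forall>c\<in>A. \<forall>B\<in>sets borel. B \<subseteq> fst c \<longrightarrow>
           emeasure \<mu> B =
             (\<integral>\<^sup>+z. ennreal (omega_top \<omega> c z) * indicator (snd c ` B) z \<partial>lborel)))"

definition int_top ::
  "('a::topological_space, 'n::finite) chart set \<Rightarrow> ('a, 'n) two_form \<Rightarrow> ('a \<Rightarrow> real) \<Rightarrow> real" where
  "int_top A \<omega> f = (\<integral>x. f x \<partial>omega_top_measure A \<omega>)"

definition int_vol ::
  "('a::topological_space, 'n::finite) chart set \<Rightarrow> ('a, 'n) two_form \<Rightarrow> ('a \<Rightarrow> real) \<Rightarrow> real" where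
  "int_vol A \<omega> f = int_top A \<omega> f / fact CARD('n)"

section \<open>The space of volume conformal factors\<close>

definition smooth_fun :: "('a, 'n::finite) chart set \<Rightarrow> ('a \<Rightarrow> real) \<Rightarrow> bool" where
  "smooth_fun A f \<longleftrightarrow> (\<forall>c\<in>A. smooth_on (chart_image c) (f \<circ> chart_inv c))"

text \<open>
  A family of functions is smooth if it is smooth jointly in the parameter and the point of the
  manifold.
\<close>

definition smooth_family ::
  "('a, 'n::finite) chart set \<Rightarrow> 'p::real_normed_vector set \<Rightarrow> ('p \<Rightarrow> 'a \<Rightarrow> real) \<Rightarrow> bool" where
  "smooth_family A P F \<longleftrightarrow>
     (\<forall>c\<in>A. smooth_on (P \<times> chart_image c) (\<lambda>(p, z). F p (chart_inv c z)))"

definition conformal_factors ::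
  "('a::topological_space, 'n::finite) chart set \<Rightarrow> ('a, 'n) two_form \<Rightarrow> ('a \<Rightarrow> real) set" where
  "conformal_factors A \<omega> =
     {F. smooth_fun A F \<and> (\<forall>x. 0 < F x) \<and> int_top A \<omega> F = int_top A \<omega> (\<lambda>x. 1)}"

text \<open>All tangent spaces of the space of conformal factors coincide.\<close>

definition tangent_functions ::
  "('a::topological_space, 'n::finite) chart set \<Rightarrow> ('a, 'n) two_form \<Rightarrow> ('a \<Rightarrow> real) set" where
  "tangent_functions A \<omega> = {G. smooth_fun A G \<and> int_top A \<omega> G = 0}"

definition smooth_weight :: "(real \<Rightarrow> real) \<Rightarrow> bool" where
  "smooth_weight chi \<longleftrightarrow> smooth_on {0<..} chi \<and> (\<forall>y>0. 0 < chi y)"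

definition weighted_metric ::
  "('a::topological_space, 'n::finite) chart set \<Rightarrow> ('a, 'n) two_form \<Rightarrow> (real \<Rightarrow> real) \<Rightarrow>
   ('a \<Rightarrow> real) \<Rightarrow> ('a \<Rightarrow> real) \<Rightarrow> ('a \<Rightarrow> real) \<Rightarrow> real" where
  "weighted_metric A \<omega> chi F G H = int_vol A \<omega> (\<lambda>x. chi (F x) * G x * H x)"

section \<open>The Levi-Civita covariant derivative\<close>

definition open_interval :: "real set \<Rightarrow> bool" where
  "open_interval I \<longleftrightarrow> open I \<and> is_interval I"

definition curve_in_factors ::
  "('a::topological_space, 'n::finite) chart set \<Rightarrow> ('a, 'n) two_form \<Rightarrow> real set \<Rightarrow>
   (real \<Rightarrow> 'a \<Rightarrow> real) \<Rightarrow> bool" where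
  "curve_in_factors A \<omega> I F \<longleftrightarrow>
     open_interval I \<and> smooth_family A I F \<and> (\<forall>t\<in>I. F t \<in> conformal_factors A \<omega>)"

definition field_along ::
  "('a::topological_space, 'n::finite) chart set \<Rightarrow> ('a, 'n) two_form \<Rightarrow> real set \<Rightarrow>
   (real \<Rightarrow> 'a \<Rightarrow> real) \<Rightarrow> (real \<Rightarrow> 'a \<Rightarrow> real) \<Rightarrow> bool" where
  "field_along A \<omega> I F G \<longleftrightarrow>
     curve_in_factors A \<omega> I F \<and> smooth_family A I G \<and> (\<forall>t\<in>I. G t \<in> tangent_functions A \<omega>)"

definition two_param_family ::
  "('a::topological_space, 'n::finite) chart set \<Rightarrow> ('a, 'n) two_form \<Rightarrow> real set \<Rightarrow> real set \<Rightarrow>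
   (real \<Rightarrow> real \<Rightarrow> 'a \<Rightarrow> real) \<Rightarrow> bool" where
  "two_param_family A \<omega> I J F \<longleftrightarrow>
     open_interval I \<and> open_interval J \<and> smooth_family A (I \<times> J) (\<lambda>(s, t). F s t) \<and>
     (\<forall>s\<in>I. \<forall>t\<in>J. F s t \<in> conformal_factors A \<omega>)"

definition pd1 :: "(real \<Rightarrow> real \<Rightarrow> 'a \<Rightarrow> real) \<Rightarrow> real \<Rightarrow> real \<Rightarrow> 'a \<Rightarrow> real" where
  "pd1 F s t x = deriv (\<lambda>s'. F s' t x) s"

definition pd2 :: "(real \<Rightarrow> real \<Rightarrow> 'a \<Rightarrow> real) \<Rightarrow> real \<Rightarrow> real \<Rightarrow> 'a \<Rightarrow> real" where
  "pd2 F s t x = deriv (\<lambda>t'. F s t' x) t"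

text \<open>
  A derivation \<open>D\<close> of vector fields along curves takes the parameter interval, the curve, the field
  and the parameter. The first clause of \<open>covariant_derivative\<close> only fixes irrelevant values
  of this total function, so that the Levi-Civita derivative is unique as a HOL object.
\<close>

type_synonym 'a derivation =
  "real set \<Rightarrow> (real \<Rightarrow> 'a \<Rightarrow> real) \<Rightarrow> (real \<Rightarrow> 'a \<Rightarrow> real) \<Rightarrow> real \<Rightarrow> 'a \<Rightarrow> real"

definition covariant_derivative ::
  "('a::topological_space, 'n::finite) chart set \<Rightarrow> ('a, 'n) two_form \<Rightarrow> 'a derivation \<Rightarrow> bool" where
  "covariant_derivative A \<omega> D \<longleftrightarrow>
     (\<forall>I F G t. \<not> (field_along A \<omega> I F G \<and> t \<in> I) \<longrightarrow> D I F G t = undefined) \<and>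
     (\<forall>I F G. field_along A \<omega> I F G \<longrightarrow> field_along A \<omega> I F (D I F G)) \<and>
     (\<forall>I F G H. field_along A \<omega> I F G \<longrightarrow> field_along A \<omega> I F H \<longrightarrow>
        (\<forall>t\<in>I. \<forall>x. D I F (\<lambda>t x. G t x + H t x) t x = D I F G t x + D I F H t x)) \<and>
     (\<forall>I F G f. field_along A \<omega> I F G \<longrightarrow> smooth_on I f \<longrightarrow>
        (\<forall>t\<in>I. \<forall>x. D I F (\<lambda>t x. f t * G t x) t x = deriv f t * G t x + f t * D I F G t x))"

definition metric_compatible ::
  "('a::topological_space, 'n::finite) chart set \<Rightarrow> ('a, 'n) two_form \<Rightarrow> (real \<Rightarrow> real) \<Rightarrow>
   'a derivation \<Rightarrow> bool" where
  "metric_compatible A \<omega> chi D \<longleftrightarrow>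
     (\<forall>I F G H. field_along A \<omega> I F G \<longrightarrow> field_along A \<omega> I F H \<longrightarrow>
        (\<forall>t\<in>I. ((\<lambda>t. weighted_metric A \<omega> chi (F t) (G t) (H t)) has_real_derivative
           weighted_metric A \<omega> chi (F t) (D I F G t) (H t)
           + weighted_metric A \<omega> chi (F t) (G t) (D I F H t)) (at t)))"

definition cov1 ::
  "'a derivation \<Rightarrow> real set \<Rightarrow> (real \<Rightarrow> real \<Rightarrow> 'a \<Rightarrow> real) \<Rightarrow> (real \<Rightarrow> real \<Rightarrow> 'a \<Rightarrow> real) \<Rightarrow>
   real \<Rightarrow> real \<Rightarrow> 'a \<Rightarrow> real" where
  "cov1 D I F X s t = D I (\<lambda>s'. F s' t) (\<lambda>s'. X s' t) s"

definition cov2 ::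
  "'a derivation \<Rightarrow> real set \<Rightarrow> (real \<Rightarrow> real \<Rightarrow> 'a \<Rightarrow> real) \<Rightarrow> (real \<Rightarrow> real \<Rightarrow> 'a \<Rightarrow> real) \<Rightarrow>
   real \<Rightarrow> real \<Rightarrow> 'a \<Rightarrow> real" where
  "cov2 D J F X s t = D J (F s) (X s) t"

definition torsion_free ::
  "('a::topological_space, 'n::finite) chart set \<Rightarrow> ('a, 'n) two_form \<Rightarrow> 'a derivation \<Rightarrow> bool" where
  "torsion_free A \<omega> D \<longleftrightarrow>
     (\<forall>I J F. two_param_family A \<omega> I J F \<longrightarrow>
        (\<forall>s\<in>I. \<forall>t\<in>J. cov2 D J F (pd1 F) s t = cov1 D I F (pd2 F) s t))"

definition levi_civita ::
  "('a::topological_space, 'n::finite) chart set \<Rightarrow> ('a, 'n) two_form \<Rightarrow> (real \<Rightarrow> real) \<Rightarrow>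
   'a derivation" where
  "levi_civita A \<omega> chi =
     (THE D. covariant_derivative A \<omega> D \<and> metric_compatible A \<omega> chi D \<and> torsion_free A \<omega> D)"

section \<open>Sectional curvature\<close>

definition linearly_independent_pair :: "('a \<Rightarrow> real) \<Rightarrow> ('a \<Rightarrow> real) \<Rightarrow> bool" where
  "linearly_independent_pair G H \<longleftrightarrow>
     (\<forall>a b. (\<forall>x. a * G x + b * H x = 0) \<longrightarrow> a = 0 \<and> b = 0)"

definition sectional_curvature ::
  "('a::topological_space, 'n::finite) chart set \<Rightarrow> ('a, 'n) two_form \<Rightarrow> (real \<Rightarrow> real) \<Rightarrow>
   real set \<Rightarrow> real set \<Rightarrow> (real \<Rightarrow> real \<Rightarrow> 'a \<Rightarrow> real) \<Rightarrow> real \<Rightarrow> real \<Rightarrow> real" where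
  "sectional_curvature A \<omega> chi I J F s t =
     (let D = levi_civita A \<omega> chi;
          ip = weighted_metric A \<omega> chi (F s t);
          Fs = pd1 F s t;
          Ft = pd2 F s t;
          R = (\<lambda>x. cov1 D I F (cov2 D J F (pd2 F)) s t x - cov2 D J F (cov1 D I F (pd2 F)) s t x)
      in ip R Fs / (ip Fs Fs * ip Ft Ft - (ip Fs Ft)\<^sup>2))"

end

theory Submission
  imports Defs
begin

text \<open>
  Write \<open>phi = chi' / (2 chi)\<close> and \<open>psi = 1 / chi\<close>. On the space of all positive functions the weighted
  metric is a product, over the points of the manifold, of metrics on the half line. It is flat, with
  covariant derivative \<open>G\<^sub>t + phi(F) F\<^sub>t G\<close>. The conformal factors are the functions whose
  integral has a prescribed value, and the normal direction to them at \<open>F\<close> is \<open>psi(F)\<close>, because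
  \<open>chi(F) psi(F) = 1\<close>. So the Levi-Civita derivative is the projection
  \<open>D\<^sub>t G = G\<^sub>t + phi(F) F\<^sub>t G - \<lambda>(F\<^sub>t, G) psi(F)\<close>, where
  \<open>\<lambda>(X, Y) = \<integral> phi(F) X Y / \<integral> psi(F)\<close>, and all curvature comes from the second
  fundamental form \<open>\<lambda>\<close>: up to a multiple of \<open>psi(F)\<close>, the curvature operator is
  \<open>psi(F) phi(F) (\<lambda>(F\<^sub>t, F\<^sub>t) F\<^sub>s - \<lambda>(F\<^sub>s, F\<^sub>t) F\<^sub>t)\<close>
  (\<open>curvature_operator\<close>). Pairing it with \<open>F\<^sub>s\<close> is the formula
  (\<open>sectional_curvature_formula\<close>).

  The Levi-Civita derivative is given only as the unique derivation with certain properties, so it has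
  to be shown that the formula has them and that nothing else does. For uniqueness
  (\<open>lc_conn_unique\<close>), the difference of two such derivations is, at a point, skew for the metric
  and symmetric, hence zero. The work is to see that the difference is an object at a point at all: a
  derivation is a function of a whole curve on a whole parameter interval. Skewness and constant
  fields remove the dependence on the field (\<open>conn_diff_pointwise\<close>), and torsion freeness in the
  families of \<open>ray_variation\<close> replaces the curve by a ray (\<open>conn_diff_exchange\<close>).

  These arguments need integration against \<open>\<omega>\<^sup>n\<close> to be what it should be. The measure is
  again given by a unique description. It exists because the coefficient of \<open>\<omega>\<^sup>n\<close> in a chart
  is positive (\<open>pf_sum_pos\<close>) and is multiplied by the Jacobian determinant when the chart changes
  (\<open>pf_sum_change_basis\<close>), so that the change of variables formula makes the measures in the charts
  agree on overlaps (\<open>chart_measure_compatible\<close>). Positivity also makes the metric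
  definite, since every nonempty open set has positive measure (\<open>vol_open_pos\<close>). Compactness makes
  the measure finite and gives the smooth dependence of integrals on parameters
  (\<open>smooth_on_int_vol\<close>).
\<close>

section \<open>Calculus of smooth functions\<close>

lemma Ck_on_cong:
  assumes "open S" "\<And>x. x \<in> S \<Longrightarrow> f x = g x" "Ck_on k S f"
  shows "Ck_on k S g"
  using assms(2,3)
proof (induction k arbitrary: f g)
  case 0
  then show ?case by (auto cong: continuous_on_cong)
next
  case (Suc k)
  have d: "(g has_derivative frechet_derivative f (at x)) (at x)" if "x \<in> S" for x
  proof (rule has_derivative_transform_within_open[OF _ \<open>open S\<close> that])
    show "(f has_derivative frechet_derivative f (at x)) (at x)"
      using Suc.prems that by (simp add: frechet_derivative_works[symmetric])
  qed (use Suc.prems in auto)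
  have e: "frechet_derivative f (at x) = frechet_derivative g (at x)" if "x \<in> S" for x
    using d[OF that] by (rule frechet_derivative_at)
  have "Ck_on k S (\<lambda>x. frechet_derivative g (at x) v)" for v
    by (rule Suc.IH[of "\<lambda>x. frechet_derivative f (at x) v"]) (use e Suc.prems in auto)
  then show ?case using d by (auto simp: differentiable_def)
qed

lemma Ck_on_SucD: "Ck_on (Suc k) S f \<Longrightarrow> Ck_on k S f"
proof (induction k arbitrary: f)
  case 0
  then show ?case
    by (auto intro!: continuous_at_imp_continuous_on differentiable_imp_continuous_within)
qed auto

text \<open>
  The derivative in the definition of \<open>Ck_on\<close> is a chosen one; this form lets any known derivative
  be used.
\<close>

lemma Ck_on_SucI:
  assumes "open S" "\<And>x. x \<in> S \<Longrightarrow> (f has_derivative D x) (at x)"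
    and "\<And>v. Ck_on k S (\<lambda>x. D x v)"
  shows "Ck_on (Suc k) S f"
proof -
  have "Ck_on k S (\<lambda>x. frechet_derivative f (at x) v)" for v
    by (rule Ck_on_cong[OF assms(1) _ assms(3)[of v]])
      (use frechet_derivative_at[OF assms(2)] in auto)
  then show ?thesis using assms(2) by (auto simp: differentiable_def)
qed

lemma Ck_on_has_derivative:
  "Ck_on (Suc k) S f \<Longrightarrow> x \<in> S \<Longrightarrow> (f has_derivative frechet_derivative f (at x)) (at x)"
  by (simp add: frechet_derivative_works[symmetric])

lemma Ck_on_const: "Ck_on k S (\<lambda>x. c)"
  by (induction k arbitrary: c) auto

lemma Ck_on_linear:
  assumes "open S" "bounded_linear L"
  shows "Ck_on k S L"
proof (cases k)
  case 0
  then show ?thesis using assms by (simp add: linear_continuous_on)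
next
  case (Suc k')
  have "Ck_on (Suc k') S L"
    by (rule Ck_on_SucI[OF assms(1), of _ "\<lambda>x. L"])
      (auto intro: bounded_linear_imp_has_derivative assms Ck_on_const)
  then show ?thesis using Suc by simp
qed

lemma Ck_on_add:
  assumes "open S" "Ck_on k S f" "Ck_on k S g"
  shows "Ck_on k S (\<lambda>x. f x + g x)"
  using assms(2,3)
proof (induction k arbitrary: f g)
  case 0
  then show ?case by (auto intro: continuous_on_add)
next
  case (Suc k)
  show ?case
    by (rule Ck_on_SucI[OF \<open>open S\<close> has_derivative_add[OF Ck_on_has_derivative Ck_on_has_derivative]])
      (use Suc in auto)
qed

lemma Ck_on_mult:
  fixes f g :: "'p::real_normed_vector \<Rightarrow> real"
  assumes "open S" "Ck_on k S f" "Ck_on k S g"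
  shows "Ck_on k S (\<lambda>x. f x * g x)"
  using assms(2,3)
proof (induction k arbitrary: f g)
  case 0
  then show ?case by (auto intro: continuous_on_mult)
next
  case (Suc k)
  show ?case
    by (rule Ck_on_SucI[OF \<open>open S\<close> has_derivative_mult[OF Ck_on_has_derivative Ck_on_has_derivative]])
      (use Suc Ck_on_SucD[OF Suc.prems(1)] Ck_on_SucD[OF Suc.prems(2)] in
        \<open>auto intro!: Ck_on_add assms(1)\<close>)
qed

text \<open>
  By the chain rule the derivative of \<open>h \<circ> f\<close> in direction \<open>v\<close> is the product of
  \<open>h' \<circ> f\<close> with the derivative of \<open>f\<close>, so one order of smoothness is gained from products of
  the previous order.
\<close>

lemma Ck_on_compose_real:
  fixes f :: "'p::real_normed_vector \<Rightarrow> real" and h :: "real \<Rightarrow> real"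
  assumes "open S" "f ` S \<subseteq> T" "Ck_on k S f" "Ck_on k T h"
  shows "Ck_on k S (\<lambda>x. h (f x))"
  using assms(3,4)
proof (induction k arbitrary: h)
  case 0
  then show ?case using assms(2) by (auto intro: continuous_on_compose2)
next
  case (Suc k)
  define h1 where "h1 y = frechet_derivative h (at y) 1" for y
  have h1: "(h has_derivative (\<lambda>v. v * h1 y)) (at y)" if "y \<in> T" for y
  proof -
    have 1: "(h has_derivative frechet_derivative h (at y)) (at y)"
      using Ck_on_has_derivative[OF Suc.prems(2) that] .
    have "frechet_derivative h (at y) v = v * h1 y" for v
      using linear_cmul[OF has_derivative_linear[OF 1], of v 1] by (simp add: h1_def)
    with 1 show ?thesis by (metis (no_types, lifting) ext)
  qed
  have 2: "((\<lambda>x. h (f x)) has_derivative (\<lambda>v. frechet_derivative f (at x) v * h1 (f x))) (at x)"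
    if "x \<in> S" for x
    using diff_chain_at[OF Ck_on_has_derivative[OF Suc.prems(1) that] h1] that assms(2)
    by (auto simp: o_def)
  have "Ck_on k S (\<lambda>x. h1 (f x))"
    using Suc.IH[of h1] Suc.prems Ck_on_SucD[OF Suc.prems(1)] by (auto simp: h1_def)
  then show ?case
    by (intro Ck_on_SucI[OF assms(1) 2] Ck_on_mult assms(1)) (use Suc.prems in auto)
qed

text \<open>
  Affine substitutions cover all changes of parameters that occur below: restricting a family to a
  slice, and regarding a function of some of the variables as a function of all of them.
\<close>

lemma Ck_on_affine:
  assumes "open S" "open T" "bounded_linear L" "\<And>x. x \<in> T \<Longrightarrow> a + L x \<in> S" "Ck_on k S f"
  shows "Ck_on k T (\<lambda>x. f (a + L x))"
  using assms(5)
proof (induction k arbitrary: f)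
  case 0
  have "continuous_on T (\<lambda>x. a + L x)"
    by (intro continuous_intros linear_continuous_on assms)
  then show ?case using 0 assms(4) by (auto intro: continuous_on_compose2)
next
  case (Suc k)
  have L: "((\<lambda>x. a + L x) has_derivative L) (at x)" for x
    using has_derivative_add[OF has_derivative_const bounded_linear_imp_has_derivative[OF assms(3)]]
    by simp
  have "((\<lambda>x. f (a + L x)) has_derivative (\<lambda>v. frechet_derivative f (at (a + L x)) (L v))) (at x)"
    if "x \<in> T" for x
    using diff_chain_at[OF L Ck_on_has_derivative[OF Suc.prems assms(4)[OF that]]]
    by (simp add: o_def)
  then show ?case
    by (rule Ck_on_SucI[OF assms(2)]) (use Suc in auto)
qed

lemma Ck_on_inverse: "Ck_on k {0::real<..} inverse"
proof (induction k)
  case 0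
  then show ?case by (auto intro!: continuous_intros)
next
  case (Suc k)
  have "(inverse has_derivative (\<lambda>v. (inverse x * inverse x) * (- v))) (at x)" if "x \<in> {0<..}" for x :: real
    using has_derivative_inverse'[of x] that by (simp add: mult_ac)
  then show ?case
    by (rule Ck_on_SucI[OF open_greaterThan]) (assumption | intro Ck_on_mult Ck_on_const Suc open_greaterThan)+
qed

lemma smooth_on_cong:
  "open S \<Longrightarrow> (\<And>x. x \<in> S \<Longrightarrow> f x = g x) \<Longrightarrow> smooth_on S f \<Longrightarrow> smooth_on S g"
  unfolding smooth_on_def using Ck_on_cong by blast

lemma smooth_on_const: "smooth_on S (\<lambda>x. c)"
  by (simp add: smooth_on_def Ck_on_const)

lemma smooth_on_linear: "open S \<Longrightarrow> bounded_linear L \<Longrightarrow> smooth_on S L"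
  by (simp add: smooth_on_def Ck_on_linear)

lemma smooth_on_add:
  "open S \<Longrightarrow> smooth_on S f \<Longrightarrow> smooth_on S g \<Longrightarrow> smooth_on S (\<lambda>x. f x + g x)"
  by (simp add: smooth_on_def Ck_on_add)

lemma smooth_on_mult:
  fixes f g :: "'p::real_normed_vector \<Rightarrow> real"
  shows "open S \<Longrightarrow> smooth_on S f \<Longrightarrow> smooth_on S g \<Longrightarrow> smooth_on S (\<lambda>x. f x * g x)"
  by (simp add: smooth_on_def Ck_on_mult)

lemma smooth_on_compose_real:
  fixes f :: "'p::real_normed_vector \<Rightarrow> real" and h :: "real \<Rightarrow> real"
  shows "open S \<Longrightarrow> f ` S \<subseteq> T \<Longrightarrow> smooth_on S f \<Longrightarrow> smooth_on T h \<Longrightarrow> smooth_on S (\<lambda>x. h (f x))"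
  unfolding smooth_on_def using Ck_on_compose_real by blast

lemma smooth_on_affine:
  assumes "smooth_on S f" "open S" "open T" "bounded_linear L" "\<And>x. x \<in> T \<Longrightarrow> a + L x \<in> S"
  shows "smooth_on T (\<lambda>x. f (a + L x))"
  using assms Ck_on_affine unfolding smooth_on_def by blast

lemma smooth_on_inverse: "smooth_on {0::real<..} inverse"
  by (simp add: smooth_on_def Ck_on_inverse)

lemma smooth_on_has_derivative:
  "smooth_on S f \<Longrightarrow> x \<in> S \<Longrightarrow> (f has_derivative frechet_derivative f (at x)) (at x)"
  unfolding smooth_on_def using Ck_on_has_derivative by blast

lemma smooth_on_frechet:
  "smooth_on S f \<Longrightarrow> smooth_on S (\<lambda>x. frechet_derivative f (at x) v)"
  unfolding smooth_on_def by (metis Ck_on.simps(2))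

lemma smooth_on_continuous: "smooth_on S f \<Longrightarrow> continuous_on S f"
  unfolding smooth_on_def by (metis Ck_on.simps(1))

lemma smooth_on_real_derivative:
  fixes f :: "real \<Rightarrow> real"
  assumes "smooth_on S f" "x \<in> S"
  shows "(f has_real_derivative deriv f x) (at x)"
  using smooth_on_has_derivative[OF assms]
  by (metis DERIV_deriv_iff_real_differentiable differentiable_def)

lemma smooth_on_deriv:
  fixes f :: "real \<Rightarrow> real"
  assumes "smooth_on S f" "open S"
  shows "smooth_on S (deriv f)"
proof (rule smooth_on_cong[OF assms(2) _ smooth_on_frechet[OF assms(1), of 1]])
  fix x assume "x \<in> S"
  then have "(f has_derivative (*) (deriv f x)) (at x)"
    using smooth_on_real_derivative[OF assms(1)] by (simp add: has_field_derivative_def)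
  from frechet_derivative_at[OF this] show "frechet_derivative f (at x) 1 = deriv f x"
    by (metis mult.right_neutral)
qed

lemma Ck_on_real_SucI:
  fixes f :: "real \<Rightarrow> real"
  assumes "open S" "\<And>x. x \<in> S \<Longrightarrow> (f has_real_derivative f' x) (at x)" "Ck_on k S f'"
  shows "Ck_on (Suc k) S f"
proof (rule Ck_on_SucI[OF assms(1)])
  show "(f has_derivative (*) (f' x)) (at x)" if "x \<in> S" for x
    using assms(2)[OF that] by (simp add: has_field_derivative_def)
  show "Ck_on k S (\<lambda>x. f' x * v)" for v
    by (intro Ck_on_mult Ck_on_const assms)
qed

section \<open>The top power of a positive form of type (1,1)\<close>

text \<open>
  For a skew form \<open>\<beta>\<close> this is \<open>2\<^sup>n n!\<close> times the Pfaffian of its matrix in the basis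
  \<open>b\<close>. It is kept as a sum over all permutations, which is the form in which the top power of a
  two-form is given.
\<close>

definition pf_sum :: "('v \<Rightarrow> 'v \<Rightarrow> real) \<Rightarrow> ('n::finite \<times> bool \<Rightarrow> 'v) \<Rightarrow> real" where
  "pf_sum \<beta> b = (\<Sum>p | p permutes UNIV.
     of_int (sign p) * (\<Prod>j\<in>UNIV. \<beta> (b (p (j, False))) (b (p (j, True)))))"

lemma omega_top_eq_pf_sum: "omega_top \<omega> c z = pf_sum (\<omega> c z) real_basis / 2 ^ CARD('n)"
  for \<omega> :: "('a, 'n::finite) two_form"
  by (simp add: omega_top_def pf_sum_def)

lemma prod_pairs: "(\<Prod>k\<in>UNIV. f k) = (\<Prod>j\<in>UNIV. f (j, False) * f (j, True))"
  for f :: "'n::finite \<times> bool \<Rightarrow> 'b::comm_monoid_mult"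
proof -
  have "(\<Prod>k\<in>UNIV. f k) = (\<Prod>j\<in>UNIV. \<Prod>b\<in>UNIV. f (j, b))"
    by (simp add: prod.cartesian_product)
  then show ?thesis by (simp add: UNIV_bool)
qed

text \<open>
  Choosing two summation indices for every \<open>j\<close> is the same as choosing a map on the pairs
  \<open>(j, False)\<close>, \<open>(j, True)\<close>.
\<close>

lemma prod_sum_pairs:
  fixes h :: "'n::finite \<Rightarrow> 'k::finite \<Rightarrow> 'k \<Rightarrow> real"
  shows "(\<Prod>j\<in>UNIV. \<Sum>l\<in>UNIV. \<Sum>m\<in>UNIV. h j l m)
    = (\<Sum>f\<in>UNIV. \<Prod>j\<in>UNIV. h j (f (j, False)) (f (j, True)))"
proof -
  have "(\<Prod>j\<in>UNIV. \<Sum>l\<in>UNIV. \<Sum>m\<in>UNIV. h j l m)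
    = (\<Prod>j\<in>UNIV. \<Sum>y\<in>UNIV. h j (fst y) (snd y))"
    by (simp add: sum.cartesian_product case_prod_unfold)
  also have "\<dots> = (\<Sum>g\<in>UNIV. \<Prod>j\<in>UNIV. h j (fst (g j)) (snd (g j)))"
    by (subst prod_sum_PiE) (auto simp: PiE_UNIV_domain)
  also have "\<dots> = (\<Sum>f\<in>UNIV. \<Prod>j\<in>UNIV. h j (f (j, False)) (f (j, True)))"
    by (rule sum.reindex_bij_witness[of _ "\<lambda>f j. (f (j, False), f (j, True))"
          "\<lambda>g (j, b). if b then snd (g j) else fst (g j)"]) (auto simp: fun_eq_iff)
  finally show ?thesis .
qed

text \<open>
  Expanding by multilinearity gives a sum over all maps \<open>f\<close> of index sets. The signed sum over
  the permutations turns the coefficient of \<open>f\<close> into the determinant of the matrix with rows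
  rearranged by \<open>f\<close>, which is zero unless \<open>f\<close> is a permutation, and then is the sign of
  \<open>f\<close> times the determinant.
\<close>

lemma pf_sum_change_basis:
  fixes \<beta> :: "'v::real_vector \<Rightarrow> 'v \<Rightarrow> real" and M :: "real ^ ('n::finite \<times> bool) ^ ('n \<times> bool)"
  assumes "bilinear \<beta>" "\<And>k. b' k = (\<Sum>l\<in>UNIV. M $ k $ l *\<^sub>R b l)"
  shows "pf_sum \<beta> b' = det M * pf_sum \<beta> b"
proof -
  define P where "P f = (\<Prod>j\<in>UNIV. \<beta> (b (f (j, False))) (b (f (j, True))))" for f :: "'n \<times> bool \<Rightarrow> 'n \<times> bool"
  have 1: "\<beta> (b' k) (b' k') = (\<Sum>l\<in>UNIV. \<Sum>m\<in>UNIV. M $ k $ l * M $ k' $ m * \<beta> (b l) (b m))" for k k'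
    unfolding assms(2) using assms(1)
    by (simp add: bilinear_sum bilinear_lmul bilinear_rmul sum.cartesian_product mult_ac)
  have 2: "(\<Prod>j\<in>UNIV. \<beta> (b' (p (j, False))) (b' (p (j, True))))
    = (\<Sum>f\<in>UNIV. (\<Prod>k\<in>UNIV. M $ p k $ f k) * P f)" for p :: "'n \<times> bool \<Rightarrow> 'n \<times> bool"
    unfolding 1 prod_sum_pairs P_def prod_pairs[of "\<lambda>k. M $ p k $ f k" for f]
    by (simp add: prod.distrib)
  have 3: "(\<Sum>p | p permutes UNIV. of_int (sign p) * (\<Prod>k\<in>UNIV. M $ p k $ f k))
     = (if f permutes UNIV then of_int (sign f) * det M else 0)" for f
  proof -
    let ?A = "(\<chi> k. transpose M $ f k) :: real ^ ('n \<times> bool) ^ ('n \<times> bool)"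
    have "(\<Sum>p | p permutes UNIV. of_int (sign p) * (\<Prod>k\<in>UNIV. M $ p k $ f k)) = det ?A"
      by (simp add: det_def Finite_Cartesian_Product.transpose_def)
    also have "\<dots> = (if f permutes UNIV then of_int (sign f) * det M else 0)"
    proof (cases "f permutes UNIV")
      case True
      then show ?thesis using det_permute_rows[OF True, of "transpose M"] by simp
    next
      case False
      then have "\<not> inj f"
        using bij_imp_permutes[of f UNIV] finite_UNIV_inj_surj[of f] by (auto simp: bij_def)
      then obtain k k' where "k \<noteq> k'" "f k = f k'" unfolding inj_def by blast
      then have "det ?A = 0" by (intro det_identical_rows[of k k']) (auto simp: row_def)
      with False show ?thesis by simp
    qed
    finally show ?thesis .
  qed
  have "pf_sum \<beta> b' = (\<Sum>p | p permutes UNIV. \<Sum>f\<in>UNIV.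
      of_int (sign p) * (\<Prod>k\<in>UNIV. M $ p k $ f k) * P f)"
    unfolding pf_sum_def 2 by (simp add: sum_distrib_left mult_ac)
  also have "\<dots> = (\<Sum>f\<in>UNIV. (\<Sum>p | p permutes UNIV.
      of_int (sign p) * (\<Prod>k\<in>UNIV. M $ p k $ f k)) * P f)"
    by (subst sum.swap) (simp add: sum_distrib_right)
  also have "\<dots> = (\<Sum>f\<in>UNIV. if f permutes UNIV then of_int (sign f) * det M * P f else 0)"
    unfolding 3 by (intro sum.cong) auto
  also have "\<dots> = (\<Sum>f | f permutes UNIV. of_int (sign f) * det M * P f)"
    by (intro sum.mono_neutral_cong_right) auto
  also have "\<dots> = det M * pf_sum \<beta> b"
    by (simp add: pf_sum_def P_def sum_distrib_left mult_ac)
  finally show ?thesis .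
qed

text \<open>
  The values of the form \<open>\<Sum>\<^sub>j dx\<^sub>j \<and> dy\<^sub>j\<close> on a symplectic basis, such as the
  basis \<open>real_basis\<close>.
\<close>

definition std_form :: "'n \<times> bool \<Rightarrow> 'n \<times> bool \<Rightarrow> real" where
  "std_form k l = (if fst k = fst l \<and> snd k \<noteq> snd l then (if snd k then -1 else 1) else 0)"

definition flip_pairs :: "'n set \<Rightarrow> 'n \<times> bool \<Rightarrow> 'n \<times> bool" where
  "flip_pairs B k = (fst k, snd k \<noteq> (fst k \<in> B))"

lemma flip_pairs_permutes: "flip_pairs B permutes UNIV"
proof (rule bij_imp_permutes)
  show "bij_betw (flip_pairs B) UNIV UNIV"
    by (rule bij_betw_byWitness[where f' = "flip_pairs B"]) (auto simp: flip_pairs_def)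
qed simp

lemma sign_flip_pairs:
  fixes B :: "'n::finite set"
  shows "sign (flip_pairs B) = (-1) ^ card B"
  using finite[of B]
proof (induction B rule: finite_induct)
  case empty
  have "flip_pairs {} = (id :: 'n \<times> bool \<Rightarrow> _)" by (auto simp: flip_pairs_def fun_eq_iff)
  then show ?case by (simp add: sign_id)
next
  case (insert a B)
  have "flip_pairs (insert a B) = Transposition.transpose (a, False) (a, True) \<circ> flip_pairs B"
    using insert(2) by (auto simp: flip_pairs_def fun_eq_iff Transposition.transpose_def)
  then have "sign (flip_pairs (insert a B)) = - sign (flip_pairs B)"
    using flip_pairs_permutes[of B]
    by (simp add: sign_compose permutation_swap_id sign_swap_id permutes_imp_permutation[OF finite])
  then show ?case using insert by simp
qed

text \<open>
  A transposition of \<open>'n\<close> acts on \<open>'n \<times> bool\<close> as a product of two disjoint transpositions.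
\<close>

lemma sign_map_first:
  fixes \<sigma> :: "'n::finite \<Rightarrow> 'n"
  assumes "\<sigma> permutes UNIV"
  shows "sign (map_prod \<sigma> id :: 'n \<times> bool \<Rightarrow> _) = 1 \<and> permutation (map_prod \<sigma> id :: 'n \<times> bool \<Rightarrow> _)"
  using assms finite
proof (induction rule: permutes_induct)
  case id
  then show ?case by (simp add: map_prod.id sign_id)
next
  case (swap a b p)
  let ?s = "Transposition.transpose (a, False) (b, False) \<circ> Transposition.transpose (a, True) (b, True)"
  have 1: "map_prod (Transposition.transpose a b \<circ> p) id = ?s \<circ> (map_prod p id :: 'n \<times> bool \<Rightarrow> _)"
    by (auto simp: fun_eq_iff Transposition.transpose_def)
  have 2: "permutation ?s" "sign ?s = 1"
    by (auto simp: sign_compose permutation_compose permutation_swap_id sign_swap_id)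
  from swap have 3: "sign (map_prod p id :: 'n \<times> bool \<Rightarrow> _) = 1" "permutation (map_prod p id :: 'n \<times> bool \<Rightarrow> _)"
    by blast+
  show ?case unfolding 1 sign_compose[OF 2(1) 3(2)] using permutation_compose[OF 2(1) 3(2)] 2(2) 3(1) by (metis mult_1)
qed

text \<open>
  A permutation contributes to the standard form only if it maps pairs to pairs. It is then a
  permutation of the pairs, which is even, composed with flips inside pairs, whose sign is
  compensated by the signs of the values of the form.
\<close>

lemma pf_sum_std_form_pos: "0 < pf_sum std_form (\<lambda>k :: 'n::finite \<times> bool. k)"
proof -
  let ?J = "\<lambda>p. \<Prod>j\<in>UNIV. std_form (p (j :: 'n, False)) (p (j, True))"
  have nonneg: "0 \<le> of_int (sign p) * ?J p" if p: "p permutes UNIV" for p :: "'n \<times> bool \<Rightarrow> 'n \<times> bool"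
  proof (cases "?J p = 0")
    case True
    then show ?thesis by (simp only: mult_zero_right order_refl)
  next
    case False
    then have nz: "std_form (p (j, False)) (p (j, True)) \<noteq> 0" for j
      by (simp add: prod_zero_iff)
    have pair: "fst (p (j, False)) = fst (p (j, True))" "snd (p (j, False)) \<noteq> snd (p (j, True))" for j
      using nz[of j] by (auto simp: std_form_def split: if_splits)
    define B where "B = {j. snd (p (j, False))}"
    define \<sigma> where "\<sigma> j = fst (p (j, False))" for j
    have q: "p \<circ> flip_pairs B = map_prod \<sigma> id"
    proof (rule ext)
      fix k :: "'n \<times> bool"
      show "(p \<circ> flip_pairs B) k = map_prod \<sigma> id k"
      proof (cases k)
        case (Pair j b)
        then show ?thesis
          using pair[of j] by (cases b; cases "j \<in> B") (auto simp: flip_pairs_def B_def \<sigma>_def prod_eq_iff)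
      qed
    qed
    have "bij (p \<circ> flip_pairs B)"
      by (intro bij_comp permutes_bij[OF p] permutes_bij[OF flip_pairs_permutes])
    then have "surj (map_prod \<sigma> (id :: bool \<Rightarrow> bool))" unfolding q by (rule bij_is_surj)
    then have "surj \<sigma>" by (metis (no_types, opaque_lifting) fst_map_prod fst_conv surj_def)
    then have \<sigma>: "\<sigma> permutes UNIV"
      by (intro bij_imp_permutes) (auto simp: bij_def finite_UNIV_surj_inj)
    have "sign (p \<circ> flip_pairs B) = sign p * (-1) ^ card B"
      using p flip_pairs_permutes[of B]
      by (simp add: sign_compose permutes_imp_permutation[OF finite] sign_flip_pairs)
    moreover have "?J p = (\<Prod>j\<in>UNIV. if j \<in> B then -1 else 1)"
      using pair by (intro prod.cong) (auto simp: std_form_def B_def)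
    then have "?J p = (-1) ^ card B" by (simp add: prod.If_cases)
    ultimately have "of_int (sign p) * ?J p = of_int (sign (p \<circ> flip_pairs B))"
      by simp
    then show ?thesis unfolding q using sign_map_first[OF \<sigma>] by simp
  qed
  have "0 < of_int (sign (id :: 'n \<times> bool \<Rightarrow> 'n \<times> bool)) * ?J id"
    by (simp add: sign_id std_form_def)
  then show ?thesis
    unfolding pf_sum_def using nonneg permutes_id by (intro sum_pos2[of _ id]) auto
qed

definition positive_11_form :: "(complex ^ 'n::finite \<Rightarrow> complex ^ 'n \<Rightarrow> real) \<Rightarrow> bool" where
  "positive_11_form \<beta> \<longleftrightarrow> bilinear \<beta> \<and> (\<forall>v. \<beta> v v = 0) \<and>
     (\<forall>u v. \<beta> (\<i> *s u) (\<i> *s v) = \<beta> u v) \<and> (\<forall>u. u \<noteq> 0 \<longrightarrow> 0 < \<beta> u (\<i> *s u))"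

lemma bilinear_alternating_skew:
  assumes "bilinear \<beta>" "\<And>v. \<beta> v v = (0::real)"
  shows "\<beta> u v = - \<beta> v u"
proof -
  have "\<beta> (u + v) (u + v) = \<beta> u u + \<beta> u v + (\<beta> v u + \<beta> v v)"
    by (simp add: bilinear_ladd[OF assms(1)] bilinear_radd[OF assms(1)])
  then show ?thesis by (simp add: assms(2))
qed

lemma DIM_complex_vec: "DIM(complex ^ 'n::finite) = 2 * CARD('n)"
  by simp

text \<open>
  This is the Gram-Schmidt process for the hermitian inner product whose imaginary part is
  \<open>\<beta>\<close>, up to sign; it produces a symplectic basis \<open>u\<^sub>j, i u\<^sub>j\<close>.
\<close>

lemma unitary_frame_on:
  fixes \<beta> :: "complex ^ 'n::finite \<Rightarrow> complex ^ 'n \<Rightarrow> real"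
    and S :: "'n set"
  assumes pos: "positive_11_form \<beta>"
  shows "\<exists>u. \<forall>j\<in>S. \<forall>k\<in>S. \<beta> (u j) (u k) = 0 \<and> \<beta> (u j) (\<i> *s u k) = (if j = k then 1 else 0)"
    (is "\<exists>u. ?P S u")
  using finite[of S]
proof (induction S rule: finite_induct)
  case empty
  then show ?case by simp
next
  case (insert a S)
  note bil = positive_11_form_def[THEN iffD1, OF pos, THEN conjunct1]
  have skew: "\<beta> u v = - \<beta> v u" for u v
    using bilinear_alternating_skew bil pos by (metis positive_11_form_def)
  have inv: "\<beta> (\<i> *s u) (\<i> *s v) = \<beta> u v" for u v using pos by (simp add: positive_11_form_def)
  have ii: "\<i> *s (\<i> *s v) = - v" for v :: "complex ^ 'n" by (simp add: vec_eq_iff)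
  have iscale: "\<i> *s (c *\<^sub>R v) = c *\<^sub>R (\<i> *s v)" for c and v :: "complex ^ 'n" by (simp add: vec_eq_iff)
  have jl: "\<beta> (\<i> *s u) v = - \<beta> u (\<i> *s v)" for u v
    using inv[of u "\<i> *s v"] by (simp add: ii bilinear_rneg[OF bil])
  obtain u where u: "?P S u" using insert by blast
  let ?W = "u ` S \<union> (\<lambda>j. \<i> *s u j) ` S"
  \<comment> \<open>Fewer vectors than real dimensions leave room for a further direction.\<close>
  have "card ?W \<le> 2 * card S"
    using card_Un_le[of "u ` S" "(\<lambda>j. \<i> *s u j) ` S"] card_image_le[of S u]
      card_image_le[of S "\<lambda>j. \<i> *s u j"] by simp
  also have "card S < CARD('n)" using insert by (intro psubset_card_mono) auto
  finally have "dim ?W < DIM(complex ^ 'n)"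
    using dim_le_card'[of ?W] unfolding DIM_complex_vec by simp
  then have "span ?W \<noteq> UNIV" by (metis dim_UNIV dim_span less_irrefl)
  then obtain w where w: "w \<notin> span ?W" by blast
  \<comment> \<open>The orthogonal projection of \<open>w\<close> to the complex span of the vectors found so far.\<close>
  define p where "p = (\<Sum>j\<in>S. \<beta> w (\<i> *s u j) *\<^sub>R u j - \<beta> w (u j) *\<^sub>R (\<i> *s u j))"
  define v where "v = w - p"
  have "p \<in> span ?W"
    unfolding p_def by (intro span_sum span_diff span_scale span_base) auto
  with w have "v \<noteq> 0" unfolding v_def by auto
  then have vpos: "0 < \<beta> v (\<i> *s v)" using pos by (simp add: positive_11_form_def)
  have p1: "\<beta> p y = (\<Sum>j\<in>S. \<beta> w (\<i> *s u j) * \<beta> (u j) y - \<beta> w (u j) * \<beta> (\<i> *s u j) y)" for y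
  proof -
    interpret linear "\<lambda>x. \<beta> x y" using bil by (simp add: bilinear_def)
    show ?thesis unfolding p_def by (simp add: sum diff scale)
  qed
  have o1: "\<beta> v (u k) = 0" if "k \<in> S" for k
  proof -
    have "\<beta> p (u k) = (\<Sum>j\<in>S. if j = k then \<beta> w (u k) else 0)"
      unfolding p1 using u that by (intro sum.cong) (auto simp: jl)
    then show ?thesis using that by (simp add: v_def bilinear_lsub[OF bil])
  qed
  have o2: "\<beta> v (\<i> *s u k) = 0" if "k \<in> S" for k
  proof -
    have "\<beta> p (\<i> *s u k) = (\<Sum>j\<in>S. if j = k then \<beta> w (\<i> *s u k) else 0)"
      unfolding p1 using u that by (intro sum.cong) (auto simp: inv)
    then show ?thesis using that by (simp add: v_def bilinear_lsub[OF bil])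
  qed
  define r where "r = 1 / sqrt (\<beta> v (\<i> *s v))"
  have r: "r * r * \<beta> v (\<i> *s v) = 1" using vpos by (simp add: r_def)
  have "?P (insert a S) (u(a := r *\<^sub>R v))"
  proof (intro ballI)
    fix j k assume jk: "j \<in> insert a S" "k \<in> insert a S"
    have vv: "\<beta> v v = 0" using pos by (simp add: positive_11_form_def)
    have o3: "\<beta> (u j) v = 0" if "j \<in> S" for j using o1[OF that] skew[of "u j" v] by simp
    have o4: "\<beta> (u j) (\<i> *s v) = 0" if "j \<in> S" for j
      using o2[OF that] jl[of "u j" v] skew[of "\<i> *s u j" v] by simp
    show "\<beta> ((u(a := r *\<^sub>R v)) j) ((u(a := r *\<^sub>R v)) k) = 0 \<and>
        \<beta> ((u(a := r *\<^sub>R v)) j) (\<i> *s (u(a := r *\<^sub>R v)) k) = (if j = k then 1 else 0)"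
      using jk u o1 o2 o3 o4 vv r insert(2)
      by (auto simp: bilinear_lmul[OF bil] bilinear_rmul[OF bil] iscale)
  qed
  then show ?case by blast
qed

definition real_coord :: "complex ^ 'n::finite \<Rightarrow> 'n \<times> bool \<Rightarrow> real" where
  "real_coord v k = (if snd k then Im (v $ fst k) else Re (v $ fst k))"

lemma real_coord_expansion: "v = (\<Sum>k\<in>UNIV. real_coord v k *\<^sub>R real_basis k)"
  for v :: "complex ^ 'n::finite"
proof -
  have "(\<Sum>k\<in>UNIV. real_coord v k *\<^sub>R real_basis k)
      = (\<Sum>j\<in>UNIV. real_coord v (j, False) *\<^sub>R real_basis (j, False) + real_coord v (j, True) *\<^sub>R real_basis (j, True))"
    by (simp only: UNIV_Times_UNIV[symmetric] sum.cartesian_product' UNIV_bool) simp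
  also have "\<dots> $ i = (\<Sum>j\<in>UNIV. if j = i then v $ i else 0)" for i
    unfolding sum_component
    by (intro sum.cong) (auto simp: real_basis_def real_coord_def axis_def complex_eq_iff)
  then have "(\<Sum>j\<in>UNIV. real_coord v (j, False) *\<^sub>R real_basis (j, False) + real_coord v (j, True) *\<^sub>R real_basis (j, True)) = v"
    by (simp add: vec_eq_iff)
  finally show ?thesis by simp
qed

lemma pf_sum_real_basis_transform:
  fixes \<beta> :: "complex ^ 'n::finite \<Rightarrow> complex ^ 'n \<Rightarrow> real"
  assumes "bilinear \<beta>"
  shows "pf_sum \<beta> b = det (\<chi> k l. real_coord (b k) l) * pf_sum \<beta> real_basis"
proof (rule pf_sum_change_basis[OF assms])
  show "b k = (\<Sum>l\<in>UNIV. (\<chi> k l. real_coord (b k) l) $ k $ l *\<^sub>R real_basis l)" for k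
    using real_coord_expansion[of "b k"] by (simp only: vec_lambda_beta)
qed

text \<open>
  A unitary frame turns the form into the standard one. The sum for the standard basis differs from the
  positive value there by the determinant of the change of basis, so it cannot vanish.
\<close>

lemma pf_sum_nonzero:
  fixes \<beta> :: "complex ^ 'n::finite \<Rightarrow> complex ^ 'n \<Rightarrow> real"
  assumes pos: "positive_11_form \<beta>"
  shows "pf_sum \<beta> real_basis \<noteq> 0"
proof
  assume 0: "pf_sum \<beta> real_basis = 0"
  note bil = positive_11_form_def[THEN iffD1, OF pos, THEN conjunct1]
  from unitary_frame_on[OF pos, of UNIV] obtain u :: "'n \<Rightarrow> complex ^ 'n" where *: "\<forall>j\<in>UNIV. \<forall>k\<in>UNIV.
      \<beta> (u j) (u k) = 0 \<and> \<beta> (u j) (\<i> *s u k) = (if j = k then 1 else 0)" ..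
  have u: "\<beta> (u j) (u k) = 0" "\<beta> (u j) (\<i> *s u k) = (if j = k then 1 else 0)" for j k
    using * by blast+
  define b where "b k = (if snd k then \<i> *s u (fst k) else u (fst k))" for k
  have alt: "\<beta> v v = 0" and inv: "\<beta> (\<i> *s v) (\<i> *s w) = \<beta> v w" for v w
    using pos unfolding positive_11_form_def by metis+
  have "\<beta> (\<i> *s u j) (u k) = - \<beta> (u k) (\<i> *s u j)" for j k
    by (rule bilinear_alternating_skew[OF bil alt])
  then have "\<beta> (\<i> *s u j) (u k) = (if j = k then -1 else 0)" for j k
    by (simp add: u(2))
  moreover have "\<beta> (\<i> *s u j) (\<i> *s u k) = 0" for j k
    using u(1) inv by simp
  ultimately have "\<beta> (b k) (b l) = std_form k l" for k l
    by (cases k; cases l) (simp add: b_def std_form_def u)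
  then have "pf_sum \<beta> b = pf_sum std_form (\<lambda>k :: 'n \<times> bool. k)" by (simp add: pf_sum_def)
  then show False
    using pf_sum_std_form_pos[where 'n = 'n] pf_sum_real_basis_transform[OF bil, of b] 0 by simp
qed

text \<open>
  The sign is found by deforming the form to the standard one: positive forms of type (1,1) make
  up a convex set, on which the sum has no zero.
\<close>

lemma pf_sum_pos:
  fixes \<beta> :: "complex ^ 'n::finite \<Rightarrow> complex ^ 'n \<Rightarrow> real"
  assumes pos: "positive_11_form \<beta>"
  shows "0 < pf_sum \<beta> real_basis"
proof (rule ccontr)
  assume "\<not> 0 < pf_sum \<beta> real_basis"
  define \<beta>0 :: "complex ^ 'n \<Rightarrow> complex ^ 'n \<Rightarrow> real" where
    "\<beta>0 u v = (\<Sum>j\<in>UNIV. Re (u $ j) * Im (v $ j) - Im (u $ j) * Re (v $ j))" for u v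
  have bil: "bilinear \<beta>" using pos by (simp add: positive_11_form_def)
  have bil0: "bilinear \<beta>0"
    unfolding bilinear_def \<beta>0_def
    by (auto intro!: linearI simp: sum.distrib[symmetric] sum_distrib_left algebra_simps)
  have \<beta>0: "0 < \<beta>0 u (\<i> *s u)" if "u \<noteq> 0" for u :: "complex ^ 'n"
  proof -
    have "\<exists>j. u $ j \<noteq> 0" using that by (simp add: vec_eq_iff)
    then obtain j where "u $ j \<noteq> 0" by blast
    then have "0 < (Re (u $ j))\<^sup>2 + (Im (u $ j))\<^sup>2" by (simp add: complex_eq_iff sum_power2_gt_zero_iff)
    then have "0 < (\<Sum>j\<in>UNIV. (Re (u $ j))\<^sup>2 + (Im (u $ j))\<^sup>2)"
      by (intro sum_pos2[of _ j]) auto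
    then show ?thesis by (simp add: \<beta>0_def power2_eq_square)
  qed
  define \<gamma> where "\<gamma> t u v = (1 - t) * \<beta>0 u v + t * \<beta> u v" for t u v
  have "positive_11_form (\<gamma> t)" if t: "0 \<le> t" "t \<le> 1" for t
    unfolding positive_11_form_def
  proof (intro conjI allI impI)
    show "bilinear (\<gamma> t)"
      unfolding bilinear_def \<gamma>_def
      by (auto intro!: linearI simp: bilinear_ladd[OF bil] bilinear_radd[OF bil]
         bilinear_lmul[OF bil] bilinear_rmul[OF bil] bilinear_ladd[OF bil0] bilinear_radd[OF bil0]
         bilinear_lmul[OF bil0] bilinear_rmul[OF bil0] algebra_simps)
    show "\<gamma> t v v = 0" for v using pos by (simp add: \<gamma>_def \<beta>0_def positive_11_form_def)
    show "\<gamma> t (\<i> *s u) (\<i> *s v) = \<gamma> t u v" for u v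
      using pos by (simp add: \<gamma>_def \<beta>0_def positive_11_form_def algebra_simps)
    show "0 < \<gamma> t u (\<i> *s u)" if "u \<noteq> 0" for u
    proof (cases "t = 0")
      case True
      then show ?thesis using \<beta>0[OF that] by (simp add: \<gamma>_def)
    next
      case False
      then have "0 < t * \<beta> u (\<i> *s u)" using t pos that by (simp add: positive_11_form_def)
      then show ?thesis using \<beta>0[OF that] t by (auto simp: \<gamma>_def intro: add_nonneg_pos)
    qed
  qed
  then have nz: "pf_sum (\<gamma> t) real_basis \<noteq> 0" if "0 \<le> t" "t \<le> 1" for t
    using that pf_sum_nonzero by blast
  have "continuous_on {0..1} (\<lambda>t. pf_sum (\<gamma> t) real_basis)"
    unfolding pf_sum_def \<gamma>_def by (intro continuous_intros)
  moreover have "\<gamma> 1 = \<beta>" "\<gamma> 0 = \<beta>0" by (auto simp: \<gamma>_def fun_eq_iff)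
  moreover have "0 < pf_sum \<beta>0 real_basis"
  proof -
    have "\<beta>0 (real_basis k) (real_basis l) = std_form k l" for k l
    proof -
      have "\<beta>0 (real_basis k) (real_basis l)
          = (\<Sum>j\<in>UNIV. if j = fst k then std_form k l else 0)"
        unfolding \<beta>0_def by (intro sum.cong) (auto simp: real_basis_def axis_def std_form_def)
      then show ?thesis by simp
    qed
    then have "pf_sum \<beta>0 real_basis = pf_sum std_form (\<lambda>k :: 'n \<times> bool. k)" by (simp add: pf_sum_def)
    then show ?thesis using pf_sum_std_form_pos[where 'n = 'n] by simp
  qed
  ultimately obtain t where "0 \<le> t" "t \<le> 1" "pf_sum (\<gamma> t) real_basis = 0"
    using IVT2'[of "\<lambda>t. pf_sum (\<gamma> t) real_basis" 1 0 0] \<open>\<not> 0 < pf_sum \<beta> real_basis\<close> by auto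
  with nz show False by blast
qed

section \<open>Change of variables in complex coordinates\<close>

lemma has_integral_iff_set_nn_integral:
  fixes h :: "'e::euclidean_space \<Rightarrow> real"
  assumes "set_borel_measurable borel S h" "\<And>x. x \<in> S \<Longrightarrow> 0 \<le> h x" "0 \<le> r"
  shows "(h has_integral r) S \<longleftrightarrow> (\<integral>\<^sup>+x\<in>S. h x \<partial>lborel) = ennreal r"
proof -
  have "(\<lambda>x. indicator S x * h x) = (\<lambda>x. if x \<in> S then h x else 0)"
    by (auto simp: fun_eq_iff indicator_def)
  then have "(h has_integral r) S \<longleftrightarrow> ((\<lambda>x. indicator S x * h x) has_integral r) UNIV"
    by (simp add: has_integral_restrict_UNIV)
  also have "\<dots> \<longleftrightarrow> (\<integral>\<^sup>+x. ennreal (indicator S x * h x) \<partial>lborel) = ennreal r"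
    using assms
    by (subst has_integral_iff_nn_integral_lebesgue)
      (auto simp: set_borel_measurable_def indicator_def nn_integral_completion
        intro: measurable_completion)
  also have "(\<integral>\<^sup>+x. ennreal (indicator S x * h x) \<partial>lborel) = (\<integral>\<^sup>+x\<in>S. h x \<partial>lborel)"
    by (intro nn_integral_cong) (auto simp: indicator_def)
  finally show ?thesis .
qed

text \<open>
  A nonnegative function is absolutely integrable as soon as it is integrable, so for it the formula for
  absolutely integrable functions becomes an equivalence for the integral alone. Real functions enter as vectors with
  one component.
\<close>

lemma has_integral_change_of_variables_nonneg:
  fixes g :: "real ^ 'm::{finite,wellorder} \<Rightarrow> real ^ 'm::_" and f :: "real ^ 'm::_ \<Rightarrow> real"
  assumes "S \<in> sets lebesgue"
    and "\<And>x. x \<in> S \<Longrightarrow> (g has_derivative g' x) (at x within S)" "inj_on g S"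
    and "\<And>y. y \<in> g ` S \<Longrightarrow> 0 \<le> f y"
  shows "((\<lambda>x. \<bar>det (matrix (g' x))\<bar> * f (g x)) has_integral b) S \<longleftrightarrow> (f has_integral b) (g ` S)"
proof -
  let ?f = "\<lambda>x. vec (f x) :: real ^ 1"
  let ?D = "\<lambda>x. \<bar>det (matrix (g' x))\<bar>"
  have 1: "(\<lambda>x. ?D x * f (g x)) absolutely_integrable_on S \<longleftrightarrow> (\<lambda>x. ?D x * f (g x)) integrable_on S"
    using assms(4) by (intro absolutely_integrable_on_iff_nonneg) auto
  have 2: "f absolutely_integrable_on (g ` S) \<longleftrightarrow> f integrable_on (g ` S)"
    using assms(4) by (intro absolutely_integrable_on_iff_nonneg) auto
  have 3: "(\<lambda>x. ?D x *\<^sub>R ?f (g x)) = (\<lambda>x. vec (?D x * f (g x)))"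
    by (auto simp: vec_eq_iff)
  have "((\<lambda>x. vec (?D x * f (g x)) :: real ^ 1) absolutely_integrable_on S \<and>
           integral S (\<lambda>x. vec (?D x * f (g x))) = (vec b :: real ^ 1))
      \<longleftrightarrow> (?f absolutely_integrable_on (g ` S) \<and> integral (g ` S) ?f = vec b)"
    using has_absolute_integral_change_of_variables[OF assms(1-3), of ?f "vec b"] unfolding 3 .
  then show ?thesis
    by (simp add: absolutely_integrable_on_1_iff integral_on_1_eq 1 2 has_integral_iff)
qed

text \<open>
  The finite values of the two integrals determine each other, so if one is infinite, so is the
  other.
\<close>

lemma nn_integral_change_of_variables:
  fixes g :: "real ^ 'm::{finite,wellorder} \<Rightarrow> real ^ 'm::_" and f u :: "real ^ 'm::_ \<Rightarrow> real"
  assumes "S \<in> sets borel"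
    and "\<And>x. x \<in> S \<Longrightarrow> (g has_derivative g' x) (at x within S)" "inj_on g S"
    and "\<And>y. y \<in> g ` S \<Longrightarrow> 0 \<le> f y"
    and "set_borel_measurable borel (g ` S) f" "set_borel_measurable borel S u"
    and u: "\<And>x. x \<in> S \<Longrightarrow> u x = \<bar>det (matrix (g' x))\<bar> * f (g x)"
  shows "(\<integral>\<^sup>+x\<in>S. u x \<partial>lborel) = (\<integral>\<^sup>+y\<in>g ` S. f y \<partial>lborel)"
proof -
  have S: "S \<in> sets lebesgue" using assms(1) by auto
  have pos: "0 \<le> u x" if "x \<in> S" for x using that u assms(4) by auto
  have "(u has_integral r) S \<longleftrightarrow> (f has_integral r) (g ` S)" for r
    using has_integral_change_of_variables_nonneg[where b = r, OF S assms(2-4)] u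
    by (simp cong: has_integral_cong)
  then have eq: "(\<integral>\<^sup>+x\<in>S. u x \<partial>lborel) = ennreal r \<longleftrightarrow> (\<integral>\<^sup>+y\<in>g ` S. f y \<partial>lborel) = ennreal r"
    if "0 \<le> r" for r
    using has_integral_iff_set_nn_integral[OF assms(6) pos that]
      has_integral_iff_set_nn_integral[OF assms(5,4) that] by blast
  show ?thesis
  proof (cases "(\<integral>\<^sup>+x\<in>S. u x \<partial>lborel)")
    case (real r)
    then show ?thesis using eq[of r] by simp
  next
    case top
    show ?thesis
    proof (cases "(\<integral>\<^sup>+y\<in>g ` S. f y \<partial>lborel)")
      case (real r)
      then show ?thesis using eq[of r] by simp
    qed (use top in simp)
  qed
qed

text \<open>
  Conjugation with a bijection of the index sets carries permutations to permutations of the same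
  sign.
\<close>

lemma det_reindex:
  fixes M :: "real ^ 'k::finite ^ 'k" and \<pi> :: "'m::finite \<Rightarrow> 'k"
  assumes "bij \<pi>"
  shows "det (\<chi> i j. M $ \<pi> i $ \<pi> j) = det M"
proof -
  let ?h = "map_permutation UNIV \<pi>"
  have inj: "inj \<pi>" and UN: "range \<pi> = UNIV" using assms by (auto simp: bij_def)
  have "det M = (\<Sum>q | q permutes UNIV. of_int (sign q) * (\<Prod>i\<in>UNIV. M $ i $ q i))"
    by (simp add: det_def)
  also have "\<dots> = (\<Sum>p | p permutes UNIV. of_int (sign (?h p)) * (\<Prod>i\<in>UNIV. M $ i $ ?h p i))"
  proof (rule sum.reindex_bij_betw[symmetric])
    let ?k = "map_permutation UNIV (inv \<pi>)"
    have bij': "bij (inv \<pi>)" using assms by (rule bij_imp_bij_inv)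
    show "bij_betw ?h {p. p permutes UNIV} {q. q permutes UNIV}"
    proof (rule bij_betw_byWitness[where f' = ?k])
      show "\<forall>p\<in>{p. p permutes UNIV}. ?k (?h p) = p"
        using assms bij' by (auto intro!: map_permutation_compose_inv simp: inj)
      show "\<forall>q\<in>{q. q permutes UNIV}. ?h (?k q) = q"
        using assms bij' by (auto intro!: map_permutation_compose_inv simp: surj_f_inv_f[OF UN])
    qed (use map_permutation_permutes[OF assms] map_permutation_permutes[OF bij'] in auto)
  qed
  also have "\<dots> = (\<Sum>p | p permutes UNIV. of_int (sign p) * (\<Prod>i\<in>UNIV. M $ \<pi> i $ \<pi> (p i)))"
  proof (intro sum.cong refl)
    fix p :: "'m \<Rightarrow> 'm" assume "p \<in> {p. p permutes UNIV}"
    then have s: "sign (?h p) = sign p" using sign_map_permutation[OF inj] by auto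
    have "(\<Prod>i\<in>UNIV. M $ i $ ?h p i) = (\<Prod>i\<in>UNIV. M $ \<pi> i $ ?h p (\<pi> i))"
      using prod.reindex_bij_betw[OF assms, of "\<lambda>i. M $ i $ ?h p i"] by simp
    then show "of_int (sign (?h p)) * (\<Prod>i\<in>UNIV. M $ i $ ?h p i)
        = of_int (sign p) * (\<Prod>i\<in>UNIV. M $ \<pi> i $ \<pi> (p i))"
      by (simp add: s map_permutation_apply[OF inj])
  qed
  also have "\<dots> = det (\<chi> i j. M $ \<pi> i $ \<pi> j)"
    by (simp add: det_def)
  finally show ?thesis by simp
qed

text \<open>
  The change of variables formula concerns vectors indexed by a finite type with a well-order. The type
  \<open>'n bit0\<close> is such a type with twice as many elements as \<open>'n\<close>, hence as many as there are real
  coordinates on \<open>complex ^ 'n\<close>.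
\<close>

definition real_index :: "'n::finite bit0 \<Rightarrow> 'n \<times> bool" where
  "real_index = (SOME f. bij f)"

lemma bij_real_index: "bij (real_index :: 'n::finite bit0 \<Rightarrow> 'n \<times> bool)"
proof -
  have "card (UNIV :: 'n bit0 set) = card (UNIV :: ('n \<times> bool) set)"
    by simp
  then have "\<exists>f :: 'n bit0 \<Rightarrow> 'n \<times> bool. bij f"
    using finite_same_card_bij[of "UNIV :: 'n bit0 set" "UNIV :: ('n \<times> bool) set"] by simp
  then show ?thesis unfolding real_index_def by (rule someI_ex)
qed

definition to_complex_vec :: "real ^ 'n bit0 \<Rightarrow> complex ^ 'n::finite" where
  "to_complex_vec x = (\<Sum>i\<in>UNIV. x $ i *\<^sub>R real_basis (real_index i))"

definition to_real_vec :: "complex ^ 'n::finite \<Rightarrow> real ^ 'n bit0" where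
  "to_real_vec v = (\<chi> i. real_coord v (real_index i))"

lemma real_coord_eq_inner: "real_coord v k = v \<bullet> real_basis k"
  by (cases k) (auto simp: real_coord_def real_basis_def inner_axis)

lemma real_coord_real_basis: "real_coord (real_basis k) l = (if k = l then 1 else 0)"
  by (cases k; cases l) (auto simp: real_coord_def real_basis_def axis_def)

lemma to_complex_vec_to_real_vec [simp]: "to_complex_vec (to_real_vec v) = v"
  unfolding to_complex_vec_def to_real_vec_def
  using sum.reindex_bij_betw[OF bij_real_index, of "\<lambda>k. real_coord v k *\<^sub>R real_basis k"]
    real_coord_expansion[of v] by simp

lemma real_coord_to_complex_vec: "real_coord (to_complex_vec x) (real_index i) = x $ i"
proof -
  have "real_coord (to_complex_vec x) (real_index i)
      = (\<Sum>j\<in>UNIV. x $ j * real_coord (real_basis (real_index j)) (real_index i))"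
    unfolding real_coord_eq_inner to_complex_vec_def by (simp add: inner_sum_left)
  also have "\<dots> = (\<Sum>j\<in>UNIV. if j = i then x $ i else 0)"
    unfolding real_coord_real_basis
    by (intro sum.cong) (auto simp: inj_eq[OF bij_is_inj[OF bij_real_index]])
  finally show ?thesis by simp
qed

lemma to_real_vec_to_complex_vec [simp]: "to_real_vec (to_complex_vec x) = x"
  by (simp add: to_real_vec_def vec_eq_iff real_coord_to_complex_vec)

lemma bounded_linear_to_complex_vec: "bounded_linear to_complex_vec"
  by (rule linear_conv_bounded_linear[THEN iffD1])
    (auto intro!: linearI simp: to_complex_vec_def sum.distrib scaleR_add_left scaleR_sum_right)

lemma bounded_linear_to_real_vec: "bounded_linear to_real_vec"
  by (rule linear_conv_bounded_linear[THEN iffD1])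
    (auto intro!: linearI simp: to_real_vec_def vec_eq_iff real_coord_eq_inner inner_add_left)

lemma Basis_complex_vec: "(Basis :: (complex ^ 'n::finite) set) = range real_basis"
proof -
  have "(Basis :: (complex ^ 'n) set) = (\<Union>i. {axis i 1, axis i \<i>})"
    by (auto simp: Basis_vec_def Basis_complex_def)
  also have "\<dots> = range real_basis"
    by (force simp: real_basis_def image_iff)
  finally show ?thesis .
qed

lemma Basis_real_vec: "(Basis :: (real ^ 'm::finite) set) = range (\<lambda>i. axis i 1)"
  by (auto simp: Basis_vec_def)

lemma inj_real_basis: "inj real_basis"
proof (rule injI)
  fix k l :: "'a \<times> bool" assume "real_basis k = (real_basis l :: complex ^ 'a)"
  then show "k = l" using real_coord_real_basis[of k l] real_coord_real_basis[of l l]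
    by (simp split: if_splits)
qed

text \<open>
  The coordinate isomorphism maps boxes to boxes with the same side lengths, and these determine
  Lebesgue measure.
\<close>

lemma lborel_to_complex_vec:
  "distr lborel borel to_complex_vec = (lborel :: (complex ^ 'n::finite) measure)"
proof (rule lborel_eqI[symmetric])
  have m: "to_complex_vec \<in> borel_measurable (borel :: (real ^ 'n bit0) measure)"
    by (intro borel_measurable_continuous_onI linear_continuous_on bounded_linear_to_complex_vec)
  fix l u :: "complex ^ 'n" assume le: "\<And>b. b \<in> Basis \<Longrightarrow> l \<bullet> b \<le> u \<bullet> b"
  have le': "to_real_vec l \<bullet> b \<le> to_real_vec u \<bullet> b" if "b \<in> Basis" for b
    using that le
    by (auto simp: Basis_real_vec Basis_complex_vec inner_axis to_real_vec_def real_coord_eq_inner)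
  have "to_complex_vec -` box l u = box (to_real_vec l) (to_real_vec u)"
  proof (rule set_eqI)
    fix x :: "real ^ 'n bit0"
    have "x \<in> to_complex_vec -` box l u \<longleftrightarrow>
      (\<forall>k. real_coord l k < real_coord (to_complex_vec x) k \<and> real_coord (to_complex_vec x) k < real_coord u k)"
      by (simp add: mem_box Basis_complex_vec real_coord_eq_inner)
    also have "\<dots> \<longleftrightarrow> (\<forall>i. real_coord l (real_index i) < x $ i \<and> x $ i < real_coord u (real_index i))"
      using real_coord_to_complex_vec[of x] bij_is_surj[OF bij_real_index] by (metis surjD)
    also have "\<dots> \<longleftrightarrow> x \<in> box (to_real_vec l) (to_real_vec u)"
      by (simp add: mem_box_cart to_real_vec_def)
    finally show "x \<in> to_complex_vec -` box l u \<longleftrightarrow> x \<in> box (to_real_vec l) (to_real_vec u)" .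
  qed
  then have "emeasure (distr lborel borel to_complex_vec) (box l u)
      = emeasure lborel (box (to_real_vec l) (to_real_vec u))"
    using m by (subst emeasure_distr) auto
  also have "\<dots> = ennreal (\<Prod>b\<in>Basis. (to_real_vec u - to_real_vec l) \<bullet> b)"
    using le' by (simp add: emeasure_lborel_box)
  also have "(\<Prod>b\<in>Basis. (to_real_vec u - to_real_vec l) \<bullet> b)
      = (\<Prod>i\<in>UNIV. (u - l) \<bullet> real_basis (real_index i))"
    unfolding Basis_real_vec
    by (subst prod.reindex)
      (auto simp: inj_def axis_eq_axis inner_axis to_real_vec_def real_coord_eq_inner inner_diff_left)
  also have "\<dots> = (\<Prod>k\<in>UNIV. (u - l) \<bullet> real_basis k)"
    by (rule prod.reindex_bij_betw[OF bij_real_index])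
  also have "\<dots> = (\<Prod>b\<in>Basis. (u - l) \<bullet> b)"
    unfolding Basis_complex_vec by (simp add: prod.reindex[OF inj_real_basis])
  finally show "emeasure (distr lborel borel to_complex_vec) (box l u) = ennreal (\<Prod>b\<in>Basis. (u - l) \<bullet> b)" .
qed simp

lemma measurable_to_complex_vec [measurable]: "to_complex_vec \<in> borel_measurable borel"
  by (intro borel_measurable_continuous_onI linear_continuous_on bounded_linear_to_complex_vec)

lemma nn_integral_to_complex_vec:
  fixes f :: "complex ^ 'n::finite \<Rightarrow> real"
  assumes "set_borel_measurable borel S f"
  shows "(\<integral>\<^sup>+z\<in>S. f z \<partial>lborel) = (\<integral>\<^sup>+x\<in>to_complex_vec -` S. f (to_complex_vec x) \<partial>lborel)"
proof -
  have m: "(\<lambda>z. ennreal (indicator S z *\<^sub>R f z)) \<in> borel_measurable borel"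
    using assms unfolding set_borel_measurable_def by measurable
  have "(\<integral>\<^sup>+z\<in>S. f z \<partial>lborel) = (\<integral>\<^sup>+z. ennreal (indicator S z *\<^sub>R f z) \<partial>lborel)"
    by (intro nn_integral_cong) (auto simp: indicator_def)
  also have "\<dots> = (\<integral>\<^sup>+x. ennreal (indicator S (to_complex_vec x) *\<^sub>R f (to_complex_vec x)) \<partial>lborel)"
    by (subst lborel_to_complex_vec[symmetric], subst nn_integral_distr) (use m in simp_all)
  also have "\<dots> = (\<integral>\<^sup>+x\<in>to_complex_vec -` S. f (to_complex_vec x) \<partial>lborel)"
    by (intro nn_integral_cong) (auto simp: indicator_def)
  finally show ?thesis .
qed

lemma nn_integral_change_of_variables_complex:
  fixes T :: "complex ^ 'n::finite \<Rightarrow> complex ^ 'n" and f u :: "complex ^ 'n \<Rightarrow> real"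
  assumes S: "S \<in> sets borel"
    and T': "\<And>z. z \<in> S \<Longrightarrow> (T has_derivative T' z) (at z)" and inj: "inj_on T S"
    and f0: "\<And>w. w \<in> T ` S \<Longrightarrow> 0 \<le> f w"
    and f: "set_borel_measurable borel (T ` S) f" and u: "set_borel_measurable borel S u"
    and uf: "\<And>z. z \<in> S \<Longrightarrow> u z = \<bar>det (\<chi> k l. real_coord (T' z (real_basis k)) l)\<bar> * f (T z)"
  shows "(\<integral>\<^sup>+z\<in>S. u z \<partial>lborel) = (\<integral>\<^sup>+w\<in>T ` S. f w \<partial>lborel)"
proof -
  let ?c = "to_complex_vec :: real ^ 'n bit0 \<Rightarrow> complex ^ 'n"
  define g where "g x = to_real_vec (T (?c x))" for x
  define g' where "g' x v = to_real_vec (T' (?c x) (?c v))" for x v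
  have vim: "?c -` X \<in> sets borel" if "X \<in> sets borel" for X
    using measurable_sets[OF measurable_to_complex_vec that] by simp
  have img: "g ` (?c -` S) = ?c -` (T ` S)"
  proof (rule set_eqI)
    fix y
    have "y \<in> g ` (?c -` S) \<longleftrightarrow> (\<exists>z\<in>S. y = to_real_vec (T z))"
    proof
      assume "\<exists>z\<in>S. y = to_real_vec (T z)"
      then obtain z where "z \<in> S" "y = to_real_vec (T z)" by blast
      then have "y = g (to_real_vec z)" "to_real_vec z \<in> ?c -` S" by (simp_all add: g_def)
      then show "y \<in> g ` (?c -` S)" by blast
    qed (auto simp: g_def)
    also have "\<dots> \<longleftrightarrow> ?c y \<in> T ` S"
      by (metis (no_types, lifting) imageE imageI to_complex_vec_to_real_vec to_real_vec_to_complex_vec)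
    finally show "y \<in> g ` (?c -` S) \<longleftrightarrow> y \<in> ?c -` (T ` S)" by simp
  qed
  have d: "(g has_derivative g' x) (at x within ?c -` S)" if "x \<in> ?c -` S" for x
  proof (rule has_derivative_at_withinI)
    have "(T \<circ> ?c has_derivative T' (?c x) \<circ> ?c) (at x)"
      using that by (intro diff_chain_at bounded_linear_imp_has_derivative
          bounded_linear_to_complex_vec T') auto
    then have "(to_real_vec \<circ> (T \<circ> ?c) has_derivative to_real_vec \<circ> (T' (?c x) \<circ> ?c)) (at x)"
      by (rule diff_chain_at) (intro bounded_linear_imp_has_derivative bounded_linear_to_real_vec)
    then show "(g has_derivative g' x) (at x)" by (simp add: g_def[abs_def] g'_def[abs_def] o_def)
  qed
  have "inj_on g (?c -` S)"
    using inj by (auto simp: inj_on_def g_def) (metis to_complex_vec_to_real_vec to_real_vec_to_complex_vec)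
  have mv: "set_borel_measurable borel (?c -` X) (\<lambda>x. h (?c x))" if "set_borel_measurable borel X h" for X h
  proof -
    have "(\<lambda>x. indicator X (?c x) *\<^sub>R h (?c x)) \<in> borel_measurable borel"
      using measurable_compose[OF measurable_to_complex_vec that[unfolded set_borel_measurable_def]] .
    then show ?thesis by (simp add: set_borel_measurable_def indicator_def)
  qed
  have det: "det (matrix (g' x)) = det (\<chi> k l. real_coord (T' (?c x) (real_basis k)) l)" for x
  proof -
    let ?M = "(\<chi> k l. real_coord (T' (?c x) (real_basis k)) l) :: real ^ ('n \<times> bool) ^ ('n \<times> bool)"
    have ax: "?c (axis j 1) = real_basis (real_index j)" for j
    proof -
      have "?c (axis j 1) = (\<Sum>i\<in>UNIV. if i = j then real_basis (real_index j) else 0)"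
        unfolding to_complex_vec_def by (intro sum.cong) (auto simp: axis_def)
      then show ?thesis by simp
    qed
    have "matrix (g' x) = (\<chi> i j. transpose ?M $ real_index i $ real_index j)"
      by (simp add: matrix_def g'_def to_real_vec_def transpose_def ax)
    then have "det (matrix (g' x)) = det (transpose ?M)"
      using det_reindex[OF bij_real_index, of "transpose ?M"] by simp
    then show ?thesis by (simp add: det_transpose)
  qed
  have "(\<integral>\<^sup>+z\<in>S. u z \<partial>lborel) = (\<integral>\<^sup>+x\<in>?c -` S. u (?c x) \<partial>lborel)"
    by (rule nn_integral_to_complex_vec[OF u])
  also have "\<dots> = (\<integral>\<^sup>+y\<in>g ` (?c -` S). f (?c y) \<partial>lborel)"
  proof (rule nn_integral_change_of_variables[OF vim[OF S] d \<open>inj_on g _\<close>])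
    show "0 \<le> f (?c y)" if "y \<in> g ` (?c -` S)" for y using that f0 unfolding img by auto
    show "set_borel_measurable borel (g ` (?c -` S)) (\<lambda>x. f (?c x))" unfolding img by (rule mv[OF f])
    show "set_borel_measurable borel (?c -` S) (\<lambda>x. u (?c x))" by (rule mv[OF u])
    show "u (?c x) = \<bar>det (matrix (g' x))\<bar> * f (?c (g x))" if "x \<in> ?c -` S" for x
      using that uf unfolding det by (simp add: g_def)
  qed
  also have "\<dots> = (\<integral>\<^sup>+w\<in>T ` S. f w \<partial>lborel)"
    unfolding img by (rule nn_integral_to_complex_vec[OF f, symmetric])
  finally show ?thesis .
qed

section \<open>The volume measure\<close>

locale kaehler_manifold =
  fixes A :: "('a::t2_space, 'n::finite) chart set" and \<omega> :: "('a, 'n) two_form"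
  assumes manifold: "compact_connected_kaehler_manifold A \<omega>"
begin

lemma compact_UNIV: "compact (UNIV :: 'a set)"
  using manifold by (simp add: compact_connected_kaehler_manifold_def)

lemma atlas: "holomorphic_atlas A"
  using manifold by (simp add: compact_connected_kaehler_manifold_def)

lemma two_form: "is_two_form A \<omega>"
  using manifold by (simp add: compact_connected_kaehler_manifold_def kaehler_form_def)

lemma chart_cover: obtains c where "c \<in> A" "x \<in> fst c"
proof -
  have "x \<in> (\<Union>c\<in>A. fst c)" using atlas by (simp add: holomorphic_atlas_def)
  then show ?thesis using that by blast
qed

lemma
  assumes "c \<in> A"
  shows open_chart_domain: "open (fst c)" and open_chart_image: "open (chart_image c)"
    and chart_inv_chart: "x \<in> fst c \<Longrightarrow> chart_inv c (snd c x) = x"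
    and chart_chart_inv: "z \<in> chart_image c \<Longrightarrow> snd c (chart_inv c z) = z"
    and chart_inv_in: "z \<in> chart_image c \<Longrightarrow> chart_inv c z \<in> fst c"
    and chart_in: "x \<in> fst c \<Longrightarrow> snd c x \<in> chart_image c"
    and continuous_chart: "continuous_on (fst c) (snd c)"
    and continuous_chart_inv: "continuous_on (chart_image c) (chart_inv c)"
proof -
  have o: "open (fst c)" "open (chart_image c)"
    and h: "homeomorphism (fst c) (chart_image c) (snd c) (chart_inv c)"
    using atlas assms unfolding holomorphic_atlas_def by simp_all
  show "open (fst c)" "open (chart_image c)" by (rule o)+
  show "continuous_on (fst c) (snd c)" "continuous_on (chart_image c) (chart_inv c)"
    using h by (simp_all add: homeomorphism_def)
  show "chart_inv c (snd c x) = x" if "x \<in> fst c" using homeomorphism_apply1[OF h that] .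
  show "snd c (chart_inv c z) = z" if "z \<in> chart_image c" using homeomorphism_apply2[OF h that] .
  show "chart_inv c z \<in> fst c" if "z \<in> chart_image c" using homeomorphism_image2[OF h] that by blast
  show "snd c x \<in> chart_image c" if "x \<in> fst c" using homeomorphism_image1[OF h] that by blast
qed

lemma chart_image_of_subset:
  assumes "c \<in> A" "B \<subseteq> fst c"
  shows "snd c ` B = chart_inv c -` B \<inter> chart_image c"
proof (intro equalityI subsetI)
  fix z assume "z \<in> snd c ` B"
  then show "z \<in> chart_inv c -` B \<inter> chart_image c"
    using assms chart_in[OF assms(1)] chart_inv_chart[OF assms(1)] by auto
next
  fix z assume "z \<in> chart_inv c -` B \<inter> chart_image c"
  then show "z \<in> snd c ` B"
    using chart_chart_inv[OF assms(1)] by (metis IntE imageI vimageE)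
qed

lemma measurable_chart_inv:
  assumes "c \<in> A"
  shows "chart_inv c \<in> measurable (restrict_space borel (chart_image c)) borel"
  by (rule borel_measurable_continuous_on_restrict[OF continuous_chart_inv[OF assms]])

lemma sets_chart_image:
  assumes "c \<in> A" "B \<in> sets borel" "B \<subseteq> fst c"
  shows "snd c ` B \<in> sets borel"
proof -
  have "chart_inv c -` B \<inter> space (restrict_space borel (chart_image c)) \<in> sets (restrict_space borel (chart_image c))"
    by (rule measurable_sets[OF measurable_chart_inv[OF assms(1)] assms(2)])
  then show ?thesis
    unfolding chart_image_of_subset[OF assms(1,3)]
    using open_chart_image[OF assms(1)]
    by (simp add: space_restrict_space sets_restrict_space_iff)
qed

lemma positive_form: "c \<in> A \<Longrightarrow> z \<in> chart_image c \<Longrightarrow> positive_11_form (\<omega> c z)"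
  using manifold
  unfolding compact_connected_kaehler_manifold_def kaehler_form_def is_two_form_def positive_11_form_def
  by blast

lemma omega_top_pos: "c \<in> A \<Longrightarrow> z \<in> chart_image c \<Longrightarrow> 0 < omega_top \<omega> c z"
  using pf_sum_pos[OF positive_form] by (simp add: omega_top_eq_pf_sum)

lemma continuous_omega_top:
  assumes "c \<in> A"
  shows "continuous_on (chart_image c) (omega_top \<omega> c)"
proof -
  have "smooth_on (chart_image c) (\<lambda>z. \<omega> c z u v)" for u v
    using two_form assms unfolding is_two_form_def by blast
  then have "continuous_on (chart_image c) (\<lambda>z. \<omega> c z u v)" for u v
    by (rule smooth_on_continuous)
  then show ?thesis
    unfolding omega_top_def by (intro continuous_intros) simp_all
qed

lemma set_borel_measurable_omega_top:
  assumes "c \<in> A" "S \<in> sets borel" "S \<subseteq> chart_image c"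
  shows "set_borel_measurable borel S (omega_top \<omega> c)"
  unfolding set_borel_measurable_def
  by (rule borel_measurable_continuous_on_indicator[OF assms(2)
        continuous_on_subset[OF continuous_omega_top[OF assms(1)] assms(3)]])

definition chart_measure :: "('a, 'n) chart \<Rightarrow> 'a measure" where
  "chart_measure c =
     distr (density (restrict_space lborel (chart_image c)) (\<lambda>z. ennreal (omega_top \<omega> c z))) borel (chart_inv c)"

lemma sets_chart_measure [simp]: "sets (chart_measure c) = sets borel"
  by (simp add: chart_measure_def)

lemma emeasure_chart_measure:
  assumes c: "c \<in> A" and B: "B \<in> sets borel" "B \<subseteq> fst c"
  shows "emeasure (chart_measure c) B
    = (\<integral>\<^sup>+z. ennreal (omega_top \<omega> c z) * indicator (snd c ` B) z \<partial>lborel)"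
proof -
  let ?R = "restrict_space lborel (chart_image c)"
  have R: "chart_inv c \<in> measurable ?R borel"
    using measurable_chart_inv[OF c] by (simp cong: measurable_cong_sets add: sets_restrict_space)
  have o: "(\<lambda>z. ennreal (omega_top \<omega> c z)) \<in> borel_measurable ?R"
    using borel_measurable_continuous_on_restrict[OF continuous_omega_top[OF c]]
    by (simp cong: measurable_cong_sets add: sets_restrict_space)
  have im: "chart_inv c -` B \<inter> space ?R = snd c ` B"
    using chart_image_of_subset[OF c B(2)] by (simp add: space_restrict_space)
  have s: "snd c ` B \<in> sets ?R"
    using measurable_sets[OF R B(1)] unfolding im .
  have "emeasure (chart_measure c) B = emeasure (density ?R (\<lambda>z. ennreal (omega_top \<omega> c z))) (snd c ` B)"
    unfolding chart_measure_def using R B im by (subst emeasure_distr) auto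
  also have "\<dots> = (\<integral>\<^sup>+z. ennreal (omega_top \<omega> c z) * indicator (snd c ` B) z \<partial>?R)"
    by (rule emeasure_density[OF o s])
  also have "\<dots> = (\<integral>\<^sup>+z. ennreal (omega_top \<omega> c z) * indicator (snd c ` B) z * indicator (chart_image c) z \<partial>lborel)"
    using open_chart_image[OF c] by (subst nn_integral_restrict_space) auto
  also have "\<dots> = (\<integral>\<^sup>+z. ennreal (omega_top \<omega> c z) * indicator (snd c ` B) z \<partial>lborel)"
    using chart_in[OF c] B(2) by (intro nn_integral_cong) (auto simp: indicator_def)
  finally show ?thesis .
qed

text \<open>
  The coefficient of \<open>\<omega>\<^sup>n\<close> is multiplied by the Jacobian determinant when the chart is changed.
  Both coefficients are positive, so the determinant equals its absolute value, and the change of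
  variables formula applies.
\<close>

lemma chart_measure_compatible:
  assumes c: "c \<in> A" and d: "d \<in> A" and B: "B \<in> sets borel" "B \<subseteq> fst c" "B \<subseteq> fst d"
  shows "emeasure (chart_measure c) B = emeasure (chart_measure d) B"
proof -
  let ?T = "transition c d"
  let ?S = "snd c ` B"
  have sub: "?S \<subseteq> chart_image c" "snd d ` B \<subseteq> chart_image d" using chart_in[OF c] chart_in[OF d] B by blast+
  have T: "?T (snd c x) = snd d x" if "x \<in> B" for x
    using that B chart_inv_chart[OF c] by (auto simp: transition_def)
  have im: "?T ` ?S = snd d ` B" using T by (auto simp: image_image)
  have inj: "inj_on ?T ?S"
  proof (rule inj_onI)
    fix z w assume "z \<in> ?S" "w \<in> ?S" "?T z = ?T w"
    then obtain x y where xy: "x \<in> B" "y \<in> B" "z = snd c x" "w = snd c y" by blast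
    then have "snd d x = snd d y" using T \<open>?T z = ?T w\<close> by simp
    then have "x = y" using xy B chart_inv_chart[OF d] by (metis subsetD)
    then show "z = w" using xy by simp
  qed
  have der: "(?T has_derivative frechet_derivative ?T (at z)) (at z)" if "z \<in> ?S" for z
  proof -
    have "z \<in> snd c ` (fst c \<inter> fst d)" using that B by auto
    then obtain L where "(?T has_derivative L) (at z)"
      using atlas c d unfolding holomorphic_atlas_def holomorphic_map_on_def by blast
    then show ?thesis using frechet_derivative_at by metis
  qed
  have "(\<integral>\<^sup>+z\<in>?S. omega_top \<omega> c z \<partial>lborel) = (\<integral>\<^sup>+w\<in>?T ` ?S. omega_top \<omega> d w \<partial>lborel)"
  proof (rule nn_integral_change_of_variables_complex[OF _ der inj])
    show "?S \<in> sets borel" by (rule sets_chart_image[OF c B(1,2)])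
    show "set_borel_measurable borel (?T ` ?S) (omega_top \<omega> d)"
      unfolding im by (rule set_borel_measurable_omega_top[OF d sets_chart_image[OF d B(1,3)] sub(2)])
    show "set_borel_measurable borel ?S (omega_top \<omega> c)"
      by (rule set_borel_measurable_omega_top[OF c sets_chart_image[OF c B(1,2)] sub(1)])
    show "0 \<le> omega_top \<omega> d w" if "w \<in> ?T ` ?S" for w
      using that sub(2) omega_top_pos[OF d] unfolding im by (auto intro: less_imp_le)
    fix z assume z: "z \<in> ?S"
    let ?T' = "frechet_derivative ?T (at z)"
    let ?D = "det (\<chi> k l. real_coord (?T' (real_basis k)) l)"
    have zi: "?T z \<in> chart_image d" using z im sub(2) by blast
    have "z \<in> snd c ` (fst c \<inter> fst d)" using z B by auto
    then have "\<omega> c z u v = \<omega> d (?T z) (?T' u) (?T' v)" for u v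
      using two_form c d unfolding is_two_form_def by blast
    then have "pf_sum (\<omega> c z) real_basis = pf_sum (\<omega> d (?T z)) (\<lambda>k. ?T' (real_basis k))"
      by (simp add: pf_sum_def)
    also have "\<dots> = ?D * pf_sum (\<omega> d (?T z)) real_basis"
      using positive_form[OF d zi] by (intro pf_sum_real_basis_transform) (simp add: positive_11_form_def)
    finally have D: "omega_top \<omega> c z = ?D * omega_top \<omega> d (?T z)"
      by (simp add: omega_top_eq_pf_sum)
    moreover have "0 < omega_top \<omega> c z" "0 < omega_top \<omega> d (?T z)"
      using omega_top_pos[OF c subsetD[OF sub(1) z]] omega_top_pos[OF d zi] by simp_all
    ultimately have "0 < ?D" by (metis zero_less_mult_pos2)
    then show "omega_top \<omega> c z = \<bar>?D\<bar> * omega_top \<omega> d (?T z)" using D by simp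
  qed
  then show ?thesis
    unfolding emeasure_chart_measure[OF c B(1,2)] emeasure_chart_measure[OF d B(1,3)] im .
qed

definition is_top_measure :: "'a measure \<Rightarrow> bool" where
  "is_top_measure \<mu> \<longleftrightarrow> sets \<mu> = sets borel \<and>
     (\<forall>c\<in>A. \<forall>B\<in>sets borel. B \<subseteq> fst c \<longrightarrow>
        emeasure \<mu> B = (\<integral>\<^sup>+z. ennreal (omega_top \<omega> c z) * indicator (snd c ` B) z \<partial>lborel))"

lemma is_top_measure_iff:
  "is_top_measure \<mu> \<longleftrightarrow> sets \<mu> = sets borel \<and>
     (\<forall>c\<in>A. \<forall>B\<in>sets borel. B \<subseteq> fst c \<longrightarrow> emeasure \<mu> B = emeasure (chart_measure c) B)"
  unfolding is_top_measure_def using emeasure_chart_measure by auto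

text \<open>
  Finitely many charts cover the manifold. Removing from each the preceding ones leaves disjoint
  Borel pieces, and a measure is determined by what it is on subsets of the pieces.
\<close>

lemma borel_pieces:
  obtains e :: "nat \<Rightarrow> ('a, 'n) chart" and P :: "nat \<Rightarrow> 'a set" and m :: nat
  where "\<And>i. i < m \<Longrightarrow> e i \<in> A" "\<And>i. i < m \<Longrightarrow> P i \<subseteq> fst (e i)" "\<And>i. P i \<in> sets borel"
    "disjoint_family P" "(\<Union>i<m. P i) = UNIV"
proof -
  have "\<exists>C\<subseteq>A. finite C \<and> (UNIV :: 'a set) \<subseteq> (\<Union>c\<in>C. fst c)"
    by (rule compactE_image[OF compact_UNIV, of A fst])
      (use open_chart_domain chart_cover in blast)+
  then obtain C where C: "C \<subseteq> A" "finite C" "(\<Union>c\<in>C. fst c) = UNIV" by blast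
  obtain e m where e: "C = e ` {..<m::nat}"
    using finite_imp_nat_seg_image_inj_on[OF C(2)] by (metis lessThan_def)
  define U where "U i = (if i < m then fst (e i) else {})" for i
  have U: "U i \<in> sets borel" for i
  proof (cases "i < m")
    case True
    then have "e i \<in> A" using C(1) e by blast
    then show ?thesis using open_chart_domain by (simp add: U_def)
  qed (simp add: U_def)
  show ?thesis
  proof (rule that[of m e "disjointed U"])
    show "e i \<in> A" if "i < m" for i using that e C by auto
    show "disjointed U i \<subseteq> fst (e i)" if "i < m" for i
      using disjointed_subset[of U i] that by (simp add: U_def)
    show "disjointed U i \<in> sets borel" for i
      using sets.range_disjointed_sets[of U borel] U by blast
    show "disjoint_family (disjointed U)" by (rule disjoint_family_disjointed)
    have "disjointed U i = {}" if "\<not> i < m" for i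
      using disjointed_subset[of U i] that by (simp add: U_def)
    then have "(\<Union>i<m. disjointed U i) = (\<Union>i. disjointed U i)" by blast
    also have "\<dots> = (\<Union>i. U i)" by (rule UN_disjointed_eq)
    also have "\<dots> = UNIV" using C(3) unfolding e U_def by fastforce
    finally show "(\<Union>i<m. disjointed U i) = UNIV" .
  qed
qed

lemma emeasure_pieces:
  fixes P :: "nat \<Rightarrow> 'a set"
  assumes "disjoint_family P" "\<And>i. P i \<in> sets borel" "(\<Union>i<m. P i) = UNIV"
    and "sets \<mu> = sets borel" "B \<in> sets borel"
  shows "emeasure \<mu> B = (\<Sum>i<m. emeasure \<mu> (B \<inter> P i))"
proof -
  have "(\<Sum>i<m. emeasure \<mu> (B \<inter> P i)) = emeasure \<mu> (\<Union>i<m. B \<inter> P i)"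
    using assms by (intro sum_emeasure) (auto simp: disjoint_family_on_def)
  also have "(\<Union>i<m. B \<inter> P i) = B" using assms(3) by blast
  finally show ?thesis by simp
qed

lemma top_measure_unique:
  assumes "is_top_measure \<mu>" "is_top_measure \<mu>'"
  shows "\<mu> = \<mu>'"
proof -
  obtain m e P where eP: "\<And>i. i < m \<Longrightarrow> e i \<in> A" "\<And>i. i < m \<Longrightarrow> P i \<subseteq> fst (e i)"
    "\<And>i. P i \<in> sets borel" "disjoint_family P" "(\<Union>i<m::nat. P i) = (UNIV :: 'a set)"
    by (rule borel_pieces) (rule that)
  show ?thesis
  proof (rule measure_eqI)
    show "sets \<mu> = sets \<mu>'" using assms by (simp add: is_top_measure_def)
    fix B assume "B \<in> sets \<mu>"
    then have B: "B \<in> sets borel" using assms by (simp add: is_top_measure_def)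
    have "emeasure \<nu> B = (\<Sum>i<m. emeasure (chart_measure (e i)) (B \<inter> P i))" if "is_top_measure \<nu>" for \<nu>
    proof -
      have "sets \<nu> = sets borel" using that by (simp add: is_top_measure_def)
      note emeasure_pieces[OF eP(4,3,5) this B]
      also have "(\<Sum>i<m. emeasure \<nu> (B \<inter> P i)) = (\<Sum>i<m. emeasure (chart_measure (e i)) (B \<inter> P i))"
      proof (intro sum.cong refl)
        fix i assume i: "i \<in> {..<m}"
        have "e i \<in> A" "B \<inter> P i \<in> sets borel" "B \<inter> P i \<subseteq> fst (e i)"
          using eP(1)[of i] eP(2)[of i] eP(3)[of i] B i by auto
        then show "emeasure \<nu> (B \<inter> P i) = emeasure (chart_measure (e i)) (B \<inter> P i)"
          using that unfolding is_top_measure_iff by blast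
      qed
      finally show ?thesis .
    qed
    then show "emeasure \<mu> B = emeasure \<mu>' B" using assms by simp
  qed
qed

lemma top_measure_exists: "\<exists>\<mu>. is_top_measure \<mu>"
proof -
  obtain m e P where eP: "\<And>i. i < m \<Longrightarrow> e i \<in> A" "\<And>i. i < m \<Longrightarrow> P i \<subseteq> fst (e i)"
    "\<And>i. P i \<in> sets borel" "disjoint_family P" "(\<Union>i<m::nat. P i) = (UNIV :: 'a set)"
    by (rule borel_pieces) (rule that)
  define f where "f B = (\<Sum>i<m. emeasure (chart_measure (e i)) (B \<inter> P i))" for B
  define \<mu> where "\<mu> = measure_of (UNIV :: 'a set) (sets borel) f"
  have s: "sets \<mu> = sets borel"
    unfolding \<mu>_def using sets.sigma_sets_eq[of borel] by (simp add: sets_measure_of_conv)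
  have em: "emeasure \<mu> B = f B" if "B \<in> sets borel" for B
    unfolding \<mu>_def
  proof (rule emeasure_measure_of_sigma)
    show "sigma_algebra UNIV (sets borel)" using sets.sigma_algebra_axioms[of borel] by simp
    show "positive (sets borel) f" by (simp add: positive_def f_def)
    show "countably_additive (sets borel) f"
    proof (rule countably_additiveI)
      fix X :: "nat \<Rightarrow> 'a set" assume X: "range X \<subseteq> sets borel" "disjoint_family X"
      have "(\<Sum>k. f (X k)) = (\<Sum>i<m. \<Sum>k. emeasure (chart_measure (e i)) (X k \<inter> P i))"
        unfolding f_def by (intro suminf_sum) (rule summableI)
      also have "\<dots> = (\<Sum>i<m. emeasure (chart_measure (e i)) (\<Union>k. X k \<inter> P i))"
        using X eP(3) by (intro sum.cong suminf_emeasure) (auto simp: disjoint_family_on_def)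
      also have "\<dots> = f (\<Union>k. X k)"
        by (simp add: f_def)
      finally show "(\<Sum>k. f (X k)) = f (\<Union>k. X k)" .
    qed
  qed (rule that)
  have "emeasure \<mu> B = emeasure (chart_measure c) B" if "c \<in> A" "B \<in> sets borel" "B \<subseteq> fst c" for c B
  proof -
    have "emeasure \<mu> B = (\<Sum>i<m. emeasure (chart_measure (e i)) (B \<inter> P i))"
      using em[OF that(2)] by (simp add: f_def)
    also have "\<dots> = (\<Sum>i<m. emeasure (chart_measure c) (B \<inter> P i))"
      using eP that by (intro sum.cong refl chart_measure_compatible) auto
    also have "\<dots> = emeasure (chart_measure c) B"
      by (rule emeasure_pieces[OF eP(4,3,5) _ that(2), symmetric]) simp
    finally show ?thesis .
  qed
  with s show ?thesis unfolding is_top_measure_iff by blast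
qed

abbreviation "vol \<equiv> omega_top_measure A \<omega>"

lemma is_top_measure_vol: "is_top_measure vol"
proof -
  have "vol = (THE \<mu>. is_top_measure \<mu>)"
    by (simp add: omega_top_measure_def is_top_measure_def)
  also have "is_top_measure (THE \<mu>. is_top_measure \<mu>)"
    using top_measure_exists top_measure_unique by (metis theI)
  finally show ?thesis .
qed

lemma sets_vol [measurable_cong, simp]: "sets vol = sets borel"
  using is_top_measure_vol by (simp add: is_top_measure_def)

lemma space_vol [simp]: "space vol = UNIV"
  using sets_eq_imp_space_eq[OF sets_vol] by simp

lemma emeasure_vol:
  "c \<in> A \<Longrightarrow> B \<in> sets borel \<Longrightarrow> B \<subseteq> fst c \<Longrightarrow>
    emeasure vol B = (\<integral>\<^sup>+z. ennreal (omega_top \<omega> c z) * indicator (snd c ` B) z \<partial>lborel)"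
  using is_top_measure_vol by (simp add: is_top_measure_def)

text \<open>
  A point has a neighbourhood that a chart maps to a ball with compact closure in the image of the chart,
  where the density is bounded.
\<close>

lemma vol_locally_finite: "\<exists>O'. open O' \<and> x \<in> O' \<and> emeasure vol O' < \<infinity>"
proof -
  obtain c where c: "c \<in> A" "x \<in> fst c" by (rule chart_cover)
  obtain r where r: "0 < r" "cball (snd c x) r \<subseteq> chart_image c"
    using open_contains_cball chart_in[OF c] open_chart_image[OF c(1)] by metis
  have "compact (omega_top \<omega> c ` cball (snd c x) r)"
    by (intro compact_continuous_image continuous_on_subset[OF continuous_omega_top[OF c(1)] r(2)]) simp
  then obtain K where K: "\<And>z. z \<in> cball (snd c x) r \<Longrightarrow> omega_top \<omega> c z \<le> K"
    by (metis bounded_imp_bdd_above compact_imp_bounded bdd_above.unfold imageI)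
  let ?O = "snd c -` ball (snd c x) r \<inter> fst c"
  have O: "open ?O"
    using continuous_open_preimage[OF continuous_chart[OF c(1)] open_chart_domain[OF c(1)], of "ball (snd c x) r"]
    by (simp add: Int_commute)
  have "emeasure vol ?O = (\<integral>\<^sup>+z. ennreal (omega_top \<omega> c z) * indicator (snd c ` ?O) z \<partial>lborel)"
    by (rule emeasure_vol[OF c(1)]) (use O in auto)
  also have "\<dots> \<le> (\<integral>\<^sup>+z. ennreal K * indicator (ball (snd c x) r) z \<partial>lborel)"
    using K by (intro nn_integral_mono) (auto simp: indicator_def intro!: ennreal_leI)
  also have "\<dots> = ennreal K * emeasure lborel (ball (snd c x) r)"
    by (simp add: nn_integral_cmult_indicator)
  also have "\<dots> < \<infinity>"
    using emeasure_bounded_finite[of "ball (snd c x) r"] by (simp add: ennreal_mult_less_top)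
  finally show ?thesis using O c r(1) by (intro exI[of _ ?O]) auto
qed

lemma finite_measure_vol: "finite_measure vol"
proof
  obtain O' where O': "\<And>x. open (O' x) \<and> x \<in> O' x \<and> emeasure vol (O' x) < \<infinity>"
    using vol_locally_finite by metis
  obtain X where X: "finite X" "UNIV \<subseteq> (\<Union>x\<in>X. O' x)"
    by (rule compactE_image[OF compact_UNIV, of UNIV O']) (use O' in auto)
  have "emeasure vol (space vol) \<le> emeasure vol (\<Union>x\<in>X. O' x)"
    using X(2) O' by (intro emeasure_mono) (auto intro!: borel_open open_UN)
  also have "\<dots> \<le> (\<Sum>x\<in>X. emeasure vol (O' x))"
    using X(1) O' by (intro emeasure_subadditive_finite) auto
  also have "\<dots> < \<infinity>" using O' X(1) by auto
  finally show "emeasure vol (space vol) \<noteq> \<infinity>" by simp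
qed

text \<open>
  In a chart a nonempty open set is not negligible, and the density is positive.
\<close>

lemma vol_open_pos:
  assumes "open O'" "x \<in> O'"
  shows "0 < emeasure vol O'"
proof -
  obtain c where c: "c \<in> A" "x \<in> fst c" by (rule chart_cover)
  let ?S = "snd c ` (O' \<inter> fst c)"
  have sub: "?S \<subseteq> chart_image c" using chart_in[OF c(1)] by auto
  have meas: "O' \<inter> fst c \<in> sets borel" using assms open_chart_domain[OF c(1)] by auto
  have "open ?S"
    using continuous_open_preimage[OF continuous_chart_inv[OF c(1)] open_chart_image[OF c(1)]
        open_Int[OF assms(1) open_chart_domain[OF c(1)]]] chart_image_of_subset[OF c(1), of "O' \<inter> fst c"]
    by (simp add: Int_commute)
  moreover have "?S \<noteq> {}" using assms c by auto
  ultimately have "\<not> negligible ?S" using open_not_negligible by blast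
  then have S: "?S \<notin> null_sets lborel" using negligible_iff_null_sets null_sets_completionI by blast
  have "emeasure vol (O' \<inter> fst c) \<noteq> 0"
  proof
    assume "emeasure vol (O' \<inter> fst c) = 0"
    then have "(\<integral>\<^sup>+z\<in>?S. omega_top \<omega> c z \<partial>lborel) = 0"
      using emeasure_vol[OF c(1) meas] by simp
    moreover have "(\<lambda>z. ennreal (omega_top \<omega> c z) * indicator ?S z) = (\<lambda>z. ennreal (indicator ?S z *\<^sub>R omega_top \<omega> c z))"
      by (auto simp: fun_eq_iff indicator_def)
    moreover have "(\<lambda>z. ennreal (indicator ?S z *\<^sub>R omega_top \<omega> c z)) \<in> borel_measurable lborel"
      using set_borel_measurable_omega_top[OF c(1) sets_chart_image[OF c(1) meas] sub]
      unfolding set_borel_measurable_def by measurable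
    ultimately have "AE z in lborel. ennreal (indicator ?S z *\<^sub>R omega_top \<omega> c z) = 0"
      by (simp add: nn_integral_0_iff_AE)
    then have "AE z in lborel. z \<notin> ?S"
    proof (rule AE_mp, intro AE_I2 impI notI)
      fix z assume "ennreal (indicator ?S z *\<^sub>R omega_top \<omega> c z) = 0" "z \<in> ?S"
      moreover have "0 < omega_top \<omega> c z" using omega_top_pos[OF c(1)] \<open>z \<in> ?S\<close> sub by blast
      ultimately show False by simp
    qed
    then show False
      using S AE_iff_null_sets[of ?S lborel] sets_chart_image[OF c(1) meas] by simp
  qed
  then show ?thesis
    using emeasure_mono[of "O' \<inter> fst c" O' vol] assms(1) by (auto simp: zero_less_iff_neq_zero)
qed

end

section \<open>Equality of mixed partial derivatives\<close>

lemma mixed_difference_mean_value: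
  fixes f :: "real \<Rightarrow> real \<Rightarrow> real"
  assumes h: "0 < h"
    and f1: "\<And>a b. a \<in> {s..s+h} \<Longrightarrow> b \<in> {t..t+h} \<Longrightarrow> ((\<lambda>a. f a b) has_real_derivative f1 a b) (at a)"
    and f12: "\<And>a b. a \<in> {s..s+h} \<Longrightarrow> b \<in> {t..t+h} \<Longrightarrow> ((\<lambda>b. f1 a b) has_real_derivative f12 a b) (at b)"
  shows "\<exists>a\<in>{s..s+h}. \<exists>b\<in>{t..t+h}. f (s + h) (t + h) - f s (t + h) - (f (s + h) t - f s t) = h * h * f12 a b"
proof -
  have "\<exists>a. s < a \<and> a < s + h \<and>
      (f (s + h) (t + h) - f (s + h) t) - (f s (t + h) - f s t) = (s + h - s) * (f1 a (t + h) - f1 a t)"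
    by (rule MVT2) (use h in \<open>auto intro!: DERIV_diff f1\<close>)
  then obtain a where a: "s < a" "a < s + h"
    "(f (s + h) (t + h) - f (s + h) t) - (f s (t + h) - f s t) = h * (f1 a (t + h) - f1 a t)"
    by auto
  have "\<exists>b. t < b \<and> b < t + h \<and> f1 a (t + h) - f1 a t = (t + h - t) * f12 a b"
    by (rule MVT2) (use h a in \<open>auto intro!: f12\<close>)
  then obtain b where b: "t < b" "b < t + h" "f1 a (t + h) - f1 a t = h * f12 a b"
    by auto
  have "f (s + h) (t + h) - f s (t + h) - (f (s + h) t - f s t) = h * h * f12 a b"
    using a(3) b(3) by simp
  then show ?thesis using a b by (intro bexI[of _ a] bexI[of _ b]) auto
qed

text \<open>
  The second difference of \<open>f\<close> over a small square is its area times a value of \<open>f12\<close>, and also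
  its area times a value of \<open>f21\<close>, at points close to \<open>(s, t)\<close>.
\<close>

lemma mixed_partials:
  fixes f :: "real \<Rightarrow> real \<Rightarrow> real"
  assumes op: "open I" "open J" "s \<in> I" "t \<in> J"
    and f1: "\<And>a b. a \<in> I \<Longrightarrow> b \<in> J \<Longrightarrow> ((\<lambda>a. f a b) has_real_derivative f1 a b) (at a)"
    and f2: "\<And>a b. a \<in> I \<Longrightarrow> b \<in> J \<Longrightarrow> ((\<lambda>b. f a b) has_real_derivative f2 a b) (at b)"
    and f12: "\<And>a b. a \<in> I \<Longrightarrow> b \<in> J \<Longrightarrow> ((\<lambda>b. f1 a b) has_real_derivative f12 a b) (at b)"
    and f21: "\<And>a b. a \<in> I \<Longrightarrow> b \<in> J \<Longrightarrow> ((\<lambda>a. f2 a b) has_real_derivative f21 a b) (at a)"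
    and c12: "continuous_on (I \<times> J) (\<lambda>(a, b). f12 a b)"
    and c21: "continuous_on (I \<times> J) (\<lambda>(a, b). f21 a b)"
  shows "f12 s t = f21 s t"
proof (rule ccontr)
  assume ne: "f12 s t \<noteq> f21 s t"
  define e where "e = \<bar>f12 s t - f21 s t\<bar> / 2"
  have e: "0 < e" using ne by (simp add: e_def)
  have "open (I \<times> J)" "(s, t) \<in> I \<times> J" using op by (auto intro: open_Times)
  note at = at_within_open[OF this(2,1)]
  have near: "\<exists>d>0. \<forall>q. dist q (s, t) < d \<longrightarrow> \<bar>g (fst q) (snd q) - g s t\<bar> < e"
    if "continuous_on (I \<times> J) (\<lambda>(a, b). g a b)" for g :: "real \<Rightarrow> real \<Rightarrow> real"
  proof -
    have "continuous (at (s, t)) (\<lambda>(a, b). g a b)"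
      using that \<open>(s, t) \<in> I \<times> J\<close> unfolding continuous_on_eq_continuous_within by (metis at)
    then have "\<exists>d>0. \<forall>q. dist q (s, t) < d \<longrightarrow> dist ((\<lambda>(a, b). g a b) q) ((\<lambda>(a, b). g a b) (s, t)) < e"
      using e unfolding continuous_at_eps_delta by blast
    then show ?thesis by (simp add: dist_real_def case_prod_unfold)
  qed
  obtain d1 d2 where d: "0 < d1" "0 < d2"
    and d1: "\<And>q. dist q (s, t) < d1 \<Longrightarrow> \<bar>f12 (fst q) (snd q) - f12 s t\<bar> < e"
    and d2: "\<And>q. dist q (s, t) < d2 \<Longrightarrow> \<bar>f21 (fst q) (snd q) - f21 s t\<bar> < e"
    using near[OF c12] near[OF c21] by meson
  obtain r1 r2 where r: "0 < r1" "cball s r1 \<subseteq> I" "0 < r2" "cball t r2 \<subseteq> J"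
    using op(1)[unfolded open_contains_cball] op(2)[unfolded open_contains_cball] op(3,4) by meson
  \<comment> \<open>Points of the square have distance at most \<open>2 h\<close> from its corner.\<close>
  define h where "h = Min {d1 / 3, d2 / 3, r1, r2}"
  have h: "0 < h" "h \<le> d1 / 3" "h \<le> d2 / 3" "h \<le> r1" "h \<le> r2"
    using d r by (auto simp: h_def)
  have I: "a \<in> I" if "a \<in> {s..s+h}" for a
    using that h r(2) by (auto simp: subset_iff dist_real_def)
  have J: "b \<in> J" if "b \<in> {t..t+h}" for b
    using that h r(4) by (auto simp: subset_iff dist_real_def)
  have dist: "dist (a, b) (s, t) \<le> 2 * h" if "a \<in> {s..s+h}" "b \<in> {t..t+h}" for a b
  proof -
    have "dist (a, b) (s, t) \<le> dist a s + dist b t"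
      by (simp add: dist_Pair_Pair sqrt_sum_squares_le_sum)
    also have "\<dots> \<le> 2 * h" using that by (auto simp: dist_real_def)
    finally show ?thesis .
  qed
  have "\<exists>a\<in>{s..s+h}. \<exists>b\<in>{t..t+h}. f (s + h) (t + h) - f s (t + h) - (f (s + h) t - f s t) = h * h * f12 a b"
    by (rule mixed_difference_mean_value[OF h(1), of s t f f1 f12])
      (rule f1[OF I J] f12[OF I J], assumption+)+
  then obtain a b where ab: "a \<in> {s..s+h}" "b \<in> {t..t+h}"
    "f (s + h) (t + h) - f s (t + h) - (f (s + h) t - f s t) = h * h * f12 a b"
    by blast
  have "\<exists>b\<in>{t..t+h}. \<exists>a\<in>{s..s+h}. f (s + h) (t + h) - f (s + h) t - (f s (t + h) - f s t) = h * h * f21 a b"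
    by (rule mixed_difference_mean_value[OF h(1), of t s "\<lambda>b a. f a b" "\<lambda>b a. f2 a b" "\<lambda>b a. f21 a b"])
      (rule f2[OF I J] f21[OF I J], assumption+)+
  then obtain a' b' where ab': "a' \<in> {s..s+h}" "b' \<in> {t..t+h}"
    "f (s + h) (t + h) - f (s + h) t - (f s (t + h) - f s t) = h * h * f21 a' b'"
    by blast
  have "h * h * f12 a b = h * h * f21 a' b'" using ab(3) ab'(3) by linarith
  then have "f12 a b = f21 a' b'" using h(1) by simp
  moreover have "\<bar>f12 a b - f12 s t\<bar> < e" using d1[of "(a, b)"] dist[OF ab(1,2)] h d by simp
  moreover have "\<bar>f21 a' b' - f21 s t\<bar> < e" using d2[of "(a', b')"] dist[OF ab'(1,2)] h d by simp
  ultimately show False unfolding e_def by (simp add: abs_if split: if_splits)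
qed

section \<open>Smooth families of functions and their integrals\<close>

definition param_deriv :: "'p \<Rightarrow> ('p::real_normed_vector \<Rightarrow> 'a \<Rightarrow> real) \<Rightarrow> 'p \<Rightarrow> 'a \<Rightarrow> real" where
  "param_deriv v H p x = frechet_derivative (\<lambda>p. H p x) (at p) v"

context kaehler_manifold
begin

lemma open_param_chart: "open P \<Longrightarrow> c \<in> A \<Longrightarrow> open (P \<times> chart_image c)"
  by (simp add: open_Times open_chart_image)

lemma smooth_family_cong:
  assumes "open P" "\<And>p x. p \<in> P \<Longrightarrow> H p x = K p x" "smooth_family A P H"
  shows "smooth_family A P K"
  unfolding smooth_family_def
proof
  fix c assume c: "c \<in> A"
  show "smooth_on (P \<times> chart_image c) (\<lambda>(p, z). K p (chart_inv c z))"
    by (rule smooth_on_cong[OF open_param_chart[OF assms(1) c], of "\<lambda>(p, z). H p (chart_inv c z)"])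
      (use assms c in \<open>auto simp: smooth_family_def\<close>)
qed

lemma smooth_family_const: "smooth_family A P (\<lambda>p x. k)"
  unfolding smooth_family_def case_prod_unfold by (simp add: smooth_on_const)

lemma smooth_family_add:
  assumes "open P" "smooth_family A P H" "smooth_family A P K"
  shows "smooth_family A P (\<lambda>p x. H p x + K p x)"
  using assms unfolding smooth_family_def case_prod_unfold
  by (intro ballI smooth_on_add open_param_chart) auto

lemma smooth_family_mult:
  assumes "open P" "smooth_family A P H" "smooth_family A P K"
  shows "smooth_family A P (\<lambda>p x. H p x * K p x)"
  using assms unfolding smooth_family_def case_prod_unfold
  by (intro ballI smooth_on_mult open_param_chart) auto

lemma smooth_family_compose:
  assumes "open P" "smooth_family A P H" "smooth_on T h" "\<And>p x. p \<in> P \<Longrightarrow> H p x \<in> T"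
  shows "smooth_family A P (\<lambda>p x. h (H p x))"
  unfolding smooth_family_def case_prod_unfold
proof
  fix c assume c: "c \<in> A"
  show "smooth_on (P \<times> chart_image c) (\<lambda>q. h (H (fst q) (chart_inv c (snd q))))"
    by (rule smooth_on_compose_real[where T = T, OF open_param_chart[OF assms(1) c]])
      (use assms c in \<open>auto simp: smooth_family_def case_prod_unfold\<close>)
qed

lemma smooth_family_diff:
  assumes "open P" "smooth_family A P H" "smooth_family A P K"
  shows "smooth_family A P (\<lambda>p x. H p x - K p x)"
  using smooth_family_add[OF assms(1,2) smooth_family_mult[OF assms(1) smooth_family_const[of P "-1"] assms(3)]]
  by simp

lemma smooth_family_param:
  assumes "open P" "smooth_on P a"
  shows "smooth_family A P (\<lambda>p x. a p)"
  unfolding smooth_family_def case_prod_unfold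
proof
  fix c assume c: "c \<in> A"
  have "smooth_on (P \<times> chart_image c) (\<lambda>q. a (0 + fst q))"
    by (rule smooth_on_affine[OF assms(2,1) open_param_chart[OF assms(1) c] bounded_linear_fst]) auto
  then show "smooth_on (P \<times> chart_image c) (\<lambda>q. a (fst q))" by simp
qed

lemma smooth_family_fun:
  assumes "open P" "smooth_fun A f"
  shows "smooth_family A P (\<lambda>p. f)"
  unfolding smooth_family_def case_prod_unfold
proof
  fix c assume c: "c \<in> A"
  have "smooth_on (chart_image c) (f \<circ> chart_inv c)" using assms c by (simp add: smooth_fun_def)
  then have "smooth_on (P \<times> chart_image c) (\<lambda>q. (f \<circ> chart_inv c) (0 + snd q))"
    by (rule smooth_on_affine[OF _ open_chart_image[OF c] open_param_chart[OF assms(1) c] bounded_linear_snd]) auto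
  then show "smooth_on (P \<times> chart_image c) (\<lambda>q. f (chart_inv c (snd q)))" by simp
qed

lemma smooth_family_at:
  assumes "open P" "smooth_family A P H" "p \<in> P"
  shows "smooth_fun A (H p)"
  unfolding smooth_fun_def
proof
  fix c assume c: "c \<in> A"
  have "smooth_on (P \<times> chart_image c) (\<lambda>(p, z). H p (chart_inv c z))"
    using assms c by (simp add: smooth_family_def)
  then have "smooth_on (chart_image c) (\<lambda>z. (\<lambda>(p, z). H p (chart_inv c z)) ((p, 0) + (0, z)))"
    by (rule smooth_on_affine[OF _ open_param_chart[OF assms(1) c] open_chart_image[OF c]])
      (use assms in \<open>auto intro!: bounded_linear_Pair bounded_linear_zero bounded_linear_ident\<close>)
  then show "smooth_on (chart_image c) (H p \<circ> chart_inv c)" by (simp add: o_def)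
qed

lemma smooth_family_affine:
  assumes "open P" "open Q" "smooth_family A P H" "bounded_linear L" "\<And>q. q \<in> Q \<Longrightarrow> a + L q \<in> P"
  shows "smooth_family A Q (\<lambda>q. H (a + L q))"
  unfolding smooth_family_def
proof
  fix c assume c: "c \<in> A"
  have "smooth_on (P \<times> chart_image c) (\<lambda>(p, z). H p (chart_inv c z))"
    using assms c by (simp add: smooth_family_def)
  then have "smooth_on (Q \<times> chart_image c) (\<lambda>y. (\<lambda>(p, z). H p (chart_inv c z)) ((a, 0) + (L (fst y), snd y)))"
    by (rule smooth_on_affine[OF _ open_param_chart[OF assms(1) c] open_param_chart[OF assms(2) c]])
      (use assms in \<open>auto intro!: bounded_linear_Pair bounded_linear_snd
         bounded_linear_compose[OF _ bounded_linear_fst, unfolded o_def]\<close>)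
  then show "smooth_on (Q \<times> chart_image c) (\<lambda>(q, z). H (a + L q) (chart_inv c z))"
    by (simp add: case_prod_unfold)
qed

text \<open>
  Smoothness of a family is joint smoothness in the charts. The second part expresses the derivative in
  the parameter by the joint derivative; from this it follows that the parameter derivatives form a
  smooth family again.
\<close>

lemma smooth_family_has_derivative:
  assumes P: "open P" and H: "smooth_family A P H" and p: "p \<in> P"
  shows "((\<lambda>p. H p x) has_derivative (\<lambda>v. param_deriv v H p x)) (at p)"
    and "c \<in> A \<Longrightarrow> x \<in> fst c \<Longrightarrow>
      param_deriv v H p x = frechet_derivative (\<lambda>(p, z). H p (chart_inv c z)) (at (p, snd c x)) (v, 0)"
proof -
  have d: "((\<lambda>p. H p x) has_derivative
      (\<lambda>v. frechet_derivative (\<lambda>(p, z). H p (chart_inv c z)) (at (p, snd c x)) (v, 0))) (at p)"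
    if c: "c \<in> A" "x \<in> fst c" for c
  proof -
    have "smooth_on (P \<times> chart_image c) (\<lambda>(p, z). H p (chart_inv c z))"
      using H c by (simp add: smooth_family_def)
    then have "((\<lambda>(p, z). H p (chart_inv c z)) has_derivative
        frechet_derivative (\<lambda>(p, z). H p (chart_inv c z)) (at (p, snd c x))) (at (p, snd c x))"
      by (rule smooth_on_has_derivative) (use p chart_in c in auto)
    moreover have "((\<lambda>p. (p, snd c x)) has_derivative (\<lambda>v. (v, 0))) (at p)"
      by (auto intro!: derivative_eq_intros)
    ultimately have "(((\<lambda>(p, z). H p (chart_inv c z)) \<circ> (\<lambda>p. (p, snd c x))) has_derivative
        (frechet_derivative (\<lambda>(p, z). H p (chart_inv c z)) (at (p, snd c x)) \<circ> (\<lambda>v. (v, 0)))) (at p)"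
      by (rule diff_chain_at[rotated])
    then show ?thesis using chart_inv_chart[OF c] by (simp add: o_def)
  qed
  have e: "param_deriv v H p x = frechet_derivative (\<lambda>(p, z). H p (chart_inv c z)) (at (p, snd c x)) (v, 0)"
    if "c \<in> A" "x \<in> fst c" for c v
    using frechet_derivative_at[OF d[OF that]] unfolding param_deriv_def by metis
  then show "c \<in> A \<Longrightarrow> x \<in> fst c \<Longrightarrow>
      param_deriv v H p x = frechet_derivative (\<lambda>(p, z). H p (chart_inv c z)) (at (p, snd c x)) (v, 0)" .
  obtain c where c: "c \<in> A" "x \<in> fst c" by (rule chart_cover)
  show "((\<lambda>p. H p x) has_derivative (\<lambda>v. param_deriv v H p x)) (at p)"
    using d[OF c] e[OF c] by simp
qed

lemma smooth_family_param_deriv: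
  assumes P: "open P" and H: "smooth_family A P H"
  shows "smooth_family A P (param_deriv v H)"
  unfolding smooth_family_def
proof
  fix c assume c: "c \<in> A"
  have s: "smooth_on (P \<times> chart_image c) (\<lambda>(p, z). H p (chart_inv c z))"
    using H c by (simp add: smooth_family_def)
  show "smooth_on (P \<times> chart_image c) (\<lambda>(p, z). param_deriv v H p (chart_inv c z))"
  proof (rule smooth_on_cong[OF open_param_chart[OF P c] _ smooth_on_frechet[OF s, of "(v, 0)"]])
    fix q assume "q \<in> P \<times> chart_image c"
    then obtain p z where q: "q = (p, z)" "p \<in> P" "z \<in> chart_image c" by auto
    show "frechet_derivative (\<lambda>(p, z). H p (chart_inv c z)) (at q) (v, 0)
        = (\<lambda>(p, z). param_deriv v H p (chart_inv c z)) q"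
      using smooth_family_has_derivative(2)[OF P H q(2) c chart_inv_in[OF c q(3)], of v]
        chart_chart_inv[OF c q(3)] q(1) by simp
  qed
qed

lemma smooth_family_real_derivative:
  assumes "open I" "smooth_family A I H" "t \<in> I"
  shows "((\<lambda>t. H t x) has_real_derivative deriv (\<lambda>t. H t x) t) (at t)"
  using smooth_family_has_derivative(1)[OF assms]
  by (metis DERIV_deriv_iff_real_differentiable differentiable_def)

lemma smooth_family_deriv:
  assumes "open I" "smooth_family A I H"
  shows "smooth_family A I (\<lambda>t x. deriv (\<lambda>t. H t x) t)"
proof (rule smooth_family_cong[OF assms(1) _ smooth_family_param_deriv[OF assms, of 1]])
  fix t x assume "t \<in> I"
  then have "((\<lambda>t. H t x) has_derivative (*) (deriv (\<lambda>t. H t x) t)) (at t)"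
    using smooth_family_real_derivative[OF assms] by (simp add: has_field_derivative_def)
  from frechet_derivative_at[OF this] show "param_deriv 1 H t x = deriv (\<lambda>t. H t x) t"
    unfolding param_deriv_def by (metis mult.right_neutral)
qed

lemma continuous_smooth_family:
  assumes "open P" "smooth_family A P H"
  shows "continuous_on (P \<times> UNIV) (\<lambda>(p, x). H p x)"
proof (rule continuous_at_imp_continuous_on, rule ballI)
  fix q :: "'b \<times> 'a" assume "q \<in> P \<times> UNIV"
  then obtain p x where q: "q = (p, x)" "p \<in> P" by auto
  obtain c where c: "c \<in> A" "x \<in> fst c" by (rule chart_cover)
  have "continuous_on (P \<times> chart_image c) (\<lambda>(p, z). H p (chart_inv c z))"
    using assms c by (intro smooth_on_continuous) (simp add: smooth_family_def)
  moreover have "continuous_on (P \<times> fst c) (\<lambda>q. (fst q, snd c (snd q)))"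
    by (intro continuous_intros continuous_on_compose2[OF continuous_chart[OF c(1)]]) auto
  ultimately have "continuous_on (P \<times> fst c) (\<lambda>q. (\<lambda>(p, z). H p (chart_inv c z)) (fst q, snd c (snd q)))"
    by (rule continuous_on_compose2) (use chart_in[OF c(1)] in auto)
  moreover have "(\<lambda>(p, z). H p (chart_inv c z)) (fst q, snd c (snd q)) = (\<lambda>(p, x). H p x) q"
    if "q \<in> P \<times> fst c" for q
    using that chart_inv_chart[OF c(1)] by auto
  ultimately have "continuous_on (P \<times> fst c) (\<lambda>(p, x). H p x)"
    by (simp cong: continuous_on_cong)
  then show "isCont (\<lambda>(p, x). H p x) q"
    using q c open_Times[OF assms(1) open_chart_domain[OF c(1)]]
    by (simp add: continuous_on_eq_continuous_at)
qed

lemma continuous_smooth_family_at: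
  assumes "open P" "smooth_family A P H" "p \<in> P"
  shows "continuous_on UNIV (H p)"
proof -
  have "continuous_on UNIV (\<lambda>x. (\<lambda>(p, x). H p x) (p, x))"
    by (rule continuous_on_compose2[OF continuous_smooth_family[OF assms(1,2)]])
      (use assms(3) in \<open>auto intro!: continuous_intros\<close>)
  then show ?thesis by simp
qed

lemma continuous_smooth_fun: "smooth_fun A f \<Longrightarrow> continuous_on UNIV f"
  using continuous_smooth_family_at[OF open_UNIV smooth_family_fun[OF open_UNIV], of f "0 :: real"] by simp

lemma integrable_continuous:
  assumes "continuous_on UNIV f"
  shows "integrable vol (f :: 'a \<Rightarrow> real)"
proof -
  obtain K where "\<And>x. \<bar>f x\<bar> \<le> K"
    using compact_imp_bounded[OF compact_continuous_image[OF assms compact_UNIV]]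
    unfolding bounded_iff by auto
  then show ?thesis
    using finite_measure.integrable_const_bound[OF finite_measure_vol, of f K]
      borel_measurable_continuous_onI[OF assms] by (simp cong: measurable_cong_sets)
qed

lemma int_vol_add:
  assumes "continuous_on UNIV f" "continuous_on UNIV g"
  shows "int_vol A \<omega> (\<lambda>x. f x + g x) = int_vol A \<omega> f + int_vol A \<omega> g"
  using assms by (simp add: int_vol_def int_top_def integrable_continuous add_divide_distrib)

lemma int_vol_diff:
  assumes "continuous_on UNIV f" "continuous_on UNIV g"
  shows "int_vol A \<omega> (\<lambda>x. f x - g x) = int_vol A \<omega> f - int_vol A \<omega> g"
  using assms by (simp add: int_vol_def int_top_def integrable_continuous diff_divide_distrib)

lemma int_vol_cmult: "int_vol A \<omega> (\<lambda>x. k * f x) = k * int_vol A \<omega> f"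
  by (simp add: int_vol_def int_top_def)

lemma int_vol_pos:
  assumes "continuous_on UNIV f" "\<And>x. 0 \<le> f x" "f x \<noteq> 0"
  shows "0 < int_vol A \<omega> f"
proof -
  have i: "integrable vol f" using assms by (simp add: integrable_continuous)
  have "(\<integral>x. f x \<partial>vol) \<noteq> 0"
  proof
    assume "(\<integral>x. f x \<partial>vol) = 0"
    then have "AE x in vol. f x = 0"
      using integral_nonneg_eq_0_iff_AE[OF i] assms(2) by simp
    moreover have o: "open {x. f x \<noteq> 0}"
      using open_Collect_neq[OF assms(1) continuous_on_const[of UNIV 0]] by simp
    ultimately have "emeasure vol {x. f x \<noteq> 0} = 0"
      using AE_iff_null_sets[of "{x. f x \<noteq> 0}" vol] by auto
    then show False using vol_open_pos[OF o] assms(3) by auto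
  qed
  moreover have "0 \<le> (\<integral>x. f x \<partial>vol)" using assms(2) by simp
  ultimately show ?thesis by (simp add: int_vol_def int_top_def less_le)
qed

text \<open>
  Difference quotients of a smooth family are bounded, uniformly on the compact manifold, by the mean
  value theorem, so the derivative passes under the integral by dominated convergence.
\<close>

lemma int_vol_has_derivative:
  assumes I: "open I" and H: "smooth_family A I H" and t: "t \<in> I"
  shows "((\<lambda>t. int_vol A \<omega> (H t)) has_real_derivative int_vol A \<omega> (\<lambda>x. deriv (\<lambda>t. H t x) t)) (at t)"
proof -
  let ?H' = "\<lambda>t x. deriv (\<lambda>t. H t x) t"
  obtain r where r: "0 < r" "cball t r \<subseteq> I" using I t open_contains_cball by metis
  have "compact (cball t r \<times> (UNIV :: 'a set))" by (intro compact_Times compact_UNIV) simp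
  moreover have "continuous_on (cball t r \<times> UNIV) (\<lambda>(t, x). ?H' t x)"
    using continuous_smooth_family[OF I smooth_family_deriv[OF I H]]
    by (rule continuous_on_subset) (use r in auto)
  ultimately have "bounded ((\<lambda>(t, x). ?H' t x) ` (cball t r \<times> UNIV))"
    using compact_continuous_image compact_imp_bounded by blast
  then obtain K where K: "\<And>s x. s \<in> cball t r \<Longrightarrow> \<bar>?H' s x\<bar> \<le> K"
    unfolding bounded_iff by force
  have der: "((\<lambda>t. H t x) has_real_derivative ?H' s x) (at s)" if "s \<in> cball t r" for s x
    using smooth_family_real_derivative[OF I H] that r by blast
  have bound: "\<bar>(H (t + h) x - H t x) / h\<bar> \<le> K" if "h \<in> ball 0 r - {0}" for h x
  proof -
    have "norm (H (t + h) x - H t x) \<le> K * norm (t + h - t)"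
      by (rule field_differentiable_bound[of "cball t r" "\<lambda>s. H s x" "\<lambda>s. ?H' s x"])
        (use that r K der in \<open>auto intro: has_field_derivative_at_within simp: dist_real_def\<close>)
    then show ?thesis using that by (auto simp: divide_simps abs_if split: if_splits)
  qed
  have cont: "continuous_on UNIV (H s)" if "s \<in> cball t r" for s
    using continuous_smooth_family_at[OF I H] that r by blast
  have meas: "f \<in> borel_measurable vol" if "continuous_on UNIV f" for f :: "'a \<Rightarrow> real"
    using borel_measurable_continuous_onI[OF that] by (simp cong: measurable_cong_sets)
  \<comment> \<open>The limit is taken within the ball of increments for which the bound holds.\<close>
  have "((\<lambda>h. ((\<integral>x. H (t + h) x \<partial>vol) - (\<integral>x. H t x \<partial>vol)) / h) \<longlongrightarrow> (\<integral>x. ?H' t x \<partial>vol)) (at 0 within ball 0 r)"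
    unfolding tendsto_at_iff_sequentially
  proof (intro allI impI)
    fix X :: "nat \<Rightarrow> real" assume X: "\<forall>i. X i \<in> ball 0 r - {0}" "X \<longlonglongrightarrow> 0"
    have Xt: "t + X i \<in> cball t r" for i using X(1) by (auto simp: dist_real_def less_imp_le)
    have t': "t \<in> cball t r" using r by simp
    have "(\<lambda>i. \<integral>x. (H (t + X i) x - H t x) / X i \<partial>vol) \<longlonglongrightarrow> (\<integral>x. ?H' t x \<partial>vol)"
    proof (rule integral_dominated_convergence[where w = "\<lambda>_. K"])
      show "?H' t \<in> borel_measurable vol"
        by (intro meas continuous_smooth_family_at[OF I smooth_family_deriv[OF I H] t])
      show "(\<lambda>x. (H (t + X i) x - H t x) / X i) \<in> borel_measurable vol" for i
        using X(1) by (intro meas continuous_intros cont Xt t') auto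
      show "integrable vol (\<lambda>_. K)" by (intro integrable_continuous continuous_intros)
      show "AE x in vol. (\<lambda>i. (H (t + X i) x - H t x) / X i) \<longlonglongrightarrow> ?H' t x"
      proof (rule AE_I2)
        fix x
        have "((\<lambda>h. (H (t + h) x - H t x) / h) \<longlongrightarrow> ?H' t x) (at 0)"
          using der[OF t', of x] by (simp add: DERIV_def)
        then show "(\<lambda>i. (H (t + X i) x - H t x) / X i) \<longlonglongrightarrow> ?H' t x"
          using X unfolding tendsto_at_iff_sequentially o_def by auto
      qed
      show "AE x in vol. norm ((H (t + X i) x - H t x) / X i) \<le> K" for i
        using bound X(1) by auto
    qed
    also have "(\<lambda>i. \<integral>x. (H (t + X i) x - H t x) / X i \<partial>vol)
        = (\<lambda>h. ((\<integral>x. H (t + h) x \<partial>vol) - (\<integral>x. H t x \<partial>vol)) / h) \<circ> X"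
      using integrable_continuous[OF cont[OF Xt]] integrable_continuous[OF cont[OF t']]
      by (simp add: fun_eq_iff)
    finally show "((\<lambda>h. ((\<integral>x. H (t + h) x \<partial>vol) - (\<integral>x. H t x \<partial>vol)) / h) \<circ> X)
        \<longlonglongrightarrow> (\<integral>x. ?H' t x \<partial>vol)" .
  qed
  then have "((\<lambda>t. \<integral>x. H t x \<partial>vol) has_real_derivative (\<integral>x. ?H' t x \<partial>vol)) (at t)"
    using r(1) by (simp add: DERIV_def at_within_open[of 0 "ball 0 r"])
  then show ?thesis unfolding int_vol_def int_top_def by (rule DERIV_cdivide)
qed

lemma smooth_on_int_vol:
  fixes I :: "real set"
  assumes "open I" "smooth_family A I H"
  shows "smooth_on I (\<lambda>t. int_vol A \<omega> (H t))"
  unfolding smooth_on_def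
proof
  fix k show "Ck_on k I (\<lambda>t. int_vol A \<omega> (H t))"
    using assms(2)
  proof (induction k arbitrary: H)
    case 0
    show ?case
      using int_vol_has_derivative[OF assms(1) 0] DERIV_isCont
      by (auto intro!: continuous_at_imp_continuous_on)
  next
    case (Suc k)
    show ?case
      by (rule Ck_on_real_SucI[OF assms(1) int_vol_has_derivative[OF assms(1) Suc.prems]])
        (use Suc.IH[OF smooth_family_deriv[OF assms(1) Suc.prems]] in auto)
  qed
qed

end

section \<open>Two-parameter families\<close>

definition velocity :: "(real \<Rightarrow> 'a \<Rightarrow> real) \<Rightarrow> real \<Rightarrow> 'a \<Rightarrow> real" where
  "velocity H t x = deriv (\<lambda>t. H t x) t"

lemma pd1_eq_velocity: "pd1 F s t = velocity (\<lambda>s. F s t) s"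
  by (simp add: pd1_def velocity_def fun_eq_iff)

lemma pd2_eq_velocity: "pd2 F s t = velocity (F s) t"
  by (simp add: pd2_def velocity_def fun_eq_iff)

lemma velocity_eqI:
  assumes "open I" "t \<in> I" "\<And>t. t \<in> I \<Longrightarrow> H t x = K t" "(K has_real_derivative d) (at t)"
  shows "velocity H t x = d"
proof -
  have "((\<lambda>t. H t x) has_real_derivative d) (at t)"
    by (rule has_field_derivative_transform_within_open[OF assms(4,1,2)]) (simp add: assms(3))
  then show ?thesis unfolding velocity_def by (rule DERIV_imp_deriv)
qed

context kaehler_manifold
begin

lemma velocity:
  assumes "open I" "smooth_family A I H"
  shows smooth_velocity: "smooth_family A I (velocity H)"
    and has_velocity: "t \<in> I \<Longrightarrow> ((\<lambda>t. H t x) has_real_derivative velocity H t x) (at t)"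
    and int_vol_has_velocity:
      "t \<in> I \<Longrightarrow> ((\<lambda>t. int_vol A \<omega> (H t)) has_real_derivative int_vol A \<omega> (velocity H t)) (at t)"
  using smooth_family_deriv[OF assms] smooth_family_real_derivative[OF assms] int_vol_has_derivative[OF assms]
  unfolding velocity_def by blast+

lemma int_vol_velocity_zero:
  assumes "open I" "smooth_family A I H" "t \<in> I" "\<And>t. t \<in> I \<Longrightarrow> int_vol A \<omega> (H t) = k"
  shows "int_vol A \<omega> (velocity H t) = 0"
proof -
  have "((\<lambda>t. int_vol A \<omega> (H t)) has_real_derivative 0) (at t)"
    by (rule has_field_derivative_transform_within_open[OF DERIV_const[of k] assms(1,3)]) (simp add: assms(4))
  then show ?thesis using int_vol_has_velocity[OF assms(1-3)] DERIV_unique by blast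
qed

abbreviation smooth2 :: "real set \<Rightarrow> real set \<Rightarrow> (real \<Rightarrow> real \<Rightarrow> 'a \<Rightarrow> real) \<Rightarrow> bool" where
  "smooth2 I J H \<equiv> smooth_family A (I \<times> J) (\<lambda>(s, t). H s t)"

lemma smooth2_slice1:
  assumes "open I" "open J" "smooth2 I J H" "t \<in> J"
  shows "smooth_family A I (\<lambda>s. H s t)"
proof -
  have "smooth_family A I (\<lambda>s. (\<lambda>(s, t). H s t) ((0, t) + (s, 0)))"
    by (rule smooth_family_affine[OF _ _ assms(3)])
      (use assms in \<open>auto intro!: open_Times bounded_linear_Pair bounded_linear_zero bounded_linear_ident\<close>)
  then show ?thesis by simp
qed

lemma smooth2_slice2:
  assumes "open I" "open J" "smooth2 I J H" "s \<in> I"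
  shows "smooth_family A J (H s)"
proof -
  have "smooth_family A J (\<lambda>t. (\<lambda>(s, t). H s t) ((s, 0) + (0, t)))"
    by (rule smooth_family_affine[OF _ _ assms(3)])
      (use assms in \<open>auto intro!: open_Times bounded_linear_Pair bounded_linear_zero bounded_linear_ident\<close>)
  then show ?thesis by simp
qed

lemma smooth2_pd1:
  assumes op: "open I" "open J" and H: "smooth2 I J H"
  shows "smooth2 I J (pd1 H)"
proof (rule smooth_family_cong[OF open_Times[OF op] _ smooth_family_param_deriv[OF open_Times[OF op] H, of "(1, 0)"]])
  fix p x assume "p \<in> I \<times> J"
  then obtain s t where p: "p = (s, t)" "s \<in> I" "t \<in> J" by auto
  have "((\<lambda>s. (s, t)) has_derivative (\<lambda>v. (v, 0))) (at s)"
    by (auto intro!: derivative_eq_intros)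
  moreover have "((\<lambda>p. (\<lambda>(s, t). H s t) p x) has_derivative (\<lambda>v. param_deriv v (\<lambda>(s, t). H s t) (s, t) x)) (at (s, t))"
    by (rule smooth_family_has_derivative(1)[OF open_Times[OF op] H]) (use p in auto)
  ultimately have "((\<lambda>p. (\<lambda>(s, t). H s t) p x) \<circ> (\<lambda>s. (s, t)) has_derivative
      (\<lambda>v. param_deriv v (\<lambda>(s, t). H s t) (s, t) x) \<circ> (\<lambda>v. (v, 0))) (at s)"
    by (rule diff_chain_at)
  moreover have "((\<lambda>s. H s t x) has_derivative (*) (pd1 H s t x)) (at s)"
    using has_velocity[OF op(1) smooth2_slice1[OF op H p(3)] p(2)]
    by (simp add: has_field_derivative_def pd1_eq_velocity)
  ultimately have "(\<lambda>v. param_deriv v (\<lambda>(s, t). H s t) (s, t) x) \<circ> (\<lambda>v. (v, 0)) = (*) (pd1 H s t x)"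
    by (intro has_derivative_unique[of "\<lambda>s. H s t x" _ s]) (simp_all add: o_def)
  from fun_cong[OF this, of 1] show "param_deriv (1, 0) (\<lambda>(s, t). H s t) p x = (case p of (s, t) \<Rightarrow> pd1 H s t) x"
    by (simp add: p)
qed

lemma smooth2_pd2:
  assumes op: "open I" "open J" and H: "smooth2 I J H"
  shows "smooth2 I J (pd2 H)"
proof (rule smooth_family_cong[OF open_Times[OF op] _ smooth_family_param_deriv[OF open_Times[OF op] H, of "(0, 1)"]])
  fix p x assume "p \<in> I \<times> J"
  then obtain s t where p: "p = (s, t)" "s \<in> I" "t \<in> J" by auto
  have "((\<lambda>t. (s, t)) has_derivative (\<lambda>v. (0, v))) (at t)"
    by (auto intro!: derivative_eq_intros)
  moreover have "((\<lambda>p. (\<lambda>(s, t). H s t) p x) has_derivative (\<lambda>v. param_deriv v (\<lambda>(s, t). H s t) (s, t) x)) (at (s, t))"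
    by (rule smooth_family_has_derivative(1)[OF open_Times[OF op] H]) (use p in auto)
  ultimately have "((\<lambda>p. (\<lambda>(s, t). H s t) p x) \<circ> (\<lambda>t. (s, t)) has_derivative
      (\<lambda>v. param_deriv v (\<lambda>(s, t). H s t) (s, t) x) \<circ> (\<lambda>v. (0, v))) (at t)"
    by (rule diff_chain_at)
  moreover have "((\<lambda>t. H s t x) has_derivative (*) (pd2 H s t x)) (at t)"
    using has_velocity[OF op(2) smooth2_slice2[OF op H p(2)] p(3)]
    by (simp add: has_field_derivative_def pd2_eq_velocity)
  ultimately have "(\<lambda>v. param_deriv v (\<lambda>(s, t). H s t) (s, t) x) \<circ> (\<lambda>v. (0, v)) = (*) (pd2 H s t x)"
    by (intro has_derivative_unique[of "\<lambda>t. H s t x" _ t]) (simp_all add: o_def)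
  from fun_cong[OF this, of 1] show "param_deriv (0, 1) (\<lambda>(s, t). H s t) p x = (case p of (s, t) \<Rightarrow> pd2 H s t) x"
    by (simp add: p)
qed

lemma has_pd1:
  assumes "open I" "open J" "smooth2 I J H" "s \<in> I" "t \<in> J"
  shows "((\<lambda>s. H s t x) has_real_derivative pd1 H s t x) (at s)"
  using has_velocity[OF assms(1) smooth2_slice1[OF assms(1-3,5)] assms(4)] by (simp add: pd1_eq_velocity)

lemma has_pd2:
  assumes "open I" "open J" "smooth2 I J H" "s \<in> I" "t \<in> J"
  shows "((\<lambda>t. H s t x) has_real_derivative pd2 H s t x) (at t)"
  using has_velocity[OF assms(2) smooth2_slice2[OF assms(1-4)] assms(5)] by (simp add: pd2_eq_velocity)

lemma pd1_pd2_commute: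
  assumes op: "open I" "open J" and H: "smooth2 I J H" and st: "s \<in> I" "t \<in> J"
  shows "pd2 (pd1 H) s t x = pd1 (pd2 H) s t x"
proof -
  have c: "continuous_on (I \<times> J) (\<lambda>(s, t). K s t x)" if "smooth2 I J K" for K
  proof -
    have "continuous_on (I \<times> J) (\<lambda>p. (\<lambda>(p, x). (case p of (s, t) \<Rightarrow> K s t) x) (p, x))"
      by (rule continuous_on_compose2[OF continuous_smooth_family[OF open_Times[OF op] that]])
        (auto intro!: continuous_intros)
    then show ?thesis by (simp add: case_prod_unfold)
  qed
  note s1 = smooth2_pd1[OF op H] and s2 = smooth2_pd2[OF op H]
  show ?thesis
    by (rule mixed_partials[OF op st, of "\<lambda>s t. H s t x" "\<lambda>s t. pd1 H s t x" "\<lambda>s t. pd2 H s t x"])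
      (rule has_pd1[OF op H] has_pd2[OF op H] has_pd2[OF op s1] has_pd1[OF op s2]
        c[OF smooth2_pd2[OF op s1]] c[OF smooth2_pd1[OF op s2]]; assumption)+
qed

end

section \<open>The weighted metric\<close>

locale weighted_factors = kaehler_manifold A \<omega>
  for A :: "('a::t2_space, 'n::finite) chart set" and \<omega> :: "('a, 'n) two_form" +
  fixes chi :: "real \<Rightarrow> real"
  assumes weight: "smooth_weight chi"
begin

abbreviation "E \<equiv> int_vol A \<omega>"
abbreviation "C \<equiv> conformal_factors A \<omega>"
abbreviation "TC \<equiv> tangent_functions A \<omega>"
abbreviation "ip \<equiv> weighted_metric A \<omega> chi"
abbreviation "field \<equiv> field_along A \<omega>"

definition phi :: "real \<Rightarrow> real" where "phi y = deriv chi y / (2 * chi y)"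
definition psi :: "real \<Rightarrow> real" where "psi y = 1 / chi y"

lemma chi_pos: "0 < y \<Longrightarrow> 0 < chi y"
  using weight by (simp add: smooth_weight_def)

lemma smooth_chi: "smooth_on {0<..} chi"
  using weight by (simp add: smooth_weight_def)

lemma smooth_psi: "smooth_on {0<..} psi"
proof -
  have "smooth_on {0<..} (\<lambda>y. inverse (chi y))"
    by (rule smooth_on_compose_real[OF _ _ smooth_chi smooth_on_inverse]) (auto simp: chi_pos)
  then show ?thesis by (simp add: psi_def[abs_def] inverse_eq_divide)
qed

lemma smooth_phi: "smooth_on {0<..} phi"
proof -
  have "smooth_on {0<..} (\<lambda>y. 1 / 2 * (deriv chi y * psi y))"
    by (intro smooth_on_mult smooth_on_const smooth_on_deriv smooth_chi smooth_psi open_greaterThan)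
  then show ?thesis by (simp add: psi_def phi_def[abs_def])
qed

lemma chi_psi: "0 < y \<Longrightarrow> chi y * psi y = 1"
  using chi_pos[of y] by (simp add: psi_def)

lemma psi_pos: "0 < y \<Longrightarrow> 0 < psi y"
  using chi_pos[of y] by (simp add: psi_def)

lemma deriv_chi: "0 < y \<Longrightarrow> (chi has_real_derivative 2 * phi y * chi y) (at y)"
  using smooth_on_real_derivative[OF smooth_chi, of y] chi_pos[of y] by (simp add: phi_def)

lemma deriv_phi: "0 < y \<Longrightarrow> (phi has_real_derivative deriv phi y) (at y)"
  using smooth_on_real_derivative[OF smooth_phi, of y] by simp

lemma deriv_psi: "0 < y \<Longrightarrow> (psi has_real_derivative - 2 * phi y * psi y) (at y)"
proof -
  assume y: "0 < y"
  have "((\<lambda>y. 1 / chi y) has_real_derivative (0 * chi y - 1 * (2 * phi y * chi y)) / (chi y * chi y)) (at y)"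
    by (rule DERIV_divide[OF DERIV_const deriv_chi[OF y]]) (use chi_pos[OF y] in simp)
  then show ?thesis using chi_pos[OF y] by (simp add: psi_def[abs_def])
qed

lemma conformal_factorD:
  assumes "F \<in> C"
  shows "smooth_fun A F" "0 < F x" "E F = E (\<lambda>x. 1)"
  using assms by (simp_all add: conformal_factors_def int_vol_def)

lemma tangent_functions_iff: "G \<in> TC \<longleftrightarrow> smooth_fun A G \<and> E G = 0"
  by (simp add: tangent_functions_def int_vol_def)

lemma smooth_fun_eq_family: "smooth_fun A f \<longleftrightarrow> smooth_family A (UNIV :: real set) (\<lambda>_. f)"
  using smooth_family_fun[OF open_UNIV, of f] smooth_family_at[OF open_UNIV _ UNIV_I, of "\<lambda>_. f"] by blast

lemma smooth_fun_add: "smooth_fun A f \<Longrightarrow> smooth_fun A g \<Longrightarrow> smooth_fun A (\<lambda>x. f x + g x)"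
  unfolding smooth_fun_eq_family by (rule smooth_family_add) auto

lemma smooth_fun_diff: "smooth_fun A f \<Longrightarrow> smooth_fun A g \<Longrightarrow> smooth_fun A (\<lambda>x. f x - g x)"
  unfolding smooth_fun_eq_family by (rule smooth_family_diff) auto

lemma smooth_fun_mult: "smooth_fun A f \<Longrightarrow> smooth_fun A g \<Longrightarrow> smooth_fun A (\<lambda>x. f x * g x)"
  unfolding smooth_fun_eq_family by (rule smooth_family_mult) auto

lemma smooth_fun_compose:
  "smooth_fun A f \<Longrightarrow> smooth_on T h \<Longrightarrow> (\<And>x. f x \<in> T) \<Longrightarrow> smooth_fun A (\<lambda>x. h (f x))"
  unfolding smooth_fun_eq_family by (rule smooth_family_compose) auto

lemma smooth_fun_weight:
  assumes "F \<in> C"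
  shows "smooth_fun A (\<lambda>x. chi (F x))" "smooth_fun A (\<lambda>x. phi (F x))" "smooth_fun A (\<lambda>x. psi (F x))"
  by (rule smooth_fun_compose[where T = "{0<..}"], rule conformal_factorD[OF assms],
      rule smooth_chi smooth_phi smooth_psi, simp add: conformal_factorD(2)[OF assms])+

lemma tangent_diff: "G \<in> TC \<Longrightarrow> H \<in> TC \<Longrightarrow> (\<lambda>x. G x - H x) \<in> TC"
  by (simp add: tangent_functions_iff smooth_fun_diff int_vol_diff continuous_smooth_fun)

lemma int_psi_pos:
  assumes "F \<in> C"
  shows "0 < E (\<lambda>x. psi (F x))"
proof (rule int_vol_pos)
  show "continuous_on UNIV (\<lambda>x. psi (F x))"
    using smooth_fun_weight[OF assms] by (simp add: continuous_smooth_fun)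
  show "0 \<le> psi (F x)" "psi (F undefined) \<noteq> 0" for x
    using psi_pos[OF conformal_factorD(2)[OF assms], of x]
      psi_pos[OF conformal_factorD(2)[OF assms], of undefined] by simp_all
qed

lemma ip_commute: "ip F G H = ip F H G"
  unfolding weighted_metric_def by (rule arg_cong[where f = E]) (simp add: mult_ac)

lemma ip_diff_left:
  assumes "F \<in> C" "smooth_fun A G" "smooth_fun A G'" "smooth_fun A H"
  shows "ip F (\<lambda>x. G x - G' x) H = ip F G H - ip F G' H"
proof -
  have "ip F G H - ip F G' H = E (\<lambda>x. chi (F x) * G x * H x - chi (F x) * G' x * H x)"
    unfolding weighted_metric_def using smooth_fun_weight[OF assms(1)] assms
    by (intro int_vol_diff[symmetric] continuous_smooth_fun smooth_fun_mult) auto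
  then show ?thesis by (simp add: weighted_metric_def algebra_simps)
qed

lemma ip_definite:
  assumes "F \<in> C" "smooth_fun A G" "ip F G G = 0"
  shows "G x = 0"
proof (rule ccontr)
  assume "G x \<noteq> 0"
  have chi: "0 < chi (F y)" for y using chi_pos conformal_factorD(2)[OF assms(1)] by blast
  have "0 < E (\<lambda>x. chi (F x) * G x * G x)"
  proof (rule int_vol_pos)
    show "continuous_on UNIV (\<lambda>x. chi (F x) * G x * G x)"
      using smooth_fun_weight[OF assms(1)] assms by (intro continuous_smooth_fun smooth_fun_mult) auto
    show "0 \<le> chi (F x) * G x * G x" for x
      using less_imp_le[OF chi[of x]] by (simp add: mult.assoc)
    show "chi (F x) * G x * G x \<noteq> 0" using chi[of x] \<open>G x \<noteq> 0\<close> by simp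
  qed
  then show False using assms(3) by (simp add: weighted_metric_def)
qed

lemma field_alongD:
  assumes "field I F G"
  shows "open I" "smooth_family A I F" "smooth_family A I G"
    and "t \<in> I \<Longrightarrow> F t \<in> C" "t \<in> I \<Longrightarrow> G t \<in> TC" "curve_in_factors A \<omega> I F"
  using assms by (simp_all add: field_along_def curve_in_factors_def open_interval_def)

lemma smooth_family_weight:
  assumes "open P" "smooth_family A P F" "\<And>p x. p \<in> P \<Longrightarrow> 0 < F p x"
  shows "smooth_family A P (\<lambda>p x. phi (F p x))" "smooth_family A P (\<lambda>p x. psi (F p x))"
    "smooth_family A P (\<lambda>p x. chi (F p x))"
  by (auto intro!: smooth_family_compose[OF assms(1,2)] smooth_chi smooth_phi smooth_psi assms(3))

section \<open>Existence of the Levi-Civita derivative\<close>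

text \<open>
  The term with \<open>phi\<close> makes the derivative compatible with the metric on all functions. The result
  need not have integral zero. It is projected back to the tangent space along \<open>psi (F t)\<close>, which is
  orthogonal to the tangent space as \<open>chi (F t) * psi (F t) = 1\<close>.
\<close>

definition lc_coeff :: "('a \<Rightarrow> real) \<Rightarrow> ('a \<Rightarrow> real) \<Rightarrow> ('a \<Rightarrow> real) \<Rightarrow> real" where
  "lc_coeff F X Y = E (\<lambda>x. phi (F x) * X x * Y x) / E (\<lambda>x. psi (F x))"

definition lc_formula :: "(real \<Rightarrow> 'a \<Rightarrow> real) \<Rightarrow> (real \<Rightarrow> 'a \<Rightarrow> real) \<Rightarrow> real \<Rightarrow> 'a \<Rightarrow> real" where
  "lc_formula F G t x = velocity G t x + phi (F t x) * velocity F t x * G t x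
     - lc_coeff (F t) (velocity F t) (G t) * psi (F t x)"

definition lc_deriv :: "'a derivation" where
  "lc_deriv I F G t = (if field I F G \<and> t \<in> I then lc_formula F G t else undefined)"

lemma lc_coeff_commute: "lc_coeff F X Y = lc_coeff F Y X"
  unfolding lc_coeff_def by (simp add: mult_ac)

lemma lc_coeff_int:
  assumes "F \<in> C"
  shows "lc_coeff F X Y * E (\<lambda>x. psi (F x)) = E (\<lambda>x. phi (F x) * X x * Y x)"
  using int_psi_pos[OF assms] by (simp add: lc_coeff_def)

lemma smooth_lc_coeff:
  fixes I :: "real set"
  assumes I: "open I" and F: "smooth_family A I F" "\<And>t. t \<in> I \<Longrightarrow> F t \<in> C"
    and XY: "smooth_family A I X" "smooth_family A I Y"
  shows "smooth_on I (\<lambda>t. lc_coeff (F t) (X t) (Y t))"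
proof -
  note w = smooth_family_weight[OF I F(1) conformal_factorD(2)[OF F(2)]]
  have "smooth_on I (\<lambda>t. inverse (E (\<lambda>x. psi (F t x))))"
    by (rule smooth_on_compose_real[OF I _ smooth_on_int_vol[OF I w(2)] smooth_on_inverse])
      (auto simp: int_psi_pos F(2))
  moreover have "smooth_on I (\<lambda>t. E (\<lambda>x. phi (F t x) * X t x * Y t x))"
    by (intro smooth_on_int_vol smooth_family_mult I w XY)
  ultimately have "smooth_on I (\<lambda>t. E (\<lambda>x. phi (F t x) * X t x * Y t x) * inverse (E (\<lambda>x. psi (F t x))))"
    by (intro smooth_on_mult I)
  then show ?thesis by (simp add: lc_coeff_def divide_inverse)
qed

lemma smooth_lc_formula:
  assumes "field I F G"
  shows "smooth_family A I (lc_formula F G)"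
proof -
  note f = field_alongD[OF assms]
  note w = smooth_family_weight[OF f(1,2) conformal_factorD(2)[OF f(4)]]
  note v = smooth_velocity[OF f(1,2)]
  have "smooth_family A I (\<lambda>t x. velocity G t x + phi (F t x) * velocity F t x * G t x
     - lc_coeff (F t) (velocity F t) (G t) * psi (F t x))"
    by (intro smooth_family_diff smooth_family_add smooth_family_mult smooth_velocity f(1,3) w v
        smooth_family_param smooth_lc_coeff f)
  then show ?thesis by (simp add: lc_formula_def[abs_def])
qed

lemma velocity_curve_tangent:
  assumes "curve_in_factors A \<omega> I F" "t \<in> I"
  shows "velocity F t \<in> TC"
proof -
  have I: "open I" and F: "smooth_family A I F" "\<And>t. t \<in> I \<Longrightarrow> F t \<in> C"
    using assms by (simp_all add: curve_in_factors_def open_interval_def)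
  show ?thesis
    unfolding tangent_functions_iff
    using smooth_family_at[OF I smooth_velocity[OF I F(1)] assms(2)]
      int_vol_velocity_zero[OF I F(1) assms(2) conformal_factorD(3)[OF F(2)]] by blast
qed

lemma lc_formula_tangent:
  assumes "field I F G" "t \<in> I"
  shows "lc_formula F G t \<in> TC"
proof -
  note f = field_alongD[OF assms(1)]
  have F: "F t \<in> C" and G: "smooth_fun A (G t)" using f assms by (auto simp: tangent_functions_iff)
  note w = smooth_fun_weight[OF F]
  have vF: "smooth_fun A (velocity F t)"
    by (rule smooth_family_at[OF f(1) smooth_velocity[OF f(1,2)] assms(2)])
  have vG: "smooth_fun A (velocity G t)"
    by (rule smooth_family_at[OF f(1) smooth_velocity[OF f(1,3)] assms(2)])
  have EG: "E (velocity G t) = 0"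
    by (rule int_vol_velocity_zero[OF f(1,3) assms(2)]) (use f(5) in \<open>simp add: tangent_functions_iff\<close>)
  let ?k = "lc_coeff (F t) (velocity F t) (G t)"
  have cont: "continuous_on UNIV (velocity G t)" "continuous_on UNIV (\<lambda>x. phi (F t x) * velocity F t x * G t x)"
    "continuous_on UNIV (\<lambda>x. psi (F t x))"
    by (intro continuous_smooth_fun smooth_fun_mult w vF vG G)+
  have "E (lc_formula F G t) = E (velocity G t) + E (\<lambda>x. phi (F t x) * velocity F t x * G t x)
      - ?k * E (\<lambda>x. psi (F t x))"
    unfolding lc_formula_def[abs_def]
    by (simp add: int_vol_diff int_vol_add int_vol_cmult cont continuous_on_add continuous_on_mult_left)
  also have "\<dots> = 0" using EG lc_coeff_int[OF F] by simp
  finally show ?thesis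
    unfolding tangent_functions_iff using smooth_family_at[OF f(1) smooth_lc_formula[OF assms(1)] assms(2)] by blast
qed

lemma field_lc_deriv:
  assumes "field I F G"
  shows "field I F (lc_deriv I F G)"
proof -
  note f = field_alongD[OF assms]
  have "lc_deriv I F G t = lc_formula F G t" if "t \<in> I" for t using that assms by (simp add: lc_deriv_def)
  then show ?thesis
    unfolding field_along_def
    using f(6) lc_formula_tangent[OF assms] smooth_family_cong[OF f(1) _ smooth_lc_formula[OF assms]] by simp
qed

lemma field_add:
  assumes "field I F G" "field I F H"
  shows "field I F (\<lambda>t x. G t x + H t x)"
  using field_alongD[OF assms(1)] field_alongD[OF assms(2)]
  by (simp add: field_along_def smooth_family_add tangent_functions_iff smooth_fun_add int_vol_add continuous_smooth_fun)

lemma field_scale: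
  assumes "field I F G" "smooth_on I f"
  shows "field I F (\<lambda>t x. f t * G t x)"
  unfolding field_along_def
proof (intro conjI ballI)
  note g = field_alongD[OF assms(1)]
  show "curve_in_factors A \<omega> I F" by (rule g)
  show s: "smooth_family A I (\<lambda>t x. f t * G t x)"
    by (intro smooth_family_mult smooth_family_param g assms(2))
  show "(\<lambda>x. f t * G t x) \<in> TC" if "t \<in> I" for t
    using smooth_family_at[OF g(1) s that] g(5)[OF that] by (simp add: tangent_functions_iff int_vol_cmult)
qed

lemma field_const:
  assumes "curve_in_factors A \<omega> I F" "g \<in> TC"
  shows "field I F (\<lambda>_. g)"
  using assms smooth_family_fun[of I g]
  by (simp add: field_along_def tangent_functions_def curve_in_factors_def open_interval_def)

lemma lc_coeff_add:
  assumes "F \<in> C" "smooth_fun A X" "smooth_fun A Y" "smooth_fun A Z"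
  shows "lc_coeff F X (\<lambda>x. Y x + Z x) = lc_coeff F X Y + lc_coeff F X Z"
proof -
  have "E (\<lambda>x. phi (F x) * X x * Y x + phi (F x) * X x * Z x)
      = E (\<lambda>x. phi (F x) * X x * Y x) + E (\<lambda>x. phi (F x) * X x * Z x)"
    using smooth_fun_weight[OF assms(1)] assms
    by (intro int_vol_add continuous_smooth_fun smooth_fun_mult) auto
  then show ?thesis by (simp add: lc_coeff_def add_divide_distrib distrib_left)
qed

lemma lc_coeff_scale: "lc_coeff F X (\<lambda>x. k * Y x) = k * lc_coeff F X Y"
proof -
  have "(\<lambda>x. phi (F x) * X x * (k * Y x)) = (\<lambda>x. k * (phi (F x) * X x * Y x))"
    by (simp add: fun_eq_iff mult_ac)
  then show ?thesis by (simp add: lc_coeff_def int_vol_cmult)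
qed

lemma lc_deriv_covariant: "covariant_derivative A \<omega> lc_deriv"
  unfolding covariant_derivative_def
proof (intro conjI allI impI ballI)
  fix I F G and t :: real assume "\<not> (field I F G \<and> t \<in> I)"
  then show "lc_deriv I F G t = undefined" by (auto simp: lc_deriv_def)
next
  fix I F G assume "field I F G"
  then show "field I F (lc_deriv I F G)" by (rule field_lc_deriv)
next
  fix I F G H t x assume G: "field I F G" and H: "field I F H" and t: "t \<in> I"
  note g = field_alongD[OF G] and h = field_alongD[OF H]
  have "smooth_fun A (velocity F t)" by (rule smooth_family_at[OF g(1) smooth_velocity[OF g(1,2)] t])
  then have "lc_coeff (F t) (velocity F t) (\<lambda>x. G t x + H t x)
      = lc_coeff (F t) (velocity F t) (G t) + lc_coeff (F t) (velocity F t) (H t)"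
    using g(4,5)[OF t] h(5)[OF t] by (intro lc_coeff_add) (auto simp: tangent_functions_iff)
  moreover have "velocity (\<lambda>t x. G t x + H t x) t x = velocity G t x + velocity H t x"
    by (rule velocity_eqI[OF g(1) t refl]) (intro DERIV_add has_velocity[OF g(1)] g h t)
  ultimately show "lc_deriv I F (\<lambda>t x. G t x + H t x) t x = lc_deriv I F G t x + lc_deriv I F H t x"
    using G H field_add[OF G H] t by (simp add: lc_deriv_def lc_formula_def algebra_simps)
next
  fix I F G and f :: "real \<Rightarrow> real" and t x assume G: "field I F G" and f: "smooth_on I f" and t: "t \<in> I"
  note g = field_alongD[OF G]
  have "velocity (\<lambda>t x. f t * G t x) t x = deriv f t * G t x + velocity G t x * f t"
    by (rule velocity_eqI[OF g(1) t refl])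
      (intro DERIV_mult smooth_on_real_derivative[OF f t] has_velocity[OF g(1)] g t)
  then show "lc_deriv I F (\<lambda>t x. f t * G t x) t x = deriv f t * G t x + f t * lc_deriv I F G t x"
    using G field_scale[OF G f] t by (simp add: lc_deriv_def lc_formula_def lc_coeff_scale algebra_simps)
qed

text \<open>
  In the inner products of \<open>lc_formula F G t\<close> with \<open>H t\<close> and of \<open>G t\<close> with
  \<open>lc_formula F H t\<close>, the projection terms become multiples of the integrals of \<open>H t\<close> and \<open>G t\<close>,
  which are zero, and the two terms with \<open>phi\<close> add up to the derivative of the weight.
\<close>

lemma lc_deriv_metric: "metric_compatible A \<omega> chi lc_deriv"
  unfolding metric_compatible_def
proof (intro allI impI ballI)
  fix I F G H and t :: real assume G: "field I F G" and H: "field I F H" and t: "t \<in> I"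
  note g = field_alongD[OF G] and h = field_alongD[OF H]
  have Fpos: "0 < F s x" if "s \<in> I" for s x using conformal_factorD(2)[OF g(4)[OF that]] .
  let ?W = "\<lambda>t x. chi (F t x) * G t x * H t x"
  have sW: "smooth_family A I ?W"
    by (intro smooth_family_mult smooth_family_weight g h Fpos)
  have W: "velocity ?W t x = (2 * phi (F t x) * chi (F t x) * velocity F t x * G t x + velocity G t x * chi (F t x)) * H t x
      + velocity H t x * (chi (F t x) * G t x)" for x
    by (rule velocity_eqI[OF g(1) t refl])
      (intro DERIV_mult DERIV_chain2[OF deriv_chi] has_velocity[OF g(1)] g h t Fpos)
  let ?a = "lc_coeff (F t) (velocity F t) (G t)" and ?b = "lc_coeff (F t) (velocity F t) (H t)"
  have DG: "lc_deriv I F G t = lc_formula F G t" and DH: "lc_deriv I F H t = lc_formula F H t"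
    using G H t by (simp_all add: lc_deriv_def)
  have tG: "smooth_fun A (G t)" "E (G t) = 0" and tH: "smooth_fun A (H t)" "E (H t) = 0"
    using g(5)[OF t] h(5)[OF t] by (simp_all add: tangent_functions_iff)
  have lG: "smooth_fun A (lc_formula F G t)" and lH: "smooth_fun A (lc_formula F H t)"
    using lc_formula_tangent[OF G t] lc_formula_tangent[OF H t] by (simp_all add: tangent_functions_iff)
  note w = smooth_fun_weight[OF g(4)[OF t]]
  have "ip (F t) (lc_formula F G t) (H t) + ip (F t) (G t) (lc_formula F H t)
      = E (\<lambda>x. chi (F t x) * lc_formula F G t x * H t x + chi (F t x) * G t x * lc_formula F H t x)"
    unfolding weighted_metric_def
    by (intro int_vol_add[symmetric] continuous_smooth_fun smooth_fun_mult w tG tH lG lH)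
  also have "(\<lambda>x. chi (F t x) * lc_formula F G t x * H t x + chi (F t x) * G t x * lc_formula F H t x)
      = (\<lambda>x. velocity ?W t x - (?a * H t x + ?b * G t x))"
  proof
    fix x
    have "chi (F t x) * lc_formula F G t x * H t x + chi (F t x) * G t x * lc_formula F H t x
      = velocity ?W t x - (chi (F t x) * psi (F t x)) * (?a * H t x + ?b * G t x)"
      unfolding W lc_formula_def by (simp add: algebra_simps)
    then show "chi (F t x) * lc_formula F G t x * H t x + chi (F t x) * G t x * lc_formula F H t x
      = velocity ?W t x - (?a * H t x + ?b * G t x)"
      unfolding chi_psi[OF Fpos[OF t]] by simp
  qed
  also have "E \<dots> = E (velocity ?W t) - (?a * E (H t) + ?b * E (G t))"
    using continuous_smooth_family_at[OF g(1) smooth_velocity[OF g(1) sW] t]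
      continuous_smooth_fun[OF tG(1)] continuous_smooth_fun[OF tH(1)]
    by (simp add: int_vol_diff int_vol_add int_vol_cmult continuous_on_add continuous_on_mult_left)
  finally have "ip (F t) (lc_deriv I F G t) (H t) + ip (F t) (G t) (lc_deriv I F H t) = E (velocity ?W t)"
    unfolding DG DH tG(2) tH(2) by simp
  moreover have "((\<lambda>t. ip (F t) (G t) (H t)) has_real_derivative E (velocity ?W t)) (at t)"
    using int_vol_has_velocity[OF g(1) sW t] by (simp add: weighted_metric_def)
  ultimately show "((\<lambda>t. ip (F t) (G t) (H t)) has_real_derivative
      ip (F t) (lc_deriv I F G t) (H t) + ip (F t) (G t) (lc_deriv I F H t)) (at t)" by simp
qed

lemma two_paramD:
  assumes "two_param_family A \<omega> I J F"
  shows "open I" "open J" "smooth2 I J F" "s \<in> I \<Longrightarrow> t \<in> J \<Longrightarrow> F s t \<in> C"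
    and "t \<in> J \<Longrightarrow> curve_in_factors A \<omega> I (\<lambda>s. F s t)" "s \<in> I \<Longrightarrow> curve_in_factors A \<omega> J (F s)"
  using assms smooth2_slice1[of I J F t] smooth2_slice2[of I J F s]
  by (auto simp: two_param_family_def curve_in_factors_def open_interval_def)

lemma two_param_field1:
  assumes "two_param_family A \<omega> I J F" "smooth2 I J X" "\<And>s t. s \<in> I \<Longrightarrow> t \<in> J \<Longrightarrow> X s t \<in> TC" "t \<in> J"
  shows "field I (\<lambda>s. F s t) (\<lambda>s. X s t)"
  using two_paramD[OF assms(1)] smooth2_slice1[OF _ _ assms(2,4)] assms(3,4) by (simp add: field_along_def)

lemma two_param_field2:
  assumes "two_param_family A \<omega> I J F" "smooth2 I J X" "\<And>s t. s \<in> I \<Longrightarrow> t \<in> J \<Longrightarrow> X s t \<in> TC" "s \<in> I"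
  shows "field J (F s) (X s)"
  using two_paramD[OF assms(1)] smooth2_slice2[OF _ _ assms(2,4)] assms(3,4) by (simp add: field_along_def)

lemma pd_tangent:
  assumes "two_param_family A \<omega> I J F" "s \<in> I" "t \<in> J"
  shows "pd1 F s t \<in> TC" "pd2 F s t \<in> TC"
  using velocity_curve_tangent[OF two_paramD(5)[OF assms(1,3)] assms(2)]
    velocity_curve_tangent[OF two_paramD(6)[OF assms(1,2)] assms(3)]
  by (simp_all add: pd1_eq_velocity pd2_eq_velocity)

lemma cov2_lc:
  assumes "two_param_family A \<omega> I J F" "smooth2 I J X" "\<And>s t. s \<in> I \<Longrightarrow> t \<in> J \<Longrightarrow> X s t \<in> TC" "s \<in> I" "t \<in> J"
  shows "cov2 lc_deriv J F X s t = (\<lambda>x. pd2 X s t x + phi (F s t x) * pd2 F s t x * X s t x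
    - lc_coeff (F s t) (pd2 F s t) (X s t) * psi (F s t x))"
  using two_param_field2[OF assms(1-4)] assms(5)
  by (simp add: cov2_def lc_deriv_def lc_formula_def[abs_def] pd2_eq_velocity)

lemma cov1_lc:
  assumes "two_param_family A \<omega> I J F" "smooth2 I J X" "\<And>s t. s \<in> I \<Longrightarrow> t \<in> J \<Longrightarrow> X s t \<in> TC" "s \<in> I" "t \<in> J"
  shows "cov1 lc_deriv I F X s t = (\<lambda>x. pd1 X s t x + phi (F s t x) * pd1 F s t x * X s t x
    - lc_coeff (F s t) (pd1 F s t) (X s t) * psi (F s t x))"
  using two_param_field1[OF assms(1-3,5)] assms(4)
  by (simp add: cov1_def lc_deriv_def lc_formula_def[abs_def] pd1_eq_velocity)

text \<open>
  Both sides consist of a mixed partial derivative of \<open>F\<close> and terms that are symmetric in the two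
  partial derivatives of \<open>F\<close>.
\<close>

lemma lc_deriv_torsion_free: "torsion_free A \<omega> lc_deriv"
  unfolding torsion_free_def
proof (intro allI impI ballI)
  fix I J F s t assume F: "two_param_family A \<omega> I J F" and st: "s \<in> I" "t \<in> J"
  note d = two_paramD[OF F]
  have "pd2 (pd1 F) s t x = pd1 (pd2 F) s t x" for x by (rule pd1_pd2_commute[OF d(1-3) st])
  then show "cov2 lc_deriv J F (pd1 F) s t = cov1 lc_deriv I F (pd2 F) s t"
    using cov2_lc[OF F smooth2_pd1[OF d(1-3)] pd_tangent(1)[OF F] st]
      cov1_lc[OF F smooth2_pd2[OF d(1-3)] pd_tangent(2)[OF F] st]
    by (simp add: lc_coeff_commute[of "F s t" "pd1 F s t"] mult_ac)
qed

end

context weighted_factors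
begin

section \<open>Uniqueness of the Levi-Civita derivative\<close>

definition lc_conn :: "'a derivation \<Rightarrow> bool" where
  "lc_conn D \<longleftrightarrow> covariant_derivative A \<omega> D \<and> metric_compatible A \<omega> chi D \<and> torsion_free A \<omega> D"

lemma lc_conn_lc_deriv: "lc_conn lc_deriv"
  by (simp add: lc_conn_def lc_deriv_covariant lc_deriv_metric lc_deriv_torsion_free)

lemma lc_conn_field:
  assumes "lc_conn D" "field I F G"
  shows "field I F (D I F G)"
proof -
  have "\<forall>I F G. field I F G \<longrightarrow> field I F (D I F G)"
    using assms(1) unfolding lc_conn_def covariant_derivative_def by (elim conjE)
  then show ?thesis using assms(2) by simp
qed

lemma lc_conn_outside:
  assumes "lc_conn D" "\<not> (field I F G \<and> t \<in> I)"
  shows "D I F G t = undefined"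
proof -
  have "\<forall>I F G t. \<not> (field I F G \<and> t \<in> I) \<longrightarrow> D I F G t = undefined"
    using assms(1) unfolding lc_conn_def covariant_derivative_def by (elim conjE)
  then show ?thesis using assms(2) by simp
qed

lemma lc_conn_metric:
  assumes "lc_conn D" "field I F G" "field I F H" "t \<in> I"
  shows "((\<lambda>t. ip (F t) (G t) (H t)) has_real_derivative
    ip (F t) (D I F G t) (H t) + ip (F t) (G t) (D I F H t)) (at t)"
proof -
  have "metric_compatible A \<omega> chi D" using assms(1) by (simp add: lc_conn_def)
  then show ?thesis using assms(2-4) unfolding metric_compatible_def by simp
qed

text \<open>
  For two derivations with the properties of the Levi-Civita derivative this becomes a tensor, since the
  derivatives of the field cancel.
\<close>

definition conn_diff :: "'a derivation \<Rightarrow> 'a derivation \<Rightarrow> 'a derivation" where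
  "conn_diff D D' I F G t x = D I F G t x - D' I F G t x"

lemma conn_diff_tangent:
  assumes "lc_conn D" "lc_conn D'" "field I F G" "t \<in> I"
  shows "conn_diff D D' I F G t \<in> TC"
  using tangent_diff[OF field_alongD(5)[OF lc_conn_field[OF assms(1,3)] assms(4)]
      field_alongD(5)[OF lc_conn_field[OF assms(2,3)] assms(4)]]
  by (simp add: conn_diff_def[abs_def])

lemma conn_diff_skew:
  assumes D: "lc_conn D" and D': "lc_conn D'" and G: "field I F G" and H: "field I F H" and t: "t \<in> I"
  shows "ip (F t) (conn_diff D D' I F G t) (H t) = - ip (F t) (G t) (conn_diff D D' I F H t)"
proof -
  have sm: "smooth_fun A (K t)" if "field I F K" for K
    using field_alongD(5)[OF that t] by (simp add: tangent_functions_iff)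
  have Ft: "F t \<in> C" by (rule field_alongD(4)[OF G t])
  note f = lc_conn_field[OF D G] lc_conn_field[OF D' G] lc_conn_field[OF D H] lc_conn_field[OF D' H]
  have "ip (F t) (D I F G t) (H t) + ip (F t) (G t) (D I F H t)
      = ip (F t) (D' I F G t) (H t) + ip (F t) (G t) (D' I F H t)"
    by (rule DERIV_unique[OF lc_conn_metric[OF D G H t] lc_conn_metric[OF D' G H t]])
  moreover have "ip (F t) (conn_diff D D' I F G t) (H t) = ip (F t) (D I F G t) (H t) - ip (F t) (D' I F G t) (H t)"
    unfolding conn_diff_def[abs_def] by (intro ip_diff_left Ft sm f H)
  moreover have "ip (F t) (G t) (conn_diff D D' I F H t) = ip (F t) (G t) (D I F H t) - ip (F t) (G t) (D' I F H t)"
    unfolding conn_diff_def[abs_def] ip_commute[of "F t" "G t"] by (intro ip_diff_left Ft sm f G)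
  ultimately show ?thesis by simp
qed

text \<open>
  The difference of two connections at \<open>t\<close> depends on the value of the field at \<open>t\<close> only: pairing
  with constant fields moves it to the other argument, where the field itself is not differentiated.
\<close>

lemma conn_diff_pointwise:
  assumes D: "lc_conn D" and D': "lc_conn D'" and G: "field I F G" and H: "field I F H"
    and t: "t \<in> I" and eq: "G t = H t"
  shows "conn_diff D D' I F G t = conn_diff D D' I F H t"
proof
  fix x
  let ?u = "\<lambda>x. conn_diff D D' I F G t x - conn_diff D D' I F H t x"
  have Ft: "F t \<in> C" by (rule field_alongD(4)[OF G t])
  have TG: "conn_diff D D' I F G t \<in> TC" and TH: "conn_diff D D' I F H t \<in> TC"
    using conn_diff_tangent[OF D D' _ t] G H by blast+
  have u: "?u \<in> TC" by (rule tangent_diff[OF TG TH])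
  have K: "field I F (\<lambda>_. ?u)" by (rule field_const[OF field_alongD(6)[OF G] u])
  have "ip (F t) (conn_diff D D' I F G t) ?u = ip (F t) (conn_diff D D' I F H t) ?u"
    using conn_diff_skew[OF D D' G K t] conn_diff_skew[OF D D' H K t] eq by simp
  then have "ip (F t) ?u ?u = 0"
    using ip_diff_left[OF Ft, of "conn_diff D D' I F G t" "conn_diff D D' I F H t" ?u] TG TH u
    by (simp add: tangent_functions_iff)
  then show "conn_diff D D' I F G t x = conn_diff D D' I F H t x"
    using ip_definite[OF Ft, of ?u] u by (simp add: tangent_functions_iff)
qed

definition ray :: "('a \<Rightarrow> real) \<Rightarrow> ('a \<Rightarrow> real) \<Rightarrow> real \<Rightarrow> 'a \<Rightarrow> real" where
  "ray F0 g s x = F0 x + s * g x"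

lemma ray_0 [simp]: "ray F0 g 0 = F0"
  by (simp add: ray_def fun_eq_iff)

lemma velocity_ray [simp]: "velocity (ray F0 g) t = g"
proof
  fix x
  have "((\<lambda>t. ray F0 g t x) has_real_derivative g x) (at t)"
    unfolding ray_def by (auto intro!: derivative_eq_intros)
  then show "velocity (ray F0 g) t x = g x" by (intro velocity_eqI[OF open_UNIV]) auto
qed

lemma smooth_family_real_param: "open J \<Longrightarrow> smooth_family A J (\<lambda>s x. s :: real)"
  by (intro smooth_family_param smooth_on_linear bounded_linear_ident)

lemma curve_ray:
  assumes F0: "F0 \<in> C" and g: "g \<in> TC" and J: "open_interval J"
    and pos: "\<And>s x. s \<in> J \<Longrightarrow> 0 < ray F0 g s x"
  shows "curve_in_factors A \<omega> J (ray F0 g)"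
proof -
  have op: "open J" using J by (simp add: open_interval_def)
  have g': "smooth_fun A g" "E g = 0" using g by (simp_all add: tangent_functions_iff)
  have s: "smooth_family A J (ray F0 g)"
    unfolding ray_def[abs_def]
    by (intro smooth_family_add smooth_family_mult smooth_family_fun smooth_family_real_param op
        conformal_factorD[OF F0] g')
  have "E (ray F0 g t) = E (\<lambda>x. 1)" for t
  proof -
    have "E (ray F0 g t) = E F0 + t * E g"
      unfolding ray_def[abs_def] using conformal_factorD(1)[OF F0] g'
      by (simp add: int_vol_add int_vol_cmult continuous_smooth_fun continuous_on_mult_left)
    then show ?thesis using conformal_factorD(3)[OF F0] g' by simp
  qed
  then have "ray F0 g t \<in> C" if "t \<in> J" for t
    using smooth_family_at[OF op s that] pos[OF that]
    by (simp add: conformal_factors_def int_vol_def)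
  then show ?thesis using s J by (simp add: curve_in_factors_def)
qed

lemma int_one_pos: "0 < E (\<lambda>x. 1)"
  by (rule int_vol_pos) auto

text \<open>
  Every curve sits in a two-parameter family whose transversal curve at the given point is a ray in a
  prescribed tangent direction \<open>g\<close>: the curve is multiplied by \<open>1 + s g / F t\<close> and normalised.
  The family is defined over the whole parameter interval of the curve, as it has to be, because a
  derivation may depend on the interval.
\<close>

lemma ray_variation:
  assumes F: "curve_in_factors A \<omega> I F" and t: "t \<in> I" and g: "g \<in> TC" and J: "open_interval J" "0 \<in> J"
    and pos: "\<And>s x. s \<in> J \<Longrightarrow> 0 < ray (F t) g s x"
  obtains \<Phi> where "two_param_family A \<omega> J I \<Phi>" "\<Phi> 0 = F" "(\<lambda>s. \<Phi> s t) = ray (F t) g"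
proof -
  have I: "open I" "open_interval I" and sF: "smooth_family A I F" and FC: "\<And>t. t \<in> I \<Longrightarrow> F t \<in> C"
    using F by (simp_all add: curve_in_factors_def open_interval_def)
  have opJ: "open J" using J by (simp add: open_interval_def)
  note op = open_Times[OF opJ I(1)]
  define k where "k x = g x * inverse (F t x)" for x
  have Ft: "0 < F t x" for x using conformal_factorD(2)[OF FC[OF t]] .
  have g': "smooth_fun A g" "E g = 0" using g by (simp_all add: tangent_functions_iff)
  have k: "smooth_fun A k"
    unfolding k_def[abs_def]
    by (rule smooth_fun_mult[OF g'(1) smooth_fun_compose[OF conformal_factorD(1)[OF FC[OF t]] smooth_on_inverse]])
      (simp add: Ft)
  have Fk: "F t x * k x = g x" for x using Ft[of x] by (simp add: k_def)
  \<comment> \<open>The factor that normalises the integral of \<open>F t * (1 + s * k)\<close> is \<open>1 / (1 + s * a t)\<close>.\<close>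
  define a where "a t = E (\<lambda>x. F t x * k x) / E (\<lambda>x. 1)" for t
  have "smooth_on I (\<lambda>t. E (\<lambda>x. F t x * k x) * inverse (E (\<lambda>x. 1)))"
    by (intro smooth_on_mult smooth_on_const smooth_on_int_vol smooth_family_mult smooth_family_fun I sF k)
  then have sa: "smooth_on I a" by (simp add: a_def[abs_def] divide_inverse)
  have a_t: "a t = 0" using g'(2) by (simp add: a_def Fk)
  have pk: "0 < 1 + s * k x" if "s \<in> J" for s x
  proof -
    have "F t x * (1 + s * k x) = ray (F t) g s x"
      using Fk[of x] by (simp add: ray_def algebra_simps)
    then show ?thesis using pos[OF that, of x] Ft[of x] by (metis zero_less_mult_pos)
  qed
  have cF: "continuous_on UNIV (F t)" if "t \<in> I" for t
    using conformal_factorD(1)[OF FC[OF that]] by (rule continuous_smooth_fun)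
  have norm: "E (\<lambda>x. F r x * (1 + s * k x)) = (1 + s * a r) * E (\<lambda>x. 1)" if "r \<in> I" for s r
  proof -
    have "(\<lambda>x. F r x * (1 + s * k x)) = (\<lambda>x. F r x + s * (F r x * k x))"
      by (simp add: fun_eq_iff algebra_simps)
    then have "E (\<lambda>x. F r x * (1 + s * k x)) = E (F r) + s * E (\<lambda>x. F r x * k x)"
      using cF[OF that] continuous_smooth_fun[OF k]
      by (simp add: int_vol_add int_vol_cmult continuous_on_mult continuous_on_mult_left)
    then show ?thesis
      using conformal_factorD(3)[OF FC[OF that]] int_one_pos by (simp add: a_def field_simps)
  qed
  have pa: "0 < 1 + s * a r" if "s \<in> J" "r \<in> I" for s r
  proof -
    have "0 < E (\<lambda>x. F r x * (1 + s * k x))"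
    proof (rule int_vol_pos)
      show "continuous_on UNIV (\<lambda>x. F r x * (1 + s * k x))"
        by (intro continuous_intros cF that continuous_smooth_fun k)
      have p: "0 < F r x * (1 + s * k x)" for x
        using conformal_factorD(2)[OF FC[OF that(2)]] pk[OF that(1)] by simp
      show "0 \<le> F r x * (1 + s * k x)" for x using p[of x] by simp
      show "F r undefined * (1 + s * k undefined) \<noteq> 0" using p[of undefined] by (rule less_imp_neq[symmetric])
    qed
    then show ?thesis using norm[OF that(2)] int_one_pos by (metis zero_less_mult_pos2)
  qed
  define \<Phi> where "\<Phi> s r x = F r x * (1 + s * k x) * inverse (1 + s * a r)" for s r x
  have pr: "smooth_family A (J \<times> I) (\<lambda>p. F (snd p))" "smooth_family A (J \<times> I) (\<lambda>p x. a (snd p))"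
    "smooth_family A (J \<times> I) (\<lambda>p x. fst p)"
    using smooth_family_affine[OF I(1) op sF bounded_linear_snd, of 0]
      smooth_family_affine[OF I(1) op smooth_family_param[OF I(1) sa] bounded_linear_snd, of 0]
      smooth_family_affine[OF opJ op smooth_family_real_param[OF opJ] bounded_linear_fst, of 0]
    by auto
  have "smooth_family A (J \<times> I) (\<lambda>p x. F (snd p) x * (1 + fst p * k x) * inverse (1 + fst p * a (snd p)))"
    by (rule smooth_family_mult[OF op], rule smooth_family_mult[OF op pr(1)],
        rule smooth_family_add[OF op smooth_family_const], rule smooth_family_mult[OF op pr(3)],
        rule smooth_family_fun[OF op k], rule smooth_family_compose[OF op _ smooth_on_inverse],
        rule smooth_family_add[OF op smooth_family_const], rule smooth_family_mult[OF op pr(3) pr(2)])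
      (use pa in auto)
  then have s\<Phi>: "smooth2 J I \<Phi>"
    by (rule smooth_family_cong[OF op, rotated]) (auto simp: \<Phi>_def)
  have "\<Phi> s r \<in> C" if sr: "s \<in> J" "r \<in> I" for s r
  proof -
    have "E (\<Phi> s r) = inverse (1 + s * a r) * E (\<lambda>x. F r x * (1 + s * k x))"
      unfolding \<Phi>_def[abs_def] int_vol_cmult[symmetric] by (simp add: mult_ac)
    also have "\<dots> = E (\<lambda>x. 1)" unfolding norm[OF sr(2)] using pa[OF sr] by simp
    finally have "E (\<Phi> s r) = E (\<lambda>x. 1)" .
    moreover have "0 < \<Phi> s r x" for x
      using conformal_factorD(2)[OF FC[OF sr(2)]] pk[OF sr(1)] pa[OF sr] by (simp add: \<Phi>_def)
    moreover have "smooth_fun A (\<Phi> s r)"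
      using smooth_family_at[OF op s\<Phi>, of "(s, r)"] sr by simp
    ultimately show ?thesis by (simp add: conformal_factors_def int_vol_def)
  qed
  then have "two_param_family A \<omega> J I \<Phi>"
    using s\<Phi> I J by (simp add: two_param_family_def)
  moreover have "\<Phi> 0 = F" by (simp add: \<Phi>_def fun_eq_iff)
  moreover have "(\<lambda>s. \<Phi> s t) = ray (F t) g"
    using Fk by (simp add: \<Phi>_def fun_eq_iff a_t ray_def algebra_simps)
  ultimately show ?thesis by (rule that)
qed

text \<open>
  Torsion freeness, applied to \<open>ray_variation\<close>, exchanges the roles of the velocity of the curve and
  of the field. The right hand side depends on the curve only through its position and velocity at
  \<open>t\<close>.
\<close>

lemma conn_diff_exchange:
  assumes D: "lc_conn D" and D': "lc_conn D'"
    and F: "curve_in_factors A \<omega> I F" and t: "t \<in> I" and g: "g \<in> TC" and J: "open_interval J" "0 \<in> J"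
    and pos: "\<And>s x. s \<in> J \<Longrightarrow> 0 < ray (F t) g s x"
  shows "conn_diff D D' I F (\<lambda>_. g) t = conn_diff D D' J (ray (F t) g) (\<lambda>_. velocity F t) 0"
proof -
  obtain \<Phi> where \<Phi>: "two_param_family A \<omega> J I \<Phi>" "\<Phi> 0 = F" "(\<lambda>s. \<Phi> s t) = ray (F t) g"
    using ray_variation[OF F t g J pos] by blast
  note d = two_paramD[OF \<Phi>(1)]
  have f2: "field I F (pd1 \<Phi> 0)"
    using two_param_field2[OF \<Phi>(1) smooth2_pd1[OF d(1-3)] pd_tangent(1)[OF \<Phi>(1)] J(2)] \<Phi>(2) by simp
  have f1: "field J (ray (F t) g) (\<lambda>s. pd2 \<Phi> s t)"
    using two_param_field1[OF \<Phi>(1) smooth2_pd2[OF d(1-3)] pd_tangent(2)[OF \<Phi>(1)] t] \<Phi>(3) by simp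
  have v1: "pd1 \<Phi> 0 t = g" unfolding pd1_eq_velocity \<Phi>(3) by simp
  have v2: "pd2 \<Phi> 0 t = velocity F t" unfolding pd2_eq_velocity \<Phi>(2) ..
  have "D'' I F (pd1 \<Phi> 0) t = D'' J (ray (F t) g) (\<lambda>s. pd2 \<Phi> s t) 0" if "lc_conn D''" for D''
  proof -
    have "cov2 D'' I \<Phi> (pd1 \<Phi>) 0 t = cov1 D'' J \<Phi> (pd2 \<Phi>) 0 t"
      using that \<Phi>(1) J(2) t unfolding lc_conn_def torsion_free_def by blast
    then show ?thesis unfolding cov1_def cov2_def \<Phi>(2,3) .
  qed
  then have "conn_diff D D' I F (pd1 \<Phi> 0) t = conn_diff D D' J (ray (F t) g) (\<lambda>s. pd2 \<Phi> s t) 0"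
    using D D' by (simp add: conn_diff_def[abs_def])
  moreover have "conn_diff D D' I F (pd1 \<Phi> 0) t = conn_diff D D' I F (\<lambda>_. g) t"
    by (rule conn_diff_pointwise[OF D D' f2 field_const[OF F g] t v1])
  moreover have "conn_diff D D' J (ray (F t) g) (\<lambda>s. pd2 \<Phi> s t) 0
      = conn_diff D D' J (ray (F t) g) (\<lambda>_. velocity F t) 0"
    by (rule conn_diff_pointwise[OF D D' f1 field_const[OF field_alongD(6)[OF f1] velocity_curve_tangent[OF F t]] J(2) v2])
  ultimately show ?thesis by simp
qed

lemma ray_positive_near_0:
  assumes "F0 \<in> C" "g \<in> TC"
  shows "\<exists>e>0. \<forall>s x. \<bar>s\<bar> < e \<longrightarrow> 0 < ray F0 g s x"
proof -
  have c0: "continuous_on UNIV F0" and cg: "continuous_on UNIV g"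
    using conformal_factorD(1)[OF assms(1)] assms(2)
    by (auto simp: tangent_functions_iff intro: continuous_smooth_fun)
  obtain y where y: "\<And>x. F0 y \<le> F0 x"
    using continuous_attains_inf[OF compact_UNIV _ c0] by auto
  obtain K where K: "0 < K" "\<And>x. \<bar>g x\<bar> \<le> K"
    using compact_imp_bounded[OF compact_continuous_image[OF cg compact_UNIV]]
    unfolding bounded_pos by auto
  have y0: "0 < F0 y" by (rule conformal_factorD(2)[OF assms(1)])
  have "0 < ray F0 g s x" if "\<bar>s\<bar> < F0 y / K" for s x
  proof -
    have "\<bar>s * g x\<bar> \<le> \<bar>s\<bar> * K" using K(2)[of x] by (simp add: abs_mult mult_left_mono)
    also have "\<dots> < F0 y" using that K(1) by (simp add: pos_less_divide_eq)
    finally show ?thesis using y[of x] by (simp add: ray_def)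
  qed
  then show ?thesis using y0 K(1) by (intro exI[of _ "F0 y / K"]) auto
qed

text \<open>
  At a point the difference of two connections is a map \<open>B\<close> of two tangent vectors that is symmetric,
  as both are torsion free, and skew with respect to the metric. So \<open>\<langle>B(u, v), w\<rangle>\<close> changes
  sign when the last two arguments are exchanged and is unchanged when the first two are, which forces
  it to vanish.
\<close>

lemma conn_diff_zero:
  assumes D: "lc_conn D" and D': "lc_conn D'" and G: "field I F G" and t: "t \<in> I"
  shows "conn_diff D D' I F G t x = 0"
proof -
  have F: "curve_in_factors A \<omega> I F" by (rule field_alongD(6)[OF G])
  let ?F = "F t"
  have Ft: "?F \<in> C" by (rule field_alongD(4)[OF G t])
  \<comment> \<open>The difference itself is a third direction, to be paired with itself in the end. All three
    rays have to stay positive on one and the same interval, for \<open>B\<close> refers to that interval.\<close>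
  define w where "w = conn_diff D D' I F G t"
  let ?T = "{G t, velocity F t, w}"
  have T: "?T \<subseteq> TC"
    using field_alongD(5)[OF G t] velocity_curve_tangent[OF F t] conn_diff_tangent[OF D D' G t]
    by (simp add: w_def)
  have "\<exists>e>0. \<forall>g\<in>?T. \<forall>s x. \<bar>s\<bar> < e \<longrightarrow> 0 < ray ?F g s x"
  proof -
    obtain e where e: "\<And>g. g \<in> TC \<Longrightarrow> 0 < e g \<and> (\<forall>s x. \<bar>s\<bar> < e g \<longrightarrow> 0 < ray ?F g s x)"
      using ray_positive_near_0[OF Ft] by metis
    show ?thesis
      by (rule exI[of _ "Min (e ` ?T)"]) (use e T in \<open>auto simp: Min_gr_iff\<close>)
  qed
  then obtain e where e: "0 < e" "\<And>g s x. g \<in> ?T \<Longrightarrow> \<bar>s\<bar> < e \<Longrightarrow> 0 < ray ?F g s x" by blast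
  let ?J = "{-e<..<e}"
  have J: "open_interval ?J" "0 \<in> ?J" using e(1) by (auto simp: open_interval_def is_interval_oo)
  have pos: "0 < ray ?F g s x" if "g \<in> ?T" "s \<in> ?J" for g s x using e(2)[OF that(1), of s x] that(2) by auto
  have ray: "curve_in_factors A \<omega> ?J (ray ?F g)" if "g \<in> ?T" for g
    by (rule curve_ray[OF Ft subsetD[OF T that] J(1) pos[OF that]])
  define B where "B u v = conn_diff D D' ?J (ray ?F u) (\<lambda>_. v) 0" for u v
  have sym: "B u v = B v u" if "u \<in> ?T" "v \<in> ?T" for u v
    using conn_diff_exchange[OF D D' ray[OF that(1)] J(2) subsetD[OF T that(2)] J, unfolded ray_0 velocity_ray, OF pos[OF that(2)]]
    by (simp add: B_def)
  have skew: "ip ?F (B u v) w = - ip ?F (B u w) v" if "u \<in> ?T" "v \<in> ?T" "w \<in> ?T" for u v w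
    using conn_diff_skew[OF D D' field_const[OF ray[OF that(1)] subsetD[OF T that(2)]]
        field_const[OF ray[OF that(1)] subsetD[OF T that(3)]] J(2)]
    by (simp add: B_def ip_commute[of ?F v])
  have zero: "ip ?F (B u v) w = 0" if u: "u \<in> ?T" and v: "v \<in> ?T" and w: "w \<in> ?T" for u v w
  proof -
    have "ip ?F (B u v) w = - ip ?F (B v w) u" using sym[OF u v] skew[OF v u w] by simp
    also have "\<dots> = ip ?F (B w u) v" using sym[OF v w] skew[OF w v u] by simp
    also have "\<dots> = - ip ?F (B u v) w" using sym[OF w u] skew[OF u w v] by simp
    finally show ?thesis by simp
  qed
  have "w = conn_diff D D' I F (\<lambda>_. G t) t"
    unfolding w_def
    by (rule conn_diff_pointwise[OF D D' G field_const[OF F subsetD[OF T]] t]) auto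
  also have "\<dots> = B (G t) (velocity F t)"
    unfolding B_def by (rule conn_diff_exchange[OF D D' F t subsetD[OF T] J pos]) auto
  finally have "ip ?F w w = 0" using zero[of "G t" "velocity F t" w] by simp
  then have "w x = 0" using ip_definite[OF Ft, of w] T by (simp add: tangent_functions_iff)
  then show ?thesis by (simp add: w_def)
qed

lemma lc_conn_unique:
  assumes D: "lc_conn D" and D': "lc_conn D'"
  shows "D = D'"
proof (intro ext)
  fix I F G t x
  show "D I F G t x = D' I F G t x"
  proof (cases "field I F G \<and> t \<in> I")
    case True
    then show ?thesis using conn_diff_zero[OF D D', of I F G t x] by (simp add: conn_diff_def)
  next
    case False
    then show ?thesis using lc_conn_outside[OF D False] lc_conn_outside[OF D' False] by simp
  qed
qed

lemma levi_civita_eq: "levi_civita A \<omega> chi = lc_deriv"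
proof -
  have "levi_civita A \<omega> chi = (THE D. lc_conn D)"
    by (simp add: levi_civita_def lc_conn_def)
  also have "\<dots> = lc_deriv"
    using lc_conn_lc_deriv lc_conn_unique by (intro the_equality) auto
  finally show ?thesis .
qed

section \<open>The sectional curvature\<close>

text \<open>
  The terms of the curvature operator that contain derivatives of \<open>F\<close> of higher order, derivatives of
  \<open>phi\<close> or the square of \<open>phi\<close> without a factor \<open>psi\<close> cancel, as they do for the flat
  connection before projection. What remains are the terms in which the projection is differentiated or
  followed by another derivative. The constant \<open>k\<close> collects the multiples of \<open>psi (F s t)\<close>, which
  are orthogonal to the tangent space.
\<close>

lemma curvature_operator:
  assumes F: "two_param_family A \<omega> I J F" and st: "s \<in> I" "t \<in> J"
  shows "\<exists>k. \<forall>x. cov1 lc_deriv I F (cov2 lc_deriv J F (pd2 F)) s t x - cov2 lc_deriv J F (cov1 lc_deriv I F (pd2 F)) s t x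
    = psi (F s t x) * (phi (F s t x) * (lc_coeff (F s t) (pd2 F s t) (pd2 F s t) * pd1 F s t x
        - lc_coeff (F s t) (pd1 F s t) (pd2 F s t) * pd2 F s t x) + k)"
proof -
  note d = two_paramD[OF F]
  note op = d(1,2) and sF = d(3)
  note s1 = smooth2_pd1[OF op sF] and s2 = smooth2_pd2[OF op sF]
  note s12 = smooth2_pd1[OF op s2] and s22 = smooth2_pd2[OF op s2]
  note T = pd_tangent[OF F]
  note pos = conformal_factorD(2)[OF d(4)]
  define L where "L s t = lc_coeff (F s t) (pd2 F s t) (pd2 F s t)" for s t
  define N where "N s t = lc_coeff (F s t) (pd1 F s t) (pd2 F s t)" for s t
  define P where "P = cov2 lc_deriv J F (pd2 F)"
  define Q where "Q = cov1 lc_deriv I F (pd2 F)"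
  have P: "P s t x = pd2 (pd2 F) s t x + phi (F s t x) * pd2 F s t x * pd2 F s t x - L s t * psi (F s t x)"
    if "s \<in> I" "t \<in> J" for s t x
    using cov2_lc[OF F s2 T(2) that] by (simp add: P_def L_def)
  have Q: "Q s t x = pd1 (pd2 F) s t x + phi (F s t x) * pd1 F s t x * pd2 F s t x - N s t * psi (F s t x)"
    if "s \<in> I" "t \<in> J" for s t x
    using cov1_lc[OF F s2 T(2) that] by (simp add: Q_def N_def)
  have "smooth_on I (\<lambda>s. L s t)"
    unfolding L_def
    by (intro smooth_lc_coeff op smooth2_slice1[OF op _ st(2)] sF s2 d(4) st)
  then obtain L' where L': "((\<lambda>s. L s t) has_real_derivative L') (at s)"
    using smooth_on_real_derivative st(1) by blast
  have "smooth_on J (N s)"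
    unfolding N_def
    by (intro smooth_lc_coeff op smooth2_slice2[OF op _ st(1)] sF s1 s2 d(4) st)
  then obtain N' where N': "(N s has_real_derivative N') (at t)"
    using smooth_on_real_derivative st(2) by blast
  have "field I (\<lambda>s. F s t) (\<lambda>s. P s t)"
  proof -
    have f: "field J (F r) (pd2 F r)" if "r \<in> I" for r
      by (rule two_param_field2[OF F s2 T(2) that])
    have "smooth_family A I (\<lambda>s x. pd2 (pd2 F) s t x + phi (F s t x) * pd2 F s t x * pd2 F s t x - L s t * psi (F s t x))"
      by (intro smooth_family_diff smooth_family_add smooth_family_mult smooth_family_weight op
          smooth2_slice1[OF op _ st(2)] sF s2 s22 smooth_family_param \<open>smooth_on I (\<lambda>s. L s t)\<close> pos st)
    then have "smooth_family A I (\<lambda>s. P s t)"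
      by (rule smooth_family_cong[OF op(1), rotated]) (simp add: P st)
    moreover have "P r t \<in> TC" if "r \<in> I" for r
      using field_alongD(5)[OF field_lc_deriv[OF f[OF that]] st(2)] by (simp add: P_def cov2_def)
    ultimately show ?thesis using d(5)[OF st(2)] by (simp add: field_along_def)
  qed
  then have DP: "cov1 lc_deriv I F P s t x = velocity (\<lambda>s. P s t) s x + phi (F s t x) * pd1 F s t x * P s t x
      - lc_coeff (F s t) (pd1 F s t) (P s t) * psi (F s t x)" for x
    using st(1) by (simp add: cov1_def lc_deriv_def lc_formula_def pd1_eq_velocity)
  have "field J (F s) (Q s)"
  proof -
    have f: "field I (\<lambda>s. F s r) (\<lambda>s. pd2 F s r)" if "r \<in> J" for r
      by (rule two_param_field1[OF F s2 T(2) that])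
    have "smooth_family A J (\<lambda>t x. pd1 (pd2 F) s t x + phi (F s t x) * pd1 F s t x * pd2 F s t x - N s t * psi (F s t x))"
      by (intro smooth_family_diff smooth_family_add smooth_family_mult smooth_family_weight op
          smooth2_slice2[OF op _ st(1)] sF s1 s2 s12 smooth_family_param \<open>smooth_on J (N s)\<close> pos st)
    then have "smooth_family A J (Q s)"
      by (rule smooth_family_cong[OF op(2), rotated]) (simp add: Q st)
    moreover have "Q s r \<in> TC" if "r \<in> J" for r
      using field_alongD(5)[OF field_lc_deriv[OF f[OF that]] st(1)] by (simp add: Q_def cov1_def)
    ultimately show ?thesis using d(6)[OF st(1)] by (simp add: field_along_def)
  qed
  then have DQ: "cov2 lc_deriv J F Q s t x = velocity (Q s) t x + phi (F s t x) * pd2 F s t x * Q s t x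
      - lc_coeff (F s t) (pd2 F s t) (Q s t) * psi (F s t x)" for x
    using st(2) by (simp add: cov2_def lc_deriv_def lc_formula_def pd2_eq_velocity)
  have vP: "velocity (\<lambda>s. P s t) s x = pd1 (pd2 (pd2 F)) s t x
      + (((deriv phi (F s t x) * pd1 F s t x) * pd2 F s t x + pd1 (pd2 F) s t x * phi (F s t x)) * pd2 F s t x
         + pd1 (pd2 F) s t x * (phi (F s t x) * pd2 F s t x))
      - (L' * psi (F s t x) + (- 2 * phi (F s t x) * psi (F s t x) * pd1 F s t x) * L s t)" for x
    by (rule velocity_eqI[OF op(1) st(1)], erule P[OF _ st(2)])
      (intro DERIV_diff DERIV_add DERIV_mult L' DERIV_chain2[OF deriv_phi] DERIV_chain2[OF deriv_psi]
        has_pd1[OF op _ st] sF s2 s22 pos st)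
  have vQ: "velocity (Q s) t x = pd2 (pd1 (pd2 F)) s t x
      + (((deriv phi (F s t x) * pd2 F s t x) * pd1 F s t x + pd2 (pd1 F) s t x * phi (F s t x)) * pd2 F s t x
         + pd2 (pd2 F) s t x * (phi (F s t x) * pd1 F s t x))
      - (N' * psi (F s t x) + (- 2 * phi (F s t x) * psi (F s t x) * pd2 F s t x) * N s t)" for x
    by (rule velocity_eqI[OF op(2) st(2)], erule Q[OF st(1)])
      (intro DERIV_diff DERIV_add DERIV_mult N' DERIV_chain2[OF deriv_phi] DERIV_chain2[OF deriv_psi]
        has_pd2[OF op _ st] sF s1 s2 s12 pos st)
  have c1: "pd2 (pd1 F) s t x = pd1 (pd2 F) s t x" for x by (rule pd1_pd2_commute[OF op sF st])
  have c2: "pd2 (pd1 (pd2 F)) s t x = pd1 (pd2 (pd2 F)) s t x" for x by (rule pd1_pd2_commute[OF op s2 st])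
  have "cov1 lc_deriv I F P s t x - cov2 lc_deriv J F Q s t x
    = psi (F s t x) * (phi (F s t x) * (L s t * pd1 F s t x - N s t * pd2 F s t x)
      + (N' - L' + lc_coeff (F s t) (pd2 F s t) (Q s t) - lc_coeff (F s t) (pd1 F s t) (P s t)))" for x
    unfolding DP DQ vP vQ c1 c2 P[OF st] Q[OF st] by (simp add: algebra_simps)
  then show ?thesis unfolding P_def Q_def L_def N_def by blast
qed

lemma sectional_curvature_formula:
  assumes F: "two_param_family A \<omega> I J F" and st: "s \<in> I" "t \<in> J"
  shows "sectional_curvature A \<omega> chi I J F s t =
    1 / (4 * E (\<lambda>x. 1 / chi (F s t x))) *
    ((E (\<lambda>x. deriv chi (F s t x) / chi (F s t x) * (pd1 F s t x)\<^sup>2) *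
      E (\<lambda>x. deriv chi (F s t x) / chi (F s t x) * (pd2 F s t x)\<^sup>2) -
      (E (\<lambda>x. deriv chi (F s t x) / chi (F s t x) * pd1 F s t x * pd2 F s t x))\<^sup>2) /
     (E (\<lambda>x. chi (F s t x) * (pd1 F s t x)\<^sup>2) * E (\<lambda>x. chi (F s t x) * (pd2 F s t x)\<^sup>2) -
      (E (\<lambda>x. chi (F s t x) * pd1 F s t x * pd2 F s t x))\<^sup>2))"
proof -
  let ?F = "F s t" and ?u = "pd1 F s t" and ?v = "pd2 F s t"
  have FC: "?F \<in> C" by (rule two_paramD(4)[OF F st])
  note pos = conformal_factorD(2)[OF FC]
  note w = smooth_fun_weight[OF FC]
  have u: "smooth_fun A ?u" "E ?u = 0" and v: "smooth_fun A ?v"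
    using pd_tangent[OF F st] by (simp_all add: tangent_functions_iff)
  define a where "a X Y = E (\<lambda>x. phi (?F x) * X x * Y x)" for X Y
  define h where "h X Y = E (\<lambda>x. deriv chi (?F x) / chi (?F x) * X x * Y x)" for X Y
  define Z where "Z = E (\<lambda>x. psi (?F x))"
  have ah: "a X Y = h X Y / 2" for X Y
  proof -
    have "(\<lambda>x. deriv chi (?F x) / chi (?F x) * X x * Y x) = (\<lambda>x. 2 * (phi (?F x) * X x * Y x))"
      by (simp add: phi_def fun_eq_iff)
    then have "h X Y = 2 * a X Y" unfolding h_def a_def by (simp add: int_vol_cmult)
    then show ?thesis by simp
  qed
  let ?L = "lc_coeff ?F ?v ?v" and ?N = "lc_coeff ?F ?u ?v"
  have LN: "?L = a ?v ?v / Z" "?N = a ?u ?v / Z" by (simp_all add: lc_coeff_def a_def Z_def)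
  define R where "R x = cov1 lc_deriv I F (cov2 lc_deriv J F (pd2 F)) s t x
    - cov2 lc_deriv J F (cov1 lc_deriv I F (pd2 F)) s t x" for x
  \<comment> \<open>The factor \<open>psi\<close> of \<open>R\<close> cancels the weight \<open>chi\<close> of the metric.\<close>
  obtain k where k: "\<And>x. R x = psi (?F x) * (phi (?F x) * (?L * ?u x - ?N * ?v x) + k)"
    using curvature_operator[OF F st] unfolding R_def by blast
  have "chi (?F x) * R x * ?u x
      = (?L * (phi (?F x) * ?u x * ?u x) - ?N * (phi (?F x) * ?u x * ?v x)) + k * ?u x" for x
  proof -
    have "chi (?F x) * R x * ?u x = (chi (?F x) * psi (?F x)) * (phi (?F x) * (?L * ?u x - ?N * ?v x) + k) * ?u x"
      unfolding k by simp
    then show ?thesis unfolding chi_psi[OF pos] by (simp add: algebra_simps)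
  qed
  then have "ip ?F R ?u = E (\<lambda>x. (?L * (phi (?F x) * ?u x * ?u x) - ?N * (phi (?F x) * ?u x * ?v x)) + k * ?u x)"
    by (simp add: weighted_metric_def)
  also have "\<dots> = ?L * a ?u ?u - ?N * a ?u ?v + k * E ?u"
  proof -
    have "continuous_on UNIV (\<lambda>x. phi (?F x) * ?u x * ?u x)" "continuous_on UNIV (\<lambda>x. phi (?F x) * ?u x * ?v x)"
      "continuous_on UNIV ?u"
      by (intro continuous_smooth_fun smooth_fun_mult w u v)+
    then show ?thesis
      by (simp add: a_def int_vol_add int_vol_diff int_vol_cmult continuous_on_diff continuous_on_mult_left)
  qed
  also have "\<dots> = (a ?u ?u * a ?v ?v - (a ?u ?v)\<^sup>2) / Z"
    unfolding u(2) LN by (simp add: diff_divide_distrib power2_eq_square mult_ac)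
  also have "\<dots> = 1 / (4 * Z) * (h ?u ?u * h ?v ?v - (h ?u ?v)\<^sup>2)"
    unfolding ah by (simp add: field_simps power2_eq_square)
  finally have num: "ip ?F R ?u = 1 / (4 * Z) * (h ?u ?u * h ?v ?v - (h ?u ?v)\<^sup>2)" .
  have "sectional_curvature A \<omega> chi I J F s t = ip ?F R ?u / (ip ?F ?u ?u * ip ?F ?v ?v - (ip ?F ?u ?v)\<^sup>2)"
    unfolding sectional_curvature_def levi_civita_eq Let_def R_def[abs_def] ..
  then show ?thesis
    unfolding num
    by (simp add: h_def Z_def psi_def weighted_metric_def power2_eq_square mult.assoc)
qed

end

theorem theorem4p7:
  fixes A :: "('a::t2_space, 'n::finite) chart set"
    and \<omega> :: "('a, 'n) two_form"
    and chi :: "real \<Rightarrow> real"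
    and F :: "real \<Rightarrow> real \<Rightarrow> 'a \<Rightarrow> real"
    and I J :: "real set" and s t :: real
  assumes "compact_connected_kaehler_manifold A \<omega>"
    and "smooth_weight chi"
    and "two_param_family A \<omega> I J F"
    and "s \<in> I" and "t \<in> J"
    and "linearly_independent_pair (pd1 F s t) (pd2 F s t)"
  shows "sectional_curvature A \<omega> chi I J F s t =
    1 / (4 * int_vol A \<omega> (\<lambda>x. 1 / chi (F s t x))) *
    ((int_vol A \<omega> (\<lambda>x. deriv chi (F s t x) / chi (F s t x) * (pd1 F s t x)\<^sup>2) *
      int_vol A \<omega> (\<lambda>x. deriv chi (F s t x) / chi (F s t x) * (pd2 F s t x)\<^sup>2) -
      (int_vol A \<omega> (\<lambda>x. deriv chi (F s t x) / chi (F s t x) * pd1 F s t x * pd2 F s t x))\<^sup>2) /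
     (int_vol A \<omega> (\<lambda>x. chi (F s t x) * (pd1 F s t x)\<^sup>2) *
      int_vol A \<omega> (\<lambda>x. chi (F s t x) * (pd2 F s t x)\<^sup>2) -
      (int_vol A \<omega> (\<lambda>x. chi (F s t x) * pd1 F s t x * pd2 F s t x))\<^sup>2))"
proof -
  interpret weighted_factors A \<omega> chi
    using assms(1,2) by unfold_locales
  show ?thesis by (rule sectional_curvature_formula[OF assms(3-5)])
qed

end
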